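(* Let $X=\mathbb R^d$ and let $m$ be a measure on $X\times\mathbb R_+$ of the form $dm(x,s)=\frac{l(x,s)}{s}\,dx\,ds$ with $l(x,s)>0$ for all $(x,s)\in X\times\mathbb R_+$. Assume that $\int_{A\times\mathbb R_+}l(x,s)\min\{s^{-1},1\}\,dx\,ds<\infty$ for all $A\in\mathcal B_0(X)$ and that $m(\Lambda\times\mathbb R_+)<\infty$ for all $\Lambda\in\mathcal B_0(X)$. Then $\mu_m$ is quasi-invariant with respect to each $g=(\varphi,\theta)\in\mathfrak G$ and the corresponding Radon--Nikodym derivative is given by $$\frac{d\mu_m^g}{d\mu_m}(\eta)=\left(\prod_{x\in\tau(\eta)}\frac{l(\varphi^{-1}(x),\theta^{-1}(x)s_x)}{l(x,\theta^{-1}(x)s_x)}J_\varphi(x)\right)\exp\bigg[\int_X\log\left(\frac{l(x,\theta^{-1}(x)s_x)}{l(x,s_x)}\right)s_x^{-1}\,d\eta(x)+\int_X\int_{\mathbb R_+}\frac{l(x,s)-l(x,\theta^{-1}(x)s)}{s}\,ds\,dx\bigg].$$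
   Context: $\mathbb R_+=(0,\infty)$; $l:X\times\mathbb R_+\to\mathbb R_+$ is measurable; $dx$ is Lebesgue measure. $\mathcal B_0(X)$ is the collection of Borel subsets of $X$ with compact closure. $\mathbb M(X)$ is the set of Radon measures on $X$ (finite on compact sets) with the vague topology and its Borel $\sigma$-algebra. $\mathbb K(X)\subset\mathbb M(X)$ is the set of discrete Radon measures $\eta=\sum_i s_i\delta_{x_i}$ with $s_i>0$, the $x_i\in X$ distinct and at most countably many (the zero measure included), with the trace $\sigma$-algebra. For $\eta\in\mathbb K(X)$, $\tau(\eta)=\{x_i\}$ is its set of atoms and $s_x:=\eta(\{x\})$ for $x\in\tau(\eta)$. $\mu_m$ denotes the unique probability measure on $\mathbb K(X)$ with Fourier transform $\int_{\mathbb K(X)}e^{i\int f\,d\eta}\,d\mu_m(\eta)=\exp\left[\int_X\int_{\mathbb R_+}(e^{isf(x)}-1)\,dm(x,s)\right]$ for all continuous compactly supported $f:X\to\mathbb R$. $\operatorname{Diff}_0(X)$ is the group (under composition) of $C^\infty$ diffeomorphisms of $X$ equal to the identity outside a compact set. $C_0(X\to\mathbb R_+)$ is the group (under pointwise multiplication) of continuous $\theta:X\to\mathbb R_+$ equal to $1$ outside a compact set; $\theta^{-1}(x)=1/\theta(x)$. $\mathfrak G=\operatorname{Diff}_0(X)\times C_0(X\to\mathbb R_+)$ is the semidirect product with multiplication $(\varphi_1,\theta_1)(\varphi_2,\theta_2)=(\varphi_1\circ\varphi_2,\theta_1(\theta_2\circ\varphi_1^{-1}))$. It acts on $\mathbb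 M(X)$ by $d(g\eta)(x)=\theta(x)\,d(\varphi^*\eta)(x)$ for $g=(\varphi,\theta)$, where $\varphi^*\eta$ is the pushforward of $\eta$ under $\varphi$; each $g$ maps $\mathbb K(X)$ into $\mathbb K(X)$. $\mu_m^g$ is the pushforward of $\mu_m$ under $\eta\mapsto g\eta$; quasi-invariance with respect to $g$ means $\mu_m^g$ and $\mu_m$ are equivalent. $J_\varphi(x)$ is the density at $x$ of the pushforward of Lebesgue measure under $\varphi$ with respect to Lebesgue measure, i.e. $J_\varphi(x)=|\det D(\varphi^{-1})(x)|$. *)

theory Defs
  imports "HOL-Probability.Probability"
begin

section \<open>Radon measures and the vague topology\<close>

definition radon_measures :: "'a::euclidean_space measure set" where
  "radon_measures =
     {\<eta>. sets \<eta> = sets borel \<and> (\<forall>K. compact K \<longrightarrow> emeasure \<eta> K < \<infinity>)}"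

definition Cc :: "('a::euclidean_space \<Rightarrow> real) set" where
  "Cc = {f. continuous_on UNIV f \<and> compact (closure {x. f x \<noteq> 0})}"

text \<open>The carrier of the vague topology is all of \<^const>\<open>radon_measures\<close>:
  take \<open>U = UNIV\<close> in the subbasis.\<close>

definition vague_topology :: "'a::euclidean_space measure topology" where
  "vague_topology = topology_generated_by
     {{\<eta> \<in> radon_measures. (LINT x|\<eta>. f x) \<in> U} | f U. f \<in> Cc \<and> open U}"

definition vague_borel :: "'a::euclidean_space measure measure" where
  "vague_borel = sigma radon_measures {U. openin vague_topology U}"

text \<open>Here \<open>return borel x\<close> is the Dirac measure at \<open>x\<close>. A family of distinct points, at most
  countable, is given by the countable set \<open>A\<close> of its members (\<open>A = {}\<close> gives the zero measure).\<close>

definition discrete_radon :: "'a::euclidean_space measure set" where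
  "discrete_radon = {\<eta> \<in> radon_measures.
     \<exists>A s. countable A \<and> (\<forall>x\<in>A. (s x :: real) > 0) \<and>
       (\<forall>B\<in>sets borel. emeasure \<eta> B =
          (\<Sum>\<^sub>\<infinity>x\<in>A. ennreal (s x) * emeasure (return borel x) B))}"

definition discrete_borel :: "'a::euclidean_space measure measure" where
  "discrete_borel = restrict_space vague_borel discrete_radon"

definition atoms :: "'a::euclidean_space measure \<Rightarrow> 'a set" where
  "atoms \<eta> = {x. emeasure \<eta> {x} > 0}"

text \<open>Precompact Borel sets.\<close>

definition B0 :: "'a::euclidean_space set set" where
  "B0 = {A. A \<in> sets borel \<and> compact (closure A)}"


section \<open>The intensity and the random measure\<close>

abbreviation lborel_pos :: "real measure" where
  "lborel_pos \<equiv> restrict_space lborel {0<..}"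

text \<open>The measure \<open>dm(x,s) = l(x,s)/s dx ds\<close> on the product of the space with \<open>(0,\<infinity>)\<close>.\<close>

definition intensity ::
  "('a::euclidean_space \<Rightarrow> real \<Rightarrow> real) \<Rightarrow> ('a \<times> real) measure" where
  "intensity l = density (lborel \<Otimes>\<^sub>M lborel_pos) (\<lambda>(x, s). ennreal (l x s / s))"

definition has_fourier_transform ::
  "'a::euclidean_space measure measure \<Rightarrow> ('a \<times> real) measure \<Rightarrow> bool" where
  "has_fourier_transform \<mu> m \<longleftrightarrow>
     (\<forall>f\<in>Cc. (LINT \<eta>|\<mu>. iexp (LINT x|\<eta>. f x)) =
        exp (LINT p|m. (case p of (x, s) \<Rightarrow> iexp (s * f x) - 1)))"

text \<open>\<open>random_measure_law m \<mu>\<close>: \<open>\<mu>\<close> is the probability measure on the discrete Radon measures that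
  belongs to \<open>m\<close>, which is characterised by its Fourier transform.\<close>

definition random_measure_law ::
  "('a::euclidean_space \<times> real) measure \<Rightarrow> 'a measure measure \<Rightarrow> bool" where
  "random_measure_law m \<mu> \<longleftrightarrow>
     prob_space \<mu> \<and> sets \<mu> = sets discrete_borel \<and> has_fourier_transform \<mu> m"


section \<open>The transformations\<close>

text \<open>\<open>C_k_map k f\<close>: \<open>f\<close> is \<open>k\<close> times continuously differentiable on the whole space.\<close>

primrec C_k_map :: "nat \<Rightarrow> ('a::euclidean_space \<Rightarrow> 'b::real_normed_vector) \<Rightarrow> bool" where
  "C_k_map 0 f \<longleftrightarrow> continuous_on UNIV f"
| "C_k_map (Suc k) f \<longleftrightarrow> (\<forall>x. f differentiable (at x)) \<and>
     (\<forall>v. C_k_map k (\<lambda>x. frechet_derivative f (at x) v))"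

definition smooth_map :: "('a::euclidean_space \<Rightarrow> 'b::real_normed_vector) \<Rightarrow> bool" where
  "smooth_map f \<longleftrightarrow> (\<forall>k. C_k_map k f)"

definition Diff0 :: "('a::euclidean_space \<Rightarrow> 'a) set" where
  "Diff0 = {\<phi>. bij \<phi> \<and> smooth_map \<phi> \<and> smooth_map (inv \<phi>) \<and>
     (\<exists>K. compact K \<and> (\<forall>x. x \<notin> K \<longrightarrow> \<phi> x = x))}"

definition C0_pos :: "('a::euclidean_space \<Rightarrow> real) set" where
  "C0_pos = {\<theta>. continuous_on UNIV \<theta> \<and> (\<forall>x. \<theta> x > 0) \<and>
     (\<exists>K. compact K \<and> (\<forall>x. x \<notin> K \<longrightarrow> \<theta> x = 1))}"

type_synonym 'a gauge = "('a \<Rightarrow> 'a) \<times> ('a \<Rightarrow> real)"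

text \<open>The semidirect product of the two groups: its carrier, its multiplication and its action on
  measures.\<close>

definition gauge_group :: "'a::euclidean_space gauge set" where
  "gauge_group = Diff0 \<times> C0_pos"

definition gauge_mult ::
  "'a::euclidean_space gauge \<Rightarrow> 'a gauge \<Rightarrow> 'a gauge" where
  "gauge_mult g1 g2 = (case (g1, g2) of ((\<phi>1, \<theta>1), (\<phi>2, \<theta>2)) \<Rightarrow>
     (\<phi>1 \<circ> \<phi>2, \<lambda>x. \<theta>1 x * \<theta>2 (inv \<phi>1 x)))"

definition gauge_act ::
  "'a::euclidean_space gauge \<Rightarrow> 'a measure \<Rightarrow> 'a measure" where
  "gauge_act g \<eta> = (case g of (\<phi>, \<theta>) \<Rightarrow> density (distr \<eta> borel \<phi>) (\<lambda>x. ennreal (\<theta> x)))"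

definition transformed_law ::
  "'a::euclidean_space gauge \<Rightarrow> 'a measure measure \<Rightarrow> 'a measure measure" where
  "transformed_law g \<mu> = distr \<mu> discrete_borel (gauge_act g)"

definition equivalent_measures :: "'a measure \<Rightarrow> 'a measure \<Rightarrow> bool" where
  "equivalent_measures M N \<longleftrightarrow> absolutely_continuous M N \<and> absolutely_continuous N M"

definition jac :: "(real^'n \<Rightarrow> real^'n) \<Rightarrow> real^'n \<Rightarrow> real" where
  "jac \<phi> x = \<bar>det (matrix (frechet_derivative (inv \<phi>) (at x)))\<bar>"

text \<open>The product over a possibly infinite set, as the limit of the finite partial products along
  the directed set of finite subsets (the multiplicative analogue of \<^const>\<open>infsum\<close>). It is needed
  because \<^const>\<open>prod\<close> over an infinite set is \<open>1\<close> by convention.\<close>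

definition unordered_prod :: "('b \<Rightarrow> real) \<Rightarrow> 'b set \<Rightarrow> real" where
  "unordered_prod f A = Lim (finite_subsets_at_top A) (prod f)"


section \<open>The density\<close>

text \<open>The weight of an atom \<open>x\<close> is \<open>s\<^sub>x = measure \<eta> {x}\<close>. In the integral over \<open>\<eta>\<close> the points that
  are not atoms form a null set.\<close>

definition density_formula ::
  "(real^'n \<Rightarrow> real \<Rightarrow> real) \<Rightarrow> (real^'n) gauge \<Rightarrow> (real^'n) measure \<Rightarrow> real" where
  "density_formula l g \<eta> = (case g of (\<phi>, \<theta>) \<Rightarrow>
     unordered_prod (\<lambda>x. l (inv \<phi> x) (measure \<eta> {x} / \<theta> x) / l x (measure \<eta> {x} / \<theta> x) * jac \<phi> x)
       (atoms \<eta>) *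
     exp ((LINT x|\<eta>. ln (l x (measure \<eta> {x} / \<theta> x) / l x (measure \<eta> {x})) / measure \<eta> {x}) +
          (LINT x|lborel. LINT s|lborel_pos. (l x s - l x (s / \<theta> x)) / s)))"

end

theory Submission
  imports Defs
begin

text \<open>
  A discrete Radon measure is a random set of marked points \<open>(x, s)\<close>, the atoms with their weights,
  and under the law \<open>\<mu>\<close> this set is a Poisson process of intensity \<open>m\<close>. The transformation \<open>(\<phi>, \<theta>)\<close>
  moves every marked point, \<open>(x, s) \<mapsto> (\<phi> x, \<theta> (\<phi> x) s)\<close>, so it turns \<open>\<mu>\<close> into the Poisson process
  whose intensity is the image of \<open>m\<close>. A change of variables shows that this image has the density
  \<open>\<rho> (x, s) = l (inv \<phi> x) (s / \<theta> x) jac \<phi> x / l x s\<close> with respect to \<open>m\<close> (\<open>distr_mark_map\<close>). It is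
  \<open>1\<close> outside a ball, and above the ball \<open>m\<close> is finite, so almost surely there are only finitely
  many atoms in the ball. The likelihood ratio of two Poisson processes of finite intensity is the
  product of \<open>\<rho>\<close> over the points times the exponential of the difference of the total masses. Here
  the masses agree, because the transformation maps the strip above the ball onto itself. By the
  scaling invariance of \<open>ds / s\<close> the double integral in the exponent of the
  formula is zero (\<open>exponent_integral_zero\<close>), and the two remaining factors of the formula multiply
  up to the product of \<open>\<rho>\<close> (\<open>density_formula_eq\<close>).

  The law \<open>\<mu>\<close> is given by its Fourier transform only, so laws have to be identified by Fourier transforms
  (\<open>fourier_determines_law\<close>). This requires that the Borel sets of the vague topology are generated by
  the evaluations \<open>\<eta> \<mapsto> \<integral>f d\<eta>\<close>, which is a second countability statement
  (\<open>sets_vague_borel\<close>). The uniqueness is then reduced to uniqueness on the real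
  line, since the evaluations can be turned into events one at a time (\<open>complex_weight_transfer\<close>).

  The Poisson process is constructed above the ball only, as a Poisson number of independent points.
  The law of the resulting measure is the law of the restriction of \<open>\<mu>\<close> to the ball
  (\<open>distr_restrict_measure\<close>), and this restriction is independent of what \<open>\<mu>\<close> does outside
  (\<open>restriction_independent\<close>). Together they give the Fourier transform of the product of \<open>\<rho>\<close> times
  \<open>\<mu>\<close>, which is the Fourier transform of the transformed law (\<open>transformed_law_density\<close>). That the
  product is a measurable function of the measure, although it is defined through the atoms, rests on the
  joint measurability of \<open>(\<eta>, x) \<mapsto> \<eta> {x}\<close> (\<open>atom_sum_measurable\<close>).
\<close>

section \<open>Change of variables in spaces with an arbitrary finite index type\<close>

text \<open>The theorem on differentiable images that relates volumes and determinants presupposes a well-ordered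
  index type. The ranks \<open>0, \<dots>, CARD('n) - 1\<close> carry the order of the natural numbers, and they turn an arbitrary
  finite index type into a well-ordered one of the same size.\<close>

typedef ('n::finite) index_rank = "{..<CARD('n)} :: nat set"
  by (auto intro!: exI[of _ 0])

setup_lifting type_definition_index_rank

instantiation index_rank :: (finite) linorder
begin
lift_definition less_eq_index_rank :: "'a index_rank \<Rightarrow> 'a index_rank \<Rightarrow> bool" is "(\<le>)" .
lift_definition less_index_rank :: "'a index_rank \<Rightarrow> 'a index_rank \<Rightarrow> bool" is "(<)" .
instance by standard (transfer; auto)+
end

lemma index_rank_finite: "finite (UNIV :: 'n::finite index_rank set)"
  by (metis finite_imageI finite_lessThan type_definition.Abs_image type_definition_index_rank)

instance index_rank :: (finite) finite
  by standard (rule index_rank_finite)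

instance index_rank :: (finite) wellorder
proof
  fix P :: "'a index_rank \<Rightarrow> bool" and a
  assume step: "\<And>x. (\<And>y. y < x \<Longrightarrow> P y) \<Longrightarrow> P x"
  show "P a"
  proof (induction "Rep_index_rank a" arbitrary: a rule: less_induct)
    case less
    show ?case by (rule step) (auto intro: less simp: less_index_rank.rep_eq)
  qed
qed

lemma ex_bij_index_rank: "\<exists>b :: 'n::finite index_rank \<Rightarrow> 'n. bij b"
proof -
  have "card (UNIV :: 'n index_rank set) = CARD('n)"
    by (simp add: type_definition.card[OF type_definition_index_rank])
  then show ?thesis
    by (metis finite_same_card_bij finite)
qed

definition reindex :: "('m \<Rightarrow> 'n) \<Rightarrow> real^'n::finite \<Rightarrow> real^'m::finite" where
  "reindex b x = (\<chi> i. x $ b i)"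

lemma linear_reindex: "linear (reindex b)"
  by (auto intro!: linearI simp: reindex_def vec_eq_iff)

lemma continuous_on_reindex [continuous_intros]: "continuous_on A (reindex b)"
  by (intro linear_continuous_on linear_conv_bounded_linear[THEN iffD1] linear_reindex)

lemma borel_measurable_reindex [measurable]: "reindex b \<in> borel_measurable borel"
  by (intro borel_measurable_continuous_onI continuous_on_reindex)

lemma reindex_inverse:
  fixes b :: "'m::finite \<Rightarrow> 'n::finite"
  assumes "bij b" shows "reindex b (reindex (inv b) x) = x" "reindex (inv b) (reindex b y) = y"
  using assms by (auto simp: reindex_def vec_eq_iff bij_is_inj bij_is_surj surj_f_inv_f)

lemma prod_Basis_cart: "(\<Prod>b\<in>Basis. f ((x::real^'n::finite) \<bullet> b)) = (\<Prod>i\<in>UNIV. f (x $ i))"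
proof -
  have B: "(Basis :: (real^'n) set) = (\<lambda>i. axis i 1) ` UNIV"
    by (auto simp: Basis_vec_def)
  have "inj (\<lambda>i::'n. axis i (1::real))"
    by (auto simp: inj_def axis_eq_axis)
  from prod.reindex[OF this, of "\<lambda>b. f (x \<bullet> b)"]
  have "(\<Prod>b\<in>Basis. f (x \<bullet> b)) = (\<Prod>i\<in>UNIV. f (x \<bullet> axis i 1))"
    unfolding B by (simp add: o_def)
  then show ?thesis by (simp add: inner_axis)
qed

text \<open>A permutation of the coordinates maps boxes to boxes with the same side lengths.\<close>

lemma distr_lborel_reindex:
  fixes b :: "'m::finite \<Rightarrow> 'n::finite"
  assumes b: "bij b"
  shows "distr lborel borel (reindex b) = lborel"
proof (rule lborel_eqI[symmetric])
  fix l u :: "real^'m"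
  assume le: "\<And>a. a \<in> Basis \<Longrightarrow> l \<bullet> a \<le> u \<bullet> a"
  have le': "l $ i \<le> u $ i" for i
    using le[of "axis i 1"] by (auto simp: inner_axis Basis_vec_def)
  have "reindex b -` box l u = box (reindex (inv b) l) (reindex (inv b) u)"
    using b by (auto simp: reindex_def mem_box_cart bij_is_inj)
      (metis b bij_inv_eq_iff)+
  then have "emeasure (distr lborel borel (reindex b)) (box l u)
      = emeasure lborel (box (reindex (inv b) l) (reindex (inv b) u))"
    by (simp add: emeasure_distr)
  also have "\<dots> = (\<Prod>a\<in>Basis. (reindex (inv b) u - reindex (inv b) l) \<bullet> a)"
    by (intro emeasure_lborel_box)
      (auto simp: Basis_vec_def inner_axis reindex_def le')
  also have "\<dots> = (\<Prod>i\<in>UNIV. (u - l) $ inv b i)"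
    using prod_Basis_cart[of "\<lambda>t. t" "reindex (inv b) u - reindex (inv b) l"] by (simp add: reindex_def)
  also have "\<dots> = (\<Prod>i\<in>UNIV. (u - l) $ i)"
    using prod.reindex_bij_betw[OF bij_imp_bij_inv[OF b], of "\<lambda>i. (u - l) $ i"] by simp
  also have "\<dots> = (\<Prod>a\<in>Basis. (u - l) \<bullet> a)"
    using prod_Basis_cart[of "\<lambda>t. t" "u - l"] by simp
  finally show "emeasure (distr lborel borel (reindex b)) (box l u) = (\<Prod>a\<in>Basis. (u - l) \<bullet> a)" .
qed simp

text \<open>Conjugation by \<open>b\<close> is a sign preserving bijection between the permutations in the two Leibniz formulas.\<close>

lemma det_reindex:
  fixes b :: "'m::finite \<Rightarrow> 'n::finite" and A :: "real^'n^'n"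
  assumes b: "bij b"
  shows "det (\<chi> i j. A $ b i $ b j) = det A"
proof -
  let ?c = "map_permutation UNIV b"
  have bb: "bij_betw ?c {p. p permutes (UNIV::'m set)} {p. p permutes (UNIV::'n set)}"
  proof -
    have "?c = (\<lambda>p x. if x \<in> UNIV then b (p (inv_into UNIV b x)) else x)"
      using b by (auto simp: fun_eq_iff map_permutation_def restrict_id_def bij_is_surj)
    then show ?thesis using bij_betw_permutations[of b UNIV UNIV] b by simp
  qed
  have inj: "inj b" using b by (rule bij_is_inj)
  have *: "of_int (sign p) * (\<Prod>i\<in>UNIV. (\<chi> i j. A $ b i $ b j) $ i $ p i) =
      of_int (sign (?c p)) * (\<Prod>i\<in>UNIV. A $ i $ ?c p i)" if "p permutes UNIV" for p :: "'m \<Rightarrow> 'm"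
  proof -
    have "sign (?c p) = sign p" using that inj by (intro sign_map_permutation) auto
    moreover have "(\<Prod>i\<in>UNIV. A $ i $ ?c p i) = (\<Prod>i\<in>UNIV. A $ b i $ ?c p (b i))"
      using prod.reindex_bij_betw[OF b, of "\<lambda>i. A $ i $ ?c p i"] by simp
    moreover have "?c p (b i) = b (p i)" for i
      using b by (simp add: map_permutation_def restrict_id_def inj bij_is_surj)
    ultimately show ?thesis by simp
  qed
  show ?thesis unfolding det_def
    using sum.reindex_bij_betw[OF bb, of "\<lambda>p. of_int (sign p) * (\<Prod>i\<in>UNIV. A $ i $ p i)"]
    by (subst sum.cong[OF refl *]) auto
qed

text \<open>Both sides may be infinite: the image of \<open>A\<close> has finite measure if and only if the Jacobian is
  integrable over \<open>A\<close>, and in that case the classical formula applies.\<close>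

lemma emeasure_differentiable_image_wellorder:
  fixes \<psi> :: "real^'m::{finite,wellorder} \<Rightarrow> real^'m::_"
  assumes der: "\<And>x. (\<psi> has_derivative D x) (at x)" and inj: "inj \<psi>"
    and img: "\<psi> ` A \<in> sets borel"
    and [measurable]: "(\<lambda>x. \<bar>det (matrix (D x))\<bar>) \<in> borel_measurable borel" "A \<in> sets borel"
  shows "emeasure lborel (\<psi> ` A) = (\<integral>\<^sup>+x\<in>A. ennreal \<bar>det (matrix (D x))\<bar> \<partial>lborel)"
proof -
  have derA: "(\<psi> has_derivative D x) (at x within A)" for x
    using der has_derivative_at_withinI by blast
  have A: "A \<in> sets lebesgue" by simp
  have injA: "inj_on \<psi> A" using inj by (rule inj_on_subset) auto
  show ?thesis
  proof (cases "emeasure lborel (\<psi> ` A) < \<infinity>")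
    case True
    have lm: "\<psi> ` A \<in> lmeasurable"
      using True img by (auto simp: fmeasurable_def)
    then have "((\<lambda>x. \<bar>det (matrix (D x))\<bar>) has_integral measure lebesgue (\<psi> ` A)) A"
      using has_measure_differentiable_image[OF A derA injA] by blast
    then have "(\<integral>\<^sup>+x\<in>A. ennreal \<bar>det (matrix (D x))\<bar> \<partial>lborel) = ennreal (measure lebesgue (\<psi> ` A))"
      by (intro nn_integral_has_integral_lebesgue') auto
    also have "\<dots> = emeasure lborel (\<psi> ` A)"
      using True img by (simp add: measure_completion emeasure_eq_ennreal_measure)
    finally show ?thesis by simp
  next
    case False
    have "\<not> (\<integral>\<^sup>+x\<in>A. ennreal \<bar>det (matrix (D x))\<bar> \<partial>lborel) < \<infinity>"
    proof
      assume *: "(\<integral>\<^sup>+x\<in>A. ennreal \<bar>det (matrix (D x))\<bar> \<partial>lborel) < \<infinity>"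
      have "integrable lborel (\<lambda>x. indicator A x *\<^sub>R \<bar>det (matrix (D x))\<bar>)"
        unfolding integrable_iff_bounded
      proof
        have "(\<integral>\<^sup>+x. ennreal (norm (indicator A x *\<^sub>R \<bar>det (matrix (D x))\<bar>)) \<partial>lborel) =
          (\<integral>\<^sup>+x\<in>A. ennreal \<bar>det (matrix (D x))\<bar> \<partial>lborel)"
          by (intro nn_integral_cong) (auto split: split_indicator)
        with * show "(\<integral>\<^sup>+x. ennreal (norm (indicator A x *\<^sub>R \<bar>det (matrix (D x))\<bar>)) \<partial>lborel) < \<infinity>" by simp
      qed simp
      then have "(\<lambda>x. \<bar>det (matrix (D x))\<bar>) integrable_on A"
        by (metis set_borel_integral_eq_integral(1) set_integrable_def)
      then have "\<psi> ` A \<in> lmeasurable"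
        using measurable_differentiable_image_eq[OF A derA injA] by blast
      then show False using False img by (auto simp: fmeasurable_def)
    qed
    with False show ?thesis by (simp add: top.not_eq_extremum[symmetric])
  qed
qed

text \<open>Renaming the coordinates conjugates \<open>\<psi>\<close> by an isometry, which changes neither volumes nor
  Jacobian determinants.\<close>

lemma emeasure_differentiable_image:
  fixes \<psi> :: "real^'n::finite \<Rightarrow> real^'n"
  assumes der: "\<And>x. (\<psi> has_derivative D x) (at x)" and inj: "inj \<psi>"
    and img: "\<psi> ` A \<in> sets borel"
    and [measurable]: "(\<lambda>x. \<bar>det (matrix (D x))\<bar>) \<in> borel_measurable borel" "A \<in> sets borel"
  shows "emeasure lborel (\<psi> ` A) = (\<integral>\<^sup>+x\<in>A. ennreal \<bar>det (matrix (D x))\<bar> \<partial>lborel)"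
proof -
  obtain b :: "'n index_rank \<Rightarrow> 'n" where b: "bij b" using ex_bij_index_rank by blast
  define L :: "real^'n \<Rightarrow> real^'n index_rank" where "L = reindex b"
  define L' :: "real^'n index_rank \<Rightarrow> real^'n" where "L' = reindex (inv b)"
  have LL' [simp]: "L (L' x) = x" and L'L [simp]: "L' (L y) = y" for x y
    using reindex_inverse[OF b] by (auto simp: L_def L'_def)
  have [measurable]: "L \<in> borel_measurable borel" "L' \<in> borel_measurable borel"
    by (auto simp: L_def L'_def)
  have bl: "bounded_linear L" "bounded_linear L'"
    by (auto simp: L_def L'_def linear_reindex linear_conv_bounded_linear[symmetric])
  have dL: "distr lborel borel L = lborel"
    unfolding L_def by (rule distr_lborel_reindex[OF b])
  have img_L: "L ` B = L' -` B" for B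
    by (auto simp: image_iff) (metis LL')
  have emL: "emeasure lborel B = emeasure lborel (L ` B)" if [measurable]: "B \<in> sets borel" for B
  proof -
    have "L -` L' -` B = B" by auto
    moreover have "emeasure lborel (L' -` B) = emeasure (distr lborel borel L) (L' -` B)"
      by (simp add: dL)
    moreover have "L' -` B \<in> sets borel" using measurable_sets_borel[of L' borel B] by auto
    ultimately show ?thesis by (simp add: emeasure_distr img_L)
  qed
  define \<psi>' where "\<psi>' = L \<circ> \<psi> \<circ> L'"
  define D' where "D' x = L \<circ> D (L' x) \<circ> L'" for x
  have der': "(\<psi>' has_derivative D' x) (at x)" for x
  proof -
    have 1: "(L' has_derivative L') (at x)" "(L has_derivative L) (at (\<psi> (L' x)))"
      using bl by (auto intro: bounded_linear_imp_has_derivative)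
    show ?thesis unfolding \<psi>'_def D'_def
      by (auto intro!: diff_chain_at 1 der simp: o_assoc)
  qed
  have det: "det (matrix (D' x)) = det (matrix (D (L' x)))" for x
  proof -
    have "matrix (D' x) = (\<chi> i j. matrix (D (L' x)) $ b i $ b j)"
    proof -
      have ax: "L' (axis j 1) = axis (b j) 1" for j
        using b by (auto simp: L'_def reindex_def vec_eq_iff axis_def bij_inv_eq_iff bij_is_inj)
      then show ?thesis
        by (simp add: matrix_def D'_def L_def reindex_def ax)
    qed
    then show ?thesis using det_reindex[OF b] by simp
  qed
  have sets: "L ` B \<in> sets borel" if "B \<in> sets borel" for B
    using that measurable_sets_borel[of L' borel B] by (simp add: img_L)
  have eq: "\<psi>' ` (L ` A) = L ` (\<psi> ` A)"
    by (auto simp: \<psi>'_def image_comp)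
  have "emeasure lborel (\<psi> ` A) = emeasure lborel (L ` \<psi> ` A)"
    by (rule emL[OF img])
  also have "\<dots> = (\<integral>\<^sup>+x\<in>L ` A. ennreal \<bar>det (matrix (D' x))\<bar> \<partial>lborel)"
    unfolding eq[symmetric]
  proof (rule emeasure_differentiable_image_wellorder[OF der'])
    show "inj \<psi>'" using inj unfolding \<psi>'_def
      by (auto simp: inj_def) (metis L'L LL')
    show "\<psi>' ` L ` A \<in> sets borel" unfolding eq by (intro sets img)
    show "L ` A \<in> sets borel" by (intro sets) simp
    show "(\<lambda>x. \<bar>det (matrix (D' x))\<bar>) \<in> borel_measurable borel"
      unfolding det by measurable
  qed
  also have "\<dots> = (\<integral>\<^sup>+x. ennreal \<bar>det (matrix (D (L' x)))\<bar> * indicator (L ` A) x \<partial>distr lborel borel L)"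
    by (simp add: det dL)
  also have "\<dots> = (\<integral>\<^sup>+x. ennreal \<bar>det (matrix (D x))\<bar> * indicator (L ` A) (L x) \<partial>lborel)"
    using sets[of A] by (subst nn_integral_distr) auto
  also have "\<dots> = (\<integral>\<^sup>+x\<in>A. ennreal \<bar>det (matrix (D x))\<bar> \<partial>lborel)"
    by (intro nn_integral_cong) (auto simp: img_L split: split_indicator)
  finally show ?thesis .
qed

section \<open>Diffeomorphisms and the transformed intensity\<close>

lemma
  assumes "\<phi> \<in> Diff0"
  shows Diff0_bij: "bij \<phi>" and Diff0_smooth: "smooth_map \<phi>" and Diff0_smooth_inv: "smooth_map (inv \<phi>)"
    and Diff0_support: "\<exists>K. compact K \<and> (\<forall>x. x \<notin> K \<longrightarrow> \<phi> x = x)"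
  using assms by (auto simp: Diff0_def)

lemma smooth_map_continuous_on: "smooth_map f \<Longrightarrow> continuous_on UNIV f"
  unfolding smooth_map_def by (metis C_k_map.simps(1))

lemma smooth_map_has_derivative:
  assumes "smooth_map f" shows "(f has_derivative frechet_derivative f (at x)) (at x)"
proof -
  have "C_k_map (Suc 0) f" using assms unfolding smooth_map_def by blast
  then show ?thesis by (auto simp: frechet_derivative_works)
qed

lemma smooth_map_continuous_derivative:
  assumes "smooth_map f" shows "continuous_on UNIV (\<lambda>x. frechet_derivative f (at x) v)"
proof -
  have "C_k_map (Suc 0) f" using assms unfolding smooth_map_def by blast
  then show ?thesis by simp
qed

lemma Diff0_continuous: "\<phi> \<in> Diff0 \<Longrightarrow> continuous_on UNIV \<phi>"
  by (rule smooth_map_continuous_on[OF Diff0_smooth])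

lemma Diff0_continuous_inv: "\<phi> \<in> Diff0 \<Longrightarrow> continuous_on UNIV (inv \<phi>)"
  by (rule smooth_map_continuous_on[OF Diff0_smooth_inv])

lemma borel_measurable_jac:
  assumes "\<phi> \<in> Diff0" shows "jac \<phi> \<in> borel_measurable borel"
proof -
  have "continuous_on UNIV (jac \<phi>)"
    unfolding jac_def det_def matrix_def
    by (auto intro!: continuous_intros smooth_map_continuous_derivative Diff0_smooth_inv assms)
  then show ?thesis by (rule borel_measurable_continuous_onI)
qed

text \<open>The derivatives of \<open>\<phi>\<close> and \<open>inv \<phi>\<close> are inverse to each other by the chain rule.\<close>

lemma jac_pos:
  assumes "\<phi> \<in> Diff0" shows "jac \<phi> x > 0"
proof -
  let ?D = "frechet_derivative (inv \<phi>) (at x)" and ?E = "frechet_derivative \<phi> (at (inv \<phi> x))"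
  have D: "(inv \<phi> has_derivative ?D) (at x)"
    by (rule smooth_map_has_derivative[OF Diff0_smooth_inv[OF assms]])
  have E: "(\<phi> has_derivative ?E) (at (inv \<phi> x))"
    by (rule smooth_map_has_derivative[OF Diff0_smooth[OF assms]])
  have "\<phi> \<circ> inv \<phi> = (\<lambda>x. x)"
    using Diff0_bij[OF assms] by (auto simp: fun_eq_iff bij_is_surj surj_f_inv_f)
  with diff_chain_at[OF D E] have "((\<lambda>x. x) has_derivative ?E \<circ> ?D) (at x)" by simp
  then have "?E \<circ> ?D = (\<lambda>x. x)"
    by (rule has_derivative_unique) (rule has_derivative_ident)
  then have "matrix ?E ** matrix ?D = mat 1"
    using matrix_compose[OF has_derivative_linear[OF D] has_derivative_linear[OF E]]
    by (simp add: matrix_id_mat_1[unfolded id_def])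
  then have "det (matrix ?E) * det (matrix ?D) = 1"
    using det_mul[of "matrix ?E" "matrix ?D"] by simp
  then have "det (matrix ?D) \<noteq> 0" by auto
  then show ?thesis by (simp add: jac_def)
qed

lemma distr_lborel_Diff0:
  assumes \<phi>: "\<phi> \<in> Diff0"
  shows "distr lborel borel \<phi> = density lborel (\<lambda>x. ennreal (jac \<phi> x))"
proof (rule measure_eqI)
  have [measurable]: "\<phi> \<in> borel_measurable borel" "jac \<phi> \<in> borel_measurable borel"
    using \<phi> by (auto intro: borel_measurable_continuous_onI Diff0_continuous borel_measurable_jac)
  fix A assume "A \<in> sets (distr lborel borel \<phi>)"
  then have A [measurable]: "A \<in> sets borel" by simp
  have b: "bij \<phi>" by (rule Diff0_bij[OF \<phi>])
  have img: "inv \<phi> ` A = \<phi> -` A"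
    using b by (auto simp: bij_vimage_eq_inv_image)
  have "\<phi> -` A \<in> sets borel" using measurable_sets_borel[of \<phi> borel A] by simp
  moreover have "inj (inv \<phi>)" using bij_imp_bij_inv[OF b] by (rule bij_is_inj)
  ultimately have "emeasure lborel (inv \<phi> ` A) = (\<integral>\<^sup>+x\<in>A. ennreal \<bar>det (matrix (frechet_derivative (inv \<phi>) (at x)))\<bar> \<partial>lborel)"
    using borel_measurable_jac[OF \<phi>]
    by (intro emeasure_differentiable_image smooth_map_has_derivative Diff0_smooth_inv[OF \<phi>])
      (auto simp: img jac_def[abs_def])
  then show "emeasure (distr lborel borel \<phi>) A = emeasure (density lborel (\<lambda>x. ennreal (jac \<phi> x))) A"
    by (simp add: emeasure_distr emeasure_density img) (simp add: jac_def)
qed simp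

abbreviation mark_space :: "('a::euclidean_space \<times> real) measure" where
  "mark_space \<equiv> lborel \<Otimes>\<^sub>M lborel_pos"

lemma space_mark_space [simp]: "space mark_space = UNIV \<times> {0<..}"
  by (simp add: space_pair_measure)

lemma borel_measurable_mark [measurable]:
  "snd \<in> borel_measurable (mark_space :: ('a::euclidean_space \<times> real) measure)"
  by (rule measurable_compose[OF measurable_snd]) (auto intro: measurable_restrict_space1)

lemma mark_rescale_measurable:
  fixes f :: "'a::euclidean_space \<Rightarrow> 'a"
  assumes [measurable]: "f \<in> borel_measurable borel" "c \<in> borel_measurable borel"
    and pos: "\<And>x. c x > (0::real)"
  shows "(\<lambda>(x, s). (f x, c x * s)) \<in> mark_space \<rightarrow>\<^sub>M mark_space"
proof -
  have 1: "(\<lambda>p. f (fst p)) \<in> mark_space \<rightarrow>\<^sub>M lborel" by measurable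
  have 2: "(\<lambda>p. c (fst p) * snd p) \<in> mark_space \<rightarrow>\<^sub>M lborel_pos"
  proof (rule measurable_restrict_space2)
    show "(\<lambda>p. c (fst p) * snd p) \<in> space mark_space \<rightarrow> {0<..}"
      by (auto simp: pos)
  qed measurable
  from measurable_Pair[OF 1 2] show ?thesis unfolding case_prod_beta .
qed

text \<open>The measure \<open>ds / s\<close> is the Haar measure of the multiplicative group of positive numbers.\<close>

lemma nn_integral_lborel_pos_scale:
  assumes [measurable]: "H \<in> borel_measurable lborel_pos" and c: "(c::real) > 0"
  shows "(\<integral>\<^sup>+s. H (c * s) * ennreal (1 / s) \<partial>lborel_pos) = (\<integral>\<^sup>+t. H t * ennreal (1 / t) \<partial>lborel_pos)"
proof -
  have [measurable]: "(\<lambda>t. t) \<in> borel_measurable lborel_pos"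
    by (rule measurable_restrict_space1) simp
  define f where "f t = H t * ennreal (1 / t) * indicator {0<..} t" for t
  have [measurable]: "f \<in> borel_measurable lborel"
    using borel_measurable_restrict_space_iff_ennreal[of "{0<..}" lborel "\<lambda>t. H t * ennreal (1 / t)"]
    unfolding f_def[abs_def] by simp
  have "(\<integral>\<^sup>+t. H t * ennreal (1 / t) \<partial>lborel_pos) = (\<integral>\<^sup>+t. f t \<partial>lborel)"
    by (simp add: nn_integral_restrict_space f_def)
  also have "\<dots> = ennreal \<bar>c\<bar> * (\<integral>\<^sup>+s. f (0 + c * s) \<partial>lborel)"
    using c by (intro nn_integral_real_affine) auto
  also have "\<dots> = (\<integral>\<^sup>+s. ennreal \<bar>c\<bar> * f (c * s) \<partial>lborel)"
    by (simp add: nn_integral_cmult)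
  also have "\<dots> = (\<integral>\<^sup>+s. H (c * s) * ennreal (1 / s) * indicator {0<..} s \<partial>lborel)"
  proof (intro nn_integral_cong)
    fix s :: real
    show "ennreal \<bar>c\<bar> * f (c * s) = H (c * s) * ennreal (1 / s) * indicator {0<..} s"
    proof (cases "s > 0")
      case True
      have "ennreal c * (H (c * s) * ennreal (1 / (c * s))) = H (c * s) * ennreal (c * (1 / (c * s)))"
        using c True by (subst ennreal_mult) (auto simp: mult_ac)
      then show ?thesis using c True by (simp add: f_def)
    next
      case False
      then show ?thesis using c by (auto simp: f_def zero_less_mult_iff)
    qed
  qed
  also have "\<dots> = (\<integral>\<^sup>+s. H (c * s) * ennreal (1 / s) \<partial>lborel_pos)"
    by (simp add: nn_integral_restrict_space)
  finally show ?thesis by simp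
qed

locale gauge_transform =
  fixes l :: "real^'n::finite \<Rightarrow> real \<Rightarrow> real"
    and \<phi> :: "real^'n \<Rightarrow> real^'n" and \<theta> :: "real^'n \<Rightarrow> real"
  assumes l_meas [measurable]: "(\<lambda>(x, s). l x s) \<in> borel_measurable mark_space"
    and l_pos: "\<And>x s. s > 0 \<Longrightarrow> l x s > 0"
    and phi: "\<phi> \<in> Diff0" and theta: "\<theta> \<in> C0_pos"
begin

lemma theta_pos [simp]: "\<theta> x > 0" and theta_nonneg [simp]: "0 \<le> \<theta> x" and theta_neq0 [simp]: "\<theta> x \<noteq> 0"
  using theta by (auto simp: C0_pos_def order.strict_implies_order less_imp_neq[symmetric])

lemma theta_continuous: "continuous_on UNIV \<theta>"
  using theta by (auto simp: C0_pos_def)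

lemma phi_measurable [measurable]: "\<phi> \<in> borel_measurable borel"
  and inv_phi_measurable [measurable]: "inv \<phi> \<in> borel_measurable borel"
  and theta_measurable [measurable]: "\<theta> \<in> borel_measurable borel"
  and jac_measurable [measurable]: "jac \<phi> \<in> borel_measurable borel"
  using phi theta_continuous
  by (auto intro: borel_measurable_continuous_onI Diff0_continuous Diff0_continuous_inv borel_measurable_jac)

lemma inv_phi_phi [simp]: "inv \<phi> (\<phi> x) = x" and phi_inv_phi [simp]: "\<phi> (inv \<phi> x) = x"
  using Diff0_bij[OF phi] by (auto simp: bij_is_inj bij_is_surj surj_f_inv_f)

text \<open>The effect of the transformation on a single marked point.\<close>

definition mark_map :: "(real^'n) \<times> real \<Rightarrow> (real^'n) \<times> real" where
  "mark_map = (\<lambda>(x, s). (\<phi> x, \<theta> (\<phi> x) * s))"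

text \<open>The density of the image of the intensity under \<^const>\<open>mark_map\<close> with respect to the intensity.\<close>

definition mark_density :: "(real^'n) \<Rightarrow> real \<Rightarrow> real" where
  "mark_density x s = l (inv \<phi> x) (s / \<theta> x) * jac \<phi> x / l x s"

lemma mark_map_measurable [measurable]: "mark_map \<in> mark_space \<rightarrow>\<^sub>M mark_space"
  unfolding mark_map_def
  using mark_rescale_measurable[of \<phi> "\<lambda>x. \<theta> (\<phi> x)"] by simp

lemma l_moved_measurable [measurable]:
  "(\<lambda>(x, s). l (inv \<phi> x) (s / \<theta> x)) \<in> borel_measurable mark_space"
proof -
  have "(\<lambda>(x, s). (inv \<phi> x, inverse (\<theta> x) * s)) \<in> mark_space \<rightarrow>\<^sub>M mark_space"
    by (rule mark_rescale_measurable) auto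
  from measurable_compose[OF this l_meas] show ?thesis
    by (simp add: case_prod_beta divide_inverse mult.commute)
qed

lemma mark_density_measurable [measurable]:
  "(\<lambda>(x, s). mark_density x s) \<in> borel_measurable mark_space"
proof -
  have [measurable]: "(\<lambda>p. l (fst p) (snd p)) \<in> borel_measurable mark_space"
    "(\<lambda>p. l (inv \<phi> (fst p)) (snd p / \<theta> (fst p))) \<in> borel_measurable mark_space"
    using l_meas l_moved_measurable by (auto simp: case_prod_beta)
  show ?thesis unfolding mark_density_def case_prod_beta by measurable
qed

lemma mark_density_pos: "s > 0 \<Longrightarrow> mark_density x s > 0"
  by (simp add: mark_density_def l_pos jac_pos[OF phi])

lemma sigma_finite_lborel_pos: "sigma_finite_measure lborel_pos"
  by (rule sigma_finite_measure_restrict_space[OF sigma_finite_lborel]) simp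

lemma nn_integral_mark_space:
  assumes "f \<in> borel_measurable (mark_space :: ((real^'n) \<times> real) measure)"
  shows "integral\<^sup>N mark_space f = (\<integral>\<^sup>+x. \<integral>\<^sup>+s. f (x, s) \<partial>lborel_pos \<partial>lborel)"
  using sigma_finite_measure.nn_integral_fst[OF sigma_finite_lborel_pos assms] by simp

text \<open>For fixed \<open>x\<close> the dilation by \<open>\<theta> (\<phi> x)\<close> is absorbed by the scaling invariance of \<open>ds / s\<close>; the factors
  \<open>l\<close> are carried along. What remains is an integral over \<open>x\<close> of a function of \<open>\<phi> x\<close>, to which the change of
  variables \<open>y = \<phi> x\<close> applies.\<close>

lemma nn_integral_mark_map:
  assumes h [measurable]: "h \<in> borel_measurable mark_space"
  shows "(\<integral>\<^sup>+p. h (mark_map p) \<partial>intensity l) = (\<integral>\<^sup>+p. h p * ennreal (mark_density (fst p) (snd p)) \<partial>intensity l)"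
proof -
  interpret sigma_finite_measure lborel_pos by (rule sigma_finite_lborel_pos)
  have [measurable]: "(\<lambda>p. l (fst p) (snd p)) \<in> borel_measurable mark_space"
    "(\<lambda>p. l (inv \<phi> (fst p)) (snd p / \<theta> (fst p))) \<in> borel_measurable mark_space"
    "(\<lambda>p. mark_density (fst p) (snd p)) \<in> borel_measurable mark_space"
    using l_meas l_moved_measurable mark_density_measurable unfolding case_prod_beta by blast+
  \<comment> \<open>the inner integral as a function of the new point \<open>y = \<phi> x\<close>\<close>
  define K where "K y = (\<integral>\<^sup>+t. h (y, t) * ennreal (l (inv \<phi> y) (t / \<theta> y)) * ennreal (1 / t) \<partial>lborel_pos)" for y
  have hm: "(\<lambda>p. h p * ennreal (l (inv \<phi> (fst p)) (snd p / \<theta> (fst p)))) \<in> borel_measurable mark_space"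
    by measurable
  have "(\<lambda>p. h p * ennreal (l (inv \<phi> (fst p)) (snd p / \<theta> (fst p))) * ennreal (1 / snd p)) \<in> borel_measurable mark_space"
    by measurable
  from borel_measurable_nn_integral_fst[OF this]
  have [measurable]: "K \<in> borel_measurable borel" by (simp add: K_def[abs_def])
  have "(\<integral>\<^sup>+p. h (mark_map p) \<partial>intensity l)
      = (\<integral>\<^sup>+p. ennreal (l (fst p) (snd p) / snd p) * h (mark_map p) \<partial>mark_space)"
    unfolding intensity_def by (subst nn_integral_density) (auto simp: case_prod_beta)
  also have "\<dots> = (\<integral>\<^sup>+x. \<integral>\<^sup>+s. ennreal (l x s / s) * h (mark_map (x, s)) \<partial>lborel_pos \<partial>lborel)"
    by (subst nn_integral_mark_space) auto
  also have "\<dots> = (\<integral>\<^sup>+x. K (\<phi> x) \<partial>lborel)"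
  proof (intro nn_integral_cong)
    fix x
    have *: "(\<lambda>t. h (\<phi> x, t) * ennreal (l (inv \<phi> (\<phi> x)) (t / \<theta> (\<phi> x)))) \<in> borel_measurable lborel_pos"
      using measurable_compose[OF measurable_Pair1'[of "\<phi> x" lborel lborel_pos] hm] by simp
    have "(\<integral>\<^sup>+s. ennreal (l x s / s) * h (mark_map (x, s)) \<partial>lborel_pos) =
       (\<integral>\<^sup>+s. h (\<phi> x, \<theta> (\<phi> x) * s) * ennreal (l (inv \<phi> (\<phi> x)) (\<theta> (\<phi> x) * s / \<theta> (\<phi> x))) * ennreal (1 / s) \<partial>lborel_pos)"
    proof (intro nn_integral_cong)
      fix s :: real assume "s \<in> space lborel_pos"
      then have "s > 0" by simp
      then have "ennreal (l x s / s) = ennreal (l x s) * ennreal (1 / s)"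
        by (subst ennreal_mult[symmetric]) (auto simp: l_pos order.strict_implies_order)
      then show "ennreal (l x s / s) * h (mark_map (x, s)) = h (\<phi> x, \<theta> (\<phi> x) * s) * ennreal (l (inv \<phi> (\<phi> x)) (\<theta> (\<phi> x) * s / \<theta> (\<phi> x))) * ennreal (1 / s)"
        by (simp add: mark_map_def mult_ac)
    qed
    also have "\<dots> = K (\<phi> x)"
      unfolding K_def by (rule nn_integral_lborel_pos_scale[OF * theta_pos])
    finally show "(\<integral>\<^sup>+s. ennreal (l x s / s) * h (mark_map (x, s)) \<partial>lborel_pos) = K (\<phi> x)" .
  qed
  also have "\<dots> = (\<integral>\<^sup>+y. K y \<partial>distr lborel borel \<phi>)"
    by (subst nn_integral_distr) auto
  also have "\<dots> = (\<integral>\<^sup>+y. ennreal (jac \<phi> y) * K y \<partial>lborel)"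
    unfolding distr_lborel_Diff0[OF phi] by (subst nn_integral_density) auto
  also have "\<dots> = (\<integral>\<^sup>+x. \<integral>\<^sup>+s. ennreal (l x s / s) * (h (x, s) * ennreal (mark_density x s)) \<partial>lborel_pos \<partial>lborel)"
  proof (intro nn_integral_cong)
    fix x
    have "(\<lambda>p. h p * ennreal (l (inv \<phi> (fst p)) (snd p / \<theta> (fst p))) * ennreal (1 / snd p)) \<in> borel_measurable mark_space"
      by measurable
    from measurable_compose[OF measurable_Pair1'[of x lborel lborel_pos] this]
    have *: "(\<lambda>t. h (x, t) * ennreal (l (inv \<phi> x) (t / \<theta> x)) * ennreal (1 / t)) \<in> borel_measurable lborel_pos" by simp
    have "ennreal (jac \<phi> x) * K x = (\<integral>\<^sup>+t. ennreal (jac \<phi> x) * (h (x, t) * ennreal (l (inv \<phi> x) (t / \<theta> x)) * ennreal (1 / t)) \<partial>lborel_pos)"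
      unfolding K_def by (rule nn_integral_cmult[symmetric, OF *])
    also have "\<dots> = (\<integral>\<^sup>+s. ennreal (l x s / s) * (h (x, s) * ennreal (mark_density x s)) \<partial>lborel_pos)"
    proof (intro nn_integral_cong)
      fix s :: real assume "s \<in> space lborel_pos"
      then have s: "s > 0" by simp
      have "ennreal (l x s / s) * ennreal (mark_density x s) = ennreal (l x s / s * mark_density x s)"
        using s by (subst ennreal_mult) (auto simp: mark_density_pos l_pos order.strict_implies_order)
      also have "l x s / s * mark_density x s = jac \<phi> x * (l (inv \<phi> x) (s / \<theta> x) * (1 / s))"
        using l_pos[OF s, of x] by (simp add: mark_density_def)
      also have "ennreal \<dots> = ennreal (jac \<phi> x) * (ennreal (l (inv \<phi> x) (s / \<theta> x)) * ennreal (1 / s))"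
        using s jac_pos[OF phi, of x] l_pos[of "s / \<theta> x" "inv \<phi> x"]
        by (subst ennreal_mult, simp, simp, subst ennreal_mult) auto
      finally show "ennreal (jac \<phi> x) * (h (x, s) * ennreal (l (inv \<phi> x) (s / \<theta> x)) * ennreal (1 / s))
        = ennreal (l x s / s) * (h (x, s) * ennreal (mark_density x s))"
        by (simp add: mult_ac)
    qed
    finally show "ennreal (jac \<phi> x) * K x = (\<integral>\<^sup>+s. ennreal (l x s / s) * (h (x, s) * ennreal (mark_density x s)) \<partial>lborel_pos)" .
  qed
  also have "\<dots> = (\<integral>\<^sup>+p. ennreal (l (fst p) (snd p) / snd p) * (h p * ennreal (mark_density (fst p) (snd p))) \<partial>mark_space)"
    by (subst nn_integral_mark_space) auto
  also have "\<dots> = (\<integral>\<^sup>+p. h p * ennreal (mark_density (fst p) (snd p)) \<partial>intensity l)"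
    unfolding intensity_def by (subst nn_integral_density) (auto simp: case_prod_beta)
  finally show ?thesis .
qed

lemma sets_intensity [measurable_cong]: "sets (intensity l) = sets mark_space"
  by (simp add: intensity_def)

lemma space_intensity [simp]: "space (intensity l) = UNIV \<times> {0<..}"
  by (simp add: intensity_def)

lemma distr_mark_map:
  "distr (intensity l) mark_space mark_map = density (intensity l) (\<lambda>p. ennreal (mark_density (fst p) (snd p)))"
proof (rule measure_eqI)
  have [measurable]: "(\<lambda>p. mark_density (fst p) (snd p)) \<in> borel_measurable mark_space"
    using mark_density_measurable by (simp add: case_prod_beta)
  fix A assume "A \<in> sets (distr (intensity l) mark_space mark_map)"
  then have A [measurable]: "A \<in> sets mark_space" by simp
  have "emeasure (distr (intensity l) mark_space mark_map) A = (\<integral>\<^sup>+p. indicator A (mark_map p) \<partial>intensity l)"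
    using A by (intro trans[OF nn_integral_indicator[symmetric] nn_integral_distr]) auto
  also have "\<dots> = (\<integral>\<^sup>+p. indicator A p * ennreal (mark_density (fst p) (snd p)) \<partial>intensity l)"
    by (rule nn_integral_mark_map) simp
  also have "\<dots> = emeasure (density (intensity l) (\<lambda>p. ennreal (mark_density (fst p) (snd p)))) A"
    by (simp add: emeasure_density mult.commute)
  finally show "emeasure (distr (intensity l) mark_space mark_map) A = emeasure (density (intensity l) (\<lambda>p. ennreal (mark_density (fst p) (snd p)))) A" .
qed (simp add: sets_intensity)

end

section \<open>The Borel sets of the vague topology\<close>

lemma CcI:
  assumes "continuous_on UNIV f" "compact K" "\<And>x. x \<notin> K \<Longrightarrow> f x = 0"
  shows "f \<in> Cc"
proof -
  have "closure {x. f x \<noteq> 0} \<subseteq> K"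
    using assms by (intro closure_minimal compact_imp_closed) auto
  then have "compact (closure {x. f x \<noteq> 0})"
    using assms(2) by (metis compact_Int_closed closed_closure inf.absorb_iff2)
  with assms(1) show ?thesis by (simp add: Cc_def)
qed

lemma Cc_continuous: "f \<in> Cc \<Longrightarrow> continuous_on UNIV f"
  by (simp add: Cc_def)

lemma Cc_measurable: "f \<in> Cc \<Longrightarrow> f \<in> borel_measurable borel"
  by (intro borel_measurable_continuous_onI Cc_continuous)

lemma CcE:
  fixes f :: "'a::euclidean_space \<Rightarrow> real"
  assumes "f \<in> Cc"
  obtains R C where "R \<ge> 0" "\<And>x. x \<notin> cball 0 R \<Longrightarrow> f x = 0" "\<And>x. \<bar>f x\<bar> \<le> C" "C \<ge> 0"
proof -
  let ?K = "closure {x. f x \<noteq> 0}"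
  have K: "compact ?K" and c: "continuous_on UNIV f" using assms by (auto simp: Cc_def)
  obtain R where R: "?K \<subseteq> cball 0 R" "R \<ge> 0"
    using bounded_subset_ballD[OF compact_imp_bounded[OF K], of 0] ball_subset_cball
    by (metis less_imp_le order_trans)
  have z: "f x = 0" if "x \<notin> cball 0 R" for x
    using R closure_subset[of "{x. f x \<noteq> 0}"] that by auto
  have "compact (f ` cball 0 R)"
    using c by (intro compact_continuous_image continuous_on_subset[OF c]) auto
  then obtain C where C: "\<And>y. y \<in> f ` cball 0 R \<Longrightarrow> \<bar>y\<bar> \<le> C"
    by (meson compact_imp_bounded bounded_real)
  have "\<bar>f x\<bar> \<le> max C 0" for x
    using C[of "f x"] z[of x] by (cases "x \<in> cball 0 R") auto
  then show ?thesis using that[OF R(2) z, of "max C 0"] by auto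
qed

lemma Cc_add:
  fixes f g :: "'a::euclidean_space \<Rightarrow> real"
  assumes f: "f \<in> Cc" and g: "g \<in> Cc"
  shows "(\<lambda>x. f x + g x) \<in> Cc"
proof -
  from f obtain R where R: "\<And>x. x \<notin> cball 0 R \<Longrightarrow> f x = 0" by (rule CcE) blast
  from g obtain S where S: "\<And>x. x \<notin> cball 0 S \<Longrightarrow> g x = 0" by (rule CcE) blast
  show ?thesis
  proof (rule CcI)
    show "continuous_on UNIV (\<lambda>x. f x + g x)"
      by (intro continuous_intros Cc_continuous f g)
    show "f x + g x = 0" if "x \<notin> cball 0 (max R S)" for x
      using R[of x] S[of x] that by simp
  qed (rule compact_cball)
qed

lemma Cc_mult_continuous:
  fixes f :: "'a::euclidean_space \<Rightarrow> real"
  assumes "f \<in> Cc" "continuous_on UNIV c"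
  shows "(\<lambda>x. f x * c x) \<in> Cc"
proof -
  from assms(1) obtain R where R: "\<And>x. x \<notin> cball 0 R \<Longrightarrow> f x = 0" by (rule CcE) blast
  show ?thesis
  proof (rule CcI)
    show "continuous_on UNIV (\<lambda>x. f x * c x)"
      by (intro continuous_intros Cc_continuous assms)
    show "f x * c x = 0" if "x \<notin> cball 0 R" for x using R[OF that] by simp
  qed (rule compact_cball)
qed

lemma Cc_scale: "(f :: 'a::euclidean_space \<Rightarrow> real) \<in> Cc \<Longrightarrow> (\<lambda>x. c * f x) \<in> Cc"
  using Cc_mult_continuous[of f "\<lambda>x. c"] by (simp add: mult.commute)

lemma Cc_zero: "(\<lambda>x. 0) \<in> Cc"
  by (rule CcI[of _ "{}"]) auto

lemma
  assumes "\<eta> \<in> radon_measures"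
  shows radon_sets: "sets \<eta> = sets borel" and radon_space: "space \<eta> = UNIV"
    and radon_finite: "compact K \<Longrightarrow> emeasure \<eta> K < \<infinity>"
  using assms sets_eq_imp_space_eq[of \<eta> borel] by (auto simp: radon_measures_def)

lemma radon_integrable:
  fixes f :: "'a::euclidean_space \<Rightarrow> real"
  assumes \<eta>: "\<eta> \<in> radon_measures" and [measurable]: "f \<in> borel_measurable borel"
    and z: "\<And>x. x \<notin> cball 0 R \<Longrightarrow> f x = 0" and C: "\<And>x. \<bar>f x\<bar> \<le> C"
  shows "integrable \<eta> f"
proof (rule integrableI_bounded_set[where A = "cball 0 R" and B = C])
  note radon_sets[OF \<eta>, measurable_cong]
  show "cball 0 R \<in> sets \<eta>" "f \<in> borel_measurable \<eta>" by measurable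
  show "emeasure \<eta> (cball 0 R) < \<infinity>" by (rule radon_finite[OF \<eta>]) simp
qed (use z C in auto)

lemma Cc_integrable: "\<eta> \<in> radon_measures \<Longrightarrow> f \<in> Cc \<Longrightarrow> integrable \<eta> f"
proof -
  assume \<eta>: "\<eta> \<in> radon_measures" and f: "f \<in> Cc"
  from f obtain R C where "\<And>x. x \<notin> cball 0 R \<Longrightarrow> f x = 0" "\<And>x. \<bar>f x\<bar> \<le> C" by (rule CcE) blast
  then show ?thesis by (rule radon_integrable[OF \<eta> Cc_measurable[OF f]])
qed

text \<open>Cones with a centre, a height and a slope. Finite maxima of cones with parameters from countable dense sets
  form a countable family that approximates the nonnegative functions of \<^const>\<open>Cc\<close>.\<close>

definition tent :: "'a::euclidean_space \<times> real \<times> real \<Rightarrow> 'a \<Rightarrow> real" where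
  "tent = (\<lambda>(z, q, r) x. max 0 (q - r * dist z x))"

definition tents :: "('a::euclidean_space \<times> real \<times> real) list \<Rightarrow> 'a \<Rightarrow> real" where
  "tents L x = foldr (\<lambda>t a. max (tent t x) a) L 0"

lemma continuous_on_tent: "continuous_on A (tent t)"
  unfolding tent_def by (cases t) (auto intro!: continuous_intros)

lemma tents_nonneg: "tents L x \<ge> 0"
  by (induction L) (auto simp: tents_def)

lemma tents_ge: "t \<in> set L \<Longrightarrow> tent t x \<le> tents L x"
  by (induction L) (auto simp: tents_def)

lemma tents_cases: "tents L x = 0 \<or> (\<exists>t\<in>set L. tents L x = tent t x)"
  by (induction L) (auto simp: tents_def max_def)

lemma continuous_on_tents: "continuous_on A (tents L)"
proof -
  have "continuous_on A (\<lambda>x. foldr (\<lambda>t a. max (tent t x) a) L 0)"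
    by (induction L) (auto intro!: continuous_intros continuous_on_tent)
  then show ?thesis by (simp add: tents_def[abs_def])
qed

text \<open>Below \<open>f + \<epsilon>\<close> every point \<open>y\<close> of the ball admits a steep narrow cone that exceeds \<open>f - \<epsilon>\<close> near
  \<open>y\<close>. By compactness finitely many of them suffice, and their maximum is the approximation.\<close>

lemma tents_approx:
  fixes f :: "'a::euclidean_space \<Rightarrow> real"
  assumes Z: "\<And>U. open U \<Longrightarrow> U \<noteq> {} \<Longrightarrow> \<exists>z\<in>Z. z \<in> U"
    and f: "continuous_on UNIV f" "\<And>x. f x \<ge> 0" "\<And>x. x \<notin> cball 0 R \<Longrightarrow> f x = 0"
    and \<epsilon>: "\<epsilon> > 0"
  obtains L where "set L \<subseteq> Z \<times> \<rat> \<times> (\<rat> \<inter> {0<..})" "\<And>x. \<bar>f x - tents L x\<bar> \<le> \<epsilon>"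
    "\<And>x. x \<notin> cball 0 (R + 2) \<Longrightarrow> tents L x = 0"
proof -
  define good where "good t \<longleftrightarrow> t \<in> Z \<times> \<rat> \<times> (\<rat> \<inter> {0<..}) \<and>
    (\<forall>x. tent t x \<le> f x + \<epsilon> \<and> (x \<notin> cball 0 (R + 2) \<longrightarrow> tent t x = 0))" for t
  have "\<exists>t. good t \<and> tent t y > f y - \<epsilon>" if y: "y \<in> cball 0 R" for y
  proof -
    obtain d where d: "d > 0" "\<And>x. dist x y < d \<Longrightarrow> dist (f x) (f y) < \<epsilon> / 2"
      using f(1) \<epsilon> unfolding continuous_on_iff by (metis UNIV_I half_gt_zero)
    define \<delta> where "\<delta> = min (d / 2) 1"
    have \<delta>: "\<delta> > 0" "\<delta> \<le> 1" and \<delta>f: "\<And>x. dist x y < 2 * \<delta> \<Longrightarrow> \<bar>f x - f y\<bar> < \<epsilon> / 2"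
      using d by (auto simp: \<delta>_def dist_real_def)
    obtain q where q: "q \<in> \<rat>" "f y - \<epsilon> / 2 < q" "q < f y"
      using Rats_dense_in_real[of "f y - \<epsilon> / 2" "f y"] \<epsilon> by auto
    \<comment> \<open>this slope makes the cone vanish at distance \<open>\<delta>\<close> from its centre, where \<open>f\<close> is still close to \<open>f y\<close>\<close>
    obtain r where r: "r \<in> \<rat>" "\<bar>q\<bar> / \<delta> < r"
      using Rats_dense_in_real[of "\<bar>q\<bar> / \<delta>" "\<bar>q\<bar> / \<delta> + 1"] by auto
    have r0: "r > 0" using r \<delta> by (smt (verit) divide_nonneg_pos)
    have near: "y \<in> ball y (min \<delta> (\<epsilon> / (2 * r)))" using \<delta> r0 \<epsilon> by simp
    obtain z where z: "z \<in> Z" "dist y z < min \<delta> (\<epsilon> / (2 * r))"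
      using Z[OF open_ball, of y "min \<delta> (\<epsilon> / (2 * r))"] near by (metis empty_iff mem_ball)
    let ?t = "(z, q, r)"
    have "r * dist z y < r * (\<epsilon> / (2 * r))"
      using z r0 by (intro mult_strict_left_mono) (simp_all add: dist_commute)
    then have "r * dist z y < \<epsilon> / 2" using r0 by simp
    then have "tent ?t y > f y - \<epsilon>" using q by (simp add: tent_def)
    moreover have "tent ?t x \<le> f x + \<epsilon> \<and> (x \<notin> cball 0 (R + 2) \<longrightarrow> tent ?t x = 0)" for x
    proof (cases "tent ?t x = 0")
      case True
      then show ?thesis using f(2)[of x] \<epsilon> by simp
    next
      case False
      then have *: "r * dist z x < q" "tent ?t x = q - r * dist z x"
        by (auto simp: tent_def max_def split: if_splits)
      have "\<bar>q\<bar> < r * \<delta>" using r(2) \<delta> by (simp add: pos_divide_less_eq)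
      then have "r * dist z x < r * \<delta>" using * by linarith
      then have "dist z x < \<delta>" using r0 by simp
      then have xy: "dist x y < 2 * \<delta>"
        using z(2) dist_triangle[of x y z] by (simp add: dist_commute)
      then have "\<bar>f x - f y\<bar> < \<epsilon> / 2" by (rule \<delta>f)
      moreover have "tent ?t x \<le> q" using * r0 by simp
      moreover have "norm x \<le> R + 2"
        using xy y \<delta> norm_triangle_ineq[of y "x - y"] by (simp add: dist_norm)
      moreover have "f y < f x + \<epsilon>" using \<open>\<bar>f x - f y\<bar> < \<epsilon> / 2\<close> \<epsilon> by linarith
      ultimately show ?thesis using q(3) by auto
    qed
    ultimately show ?thesis using q r r0 z by (auto simp: good_def intro!: exI[of _ ?t])
  qed
  then obtain t where t: "\<And>y. y \<in> cball 0 R \<Longrightarrow> good (t y) \<and> tent (t y) y > f y - \<epsilon>" by metis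
  have op: "open {x. tent (t y) x > f x - \<epsilon>}" for y
    by (intro open_Collect_less continuous_intros continuous_on_tent f)
  have "cball 0 R \<subseteq> (\<Union>y\<in>cball 0 R. {x. tent (t y) x > f x - \<epsilon>})" using t by auto
  from compactE_image[OF compact_cball op this]
  obtain F where F: "F \<subseteq> cball 0 R" "finite F" "cball 0 R \<subseteq> (\<Union>y\<in>F. {x. tent (t y) x > f x - \<epsilon>})"
    by auto
  obtain L where L: "set L = t ` F" using finite_list[of "t ` F"] F by auto
  have gL: "good s" if "s \<in> set L" for s using that L F t by auto
  show ?thesis
  proof (rule that[of L])
    show "set L \<subseteq> Z \<times> \<rat> \<times> (\<rat> \<inter> {0<..})" using gL by (auto simp: good_def)
    show "tents L x = 0" if "x \<notin> cball 0 (R + 2)" for x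
      using tents_cases[of L x] gL that by (auto simp: good_def)
    show "\<bar>f x - tents L x\<bar> \<le> \<epsilon>" for x
    proof -
      have "tents L x \<le> f x + \<epsilon>"
        using tents_cases[of L x] gL f(2)[of x] \<epsilon> by (auto simp: good_def)
      moreover have "f x - \<epsilon> \<le> tents L x"
      proof (cases "x \<in> cball 0 R")
        case True
        then obtain y where "y \<in> F" "tent (t y) x > f x - \<epsilon>" using F by auto
        then show ?thesis using tents_ge[of "t y" L x] L by auto
      next
        case False
        then show ?thesis using f(3)[of x] tents_nonneg[of L x] \<epsilon> by simp
      qed
      ultimately show ?thesis by linarith
    qed
  qed
qed

text \<open>The error is measured against a multiple of one function \<open>\<kappa>\<close> of the family, not against a constant: an error
  of this form can be integrated against a measure of infinite total mass, and \<open>\<integral>\<kappa> d\<eta>\<close> is itself vaguely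
  continuous in \<open>\<eta>\<close>.\<close>

lemma Cc_separable:
  obtains D :: "('a::euclidean_space \<Rightarrow> real) set" where "countable D" "D \<subseteq> Cc"
    "\<And>f. f \<in> Cc \<Longrightarrow> \<exists>\<kappa>\<in>D. (\<forall>x. 0 \<le> \<kappa> x) \<and> (\<forall>\<epsilon>>0. \<exists>h\<in>D. \<forall>x. \<bar>f x - h x\<bar> \<le> \<epsilon> * \<kappa> x)"
proof -
  obtain Z :: "'a set" where Z: "countable Z" "\<And>U. open U \<Longrightarrow> U \<noteq> {} \<Longrightarrow> \<exists>z\<in>Z. z \<in> U"
    using countable_dense_exists[where 'a='a] by metis
  define P where "P = Z \<times> (\<rat>::real set) \<times> (\<rat> \<inter> {0<..}::real set)"
  define cone :: "nat \<Rightarrow> 'a \<Rightarrow> real" where "cone n x = max 0 (real n - norm x)" for n x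
  define D where "D = (\<lambda>(L, M) x. tents L x - tents M x) ` (lists P \<times> lists P) \<inter> Cc \<union> range cone"
  show ?thesis
  proof (rule that[of D])
    have "countable P" unfolding P_def
      by (intro countable_SIGMA Z countable_rat countable_subset[OF _ countable_rat]) auto
    then show "countable D" unfolding D_def
      by (intro countable_Un countable_subset[OF Int_lower1] countable_image countable_SIGMA countable_lists) auto
    have "cone n \<in> Cc" for n
      by (rule CcI[of _ "cball 0 (real n)"]) (auto simp: cone_def[abs_def] intro!: continuous_intros)
    then show "D \<subseteq> Cc" by (auto simp: D_def)
    fix f :: "'a \<Rightarrow> real" assume f: "f \<in> Cc"
    then obtain R where R: "R \<ge> 0" "\<And>x. x \<notin> cball 0 R \<Longrightarrow> f x = 0" by (rule CcE) blast
    obtain n where n: "real n \<ge> R + 3" by (meson real_arch_simple)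
    show "\<exists>\<kappa>\<in>D. (\<forall>x. 0 \<le> \<kappa> x) \<and> (\<forall>\<epsilon>>0. \<exists>h\<in>D. \<forall>x. \<bar>f x - h x\<bar> \<le> \<epsilon> * \<kappa> x)"
    proof (rule bexI[of _ "cone n"], intro conjI allI impI)
      fix \<epsilon> :: real assume "\<epsilon> > 0"
      then have e: "\<epsilon> / 2 > 0" by simp
      have cf: "continuous_on UNIV (\<lambda>x. max 0 (f x))" "continuous_on UNIV (\<lambda>x. max 0 (- f x))"
        using Cc_continuous[OF f] by (auto intro!: continuous_intros)
      obtain L where L: "set L \<subseteq> P" "\<And>x. \<bar>max 0 (f x) - tents L x\<bar> \<le> \<epsilon> / 2"
          "\<And>x. x \<notin> cball 0 (R + 2) \<Longrightarrow> tents L x = 0"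
        using tents_approx[OF Z(2) cf(1) _ _ e, of R] R(2) unfolding P_def by auto
      obtain M where M: "set M \<subseteq> P" "\<And>x. \<bar>max 0 (- f x) - tents M x\<bar> \<le> \<epsilon> / 2"
          "\<And>x. x \<notin> cball 0 (R + 2) \<Longrightarrow> tents M x = 0"
        using tents_approx[OF Z(2) cf(2) _ _ e, of R] R(2) unfolding P_def by auto
      let ?h = "\<lambda>x. tents L x - tents M x"
      have "?h \<in> Cc"
        using L(3) M(3) by (intro CcI[of _ "cball 0 (R + 2)"] continuous_intros continuous_on_tents) auto
      then have "?h \<in> D" using L(1) M(1) by (auto simp: D_def image_iff in_lists_conv_set)
      moreover have "\<bar>f x - ?h x\<bar> \<le> \<epsilon> * cone n x" for x
      proof (cases "x \<in> cball 0 (R + 2)")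
        case True
        then have "cone n x \<ge> 1" using n by (simp add: cone_def)
        then have "\<epsilon> \<le> \<epsilon> * cone n x" using \<open>\<epsilon> > 0\<close> by simp
        moreover have "\<bar>f x - ?h x\<bar> \<le> \<epsilon>"
          using L(2)[of x] M(2)[of x] by linarith
        ultimately show ?thesis by simp
      next
        case False
        then have "f x = 0" using R by auto
        with False show ?thesis using L(3) M(3) \<open>\<epsilon> > 0\<close> by (simp add: cone_def)
      qed
      ultimately show "\<exists>h\<in>D. \<forall>x. \<bar>f x - h x\<bar> \<le> \<epsilon> * cone n x"
        by (intro bexI[of _ ?h] allI)
    qed (auto simp: cone_def D_def)
  qed
qed

text \<open>Replacing \<open>f\<close> by a nearby \<open>h\<close> of the countable family costs at most \<open>\<delta> \<integral>\<kappa> d\<eta>\<close>, and \<open>\<integral>\<kappa> d\<eta>\<close> is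
  bounded on the vague neighbourhood \<open>\<integral>\<kappa> d\<eta> < c + 1\<close>. So conditions on the countable family alone describe
  the neighbourhoods of a measure.\<close>

lemma vague_open_countable_subbasis:
  obtains C :: "(('a::euclidean_space \<Rightarrow> real) \<times> real set) set" where "countable C"
    "\<And>f V. (f, V) \<in> C \<Longrightarrow> f \<in> Cc \<and> open V"
    "\<And>U \<eta>. openin vague_topology U \<Longrightarrow> \<eta> \<in> U \<Longrightarrow>
      \<exists>F\<subseteq>C. finite F \<and> \<eta> \<in> {\<eta>\<in>radon_measures. \<forall>(f, V)\<in>F. (LINT x|\<eta>. f x) \<in> V} \<and>
         {\<eta>\<in>radon_measures. \<forall>(f, V)\<in>F. (LINT x|\<eta>. f x) \<in> V} \<subseteq> U"
proof -
  obtain D :: "('a \<Rightarrow> real) set" where D: "countable D" "D \<subseteq> Cc"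
    "\<And>f. f \<in> Cc \<Longrightarrow> \<exists>\<kappa>\<in>D. (\<forall>x. 0 \<le> \<kappa> x) \<and> (\<forall>\<epsilon>>0. \<exists>h\<in>D. \<forall>x. \<bar>f x - h x\<bar> \<le> \<epsilon> * \<kappa> x)"
    by (rule Cc_separable) blast
  obtain B :: "real set set" where B: "countable B" "topological_basis B"
    using ex_countable_basis by blast
  define N where "N F = {\<eta>\<in>radon_measures. \<forall>(f, V)\<in>F. (LINT x|\<eta>. f x) \<in> V}"
    for F :: "(('a \<Rightarrow> real) \<times> real set) set"
  have basic: "\<exists>V\<in>B. t \<in> V \<and> V \<subseteq> W" if "open W" "t \<in> W" for t W
    using topological_basisE[OF B(2) that] by metis
  define S where "S = {{\<eta> \<in> radon_measures. (LINT x|\<eta>. f x) \<in> U} | (f :: 'a \<Rightarrow> real) U. f \<in> Cc \<and> open U}"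
  have key: "\<exists>F\<subseteq>D \<times> B. finite F \<and> \<eta> \<in> N F \<and> N F \<subseteq> U"
    if "openin vague_topology U" "\<eta> \<in> U" for U \<eta>
  proof -
    have "generate_topology_on S U"
      using that(1) unfolding vague_topology_def S_def by (rule openin_topology_generated_by)
    then show ?thesis using that(2)
    proof (induction arbitrary: \<eta> rule: generate_topology_on.induct)
      case Empty
      then show ?case by simp
    next
      case (Int a b)
      obtain F where F: "F \<subseteq> D \<times> B" "finite F" "\<eta> \<in> N F" "N F \<subseteq> a"
        using Int.IH(1)[of \<eta>] Int.prems by auto
      obtain G where G: "G \<subseteq> D \<times> B" "finite G" "\<eta> \<in> N G" "N G \<subseteq> b"
        using Int.IH(2)[of \<eta>] Int.prems by auto
      have "N (F \<union> G) = N F \<inter> N G" by (auto simp: N_def)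
      with F(3,4) G(3,4) have "\<eta> \<in> N (F \<union> G)" "N (F \<union> G) \<subseteq> a \<inter> b" by auto
      with F(1,2) G(1,2) show ?case by (intro exI[of _ "F \<union> G"]) simp
    next
      case (UN K)
      then obtain k where k: "k \<in> K" "\<eta> \<in> k" by blast
      with UN.IH[OF k] obtain F where "F \<subseteq> D \<times> B" "finite F" "\<eta> \<in> N F" "N F \<subseteq> k" by blast
      with k show ?case by (intro exI[of _ F]) auto
    next
      case (Basis s)
      then obtain f U where s: "s = {\<eta> \<in> radon_measures. (LINT x|\<eta>. f x) \<in> U}" "f \<in> Cc" "open U"
        unfolding S_def by blast
      have \<eta>: "\<eta> \<in> radon_measures" "(LINT x|\<eta>. f x) \<in> U" using Basis s by auto
      obtain e where e: "e > 0" "\<And>t. dist t (LINT x|\<eta>. f x) < e \<Longrightarrow> t \<in> U"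
        using s(3) \<eta>(2) unfolding open_dist by blast
      obtain \<kappa> where \<kappa>: "\<kappa> \<in> D" "\<And>x. 0 \<le> \<kappa> x" "\<And>\<epsilon>. \<epsilon> > 0 \<Longrightarrow> \<exists>h\<in>D. \<forall>x. \<bar>f x - h x\<bar> \<le> \<epsilon> * \<kappa> x"
        using D(3)[OF s(2)] by blast
      define c where "c = (LINT x|\<eta>. \<kappa> x)"
      have c: "c \<ge> 0" using \<kappa>(2) by (simp add: c_def)
      \<comment> \<open>then the two replacement errors and the deviation of \<open>\<integral>h d\<eta>\<close> are at most \<open>e / 4\<close> each\<close>
      define \<delta> where "\<delta> = e / (4 * (c + 1))"
      have \<delta>: "\<delta> > 0" "\<delta> * (c + 1) = e / 4"
      proof -
        have *: "e / (4 * k) * k = e / 4" if "k > 0" for k using that by (simp add: field_simps)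
        have pos: "c + 1 > 0" using c by simp
        show "\<delta> > 0" unfolding \<delta>_def using e(1) pos by simp
        show "\<delta> * (c + 1) = e / 4" unfolding \<delta>_def by (rule *[OF pos])
      qed
      obtain h where h: "h \<in> D" "\<And>x. \<bar>f x - h x\<bar> \<le> \<delta> * \<kappa> x" using \<kappa>(3)[OF \<delta>(1)] by blast
      have hC: "h \<in> Cc" "\<kappa> \<in> Cc" using h(1) \<kappa>(1) D(2) by auto
      have est: "\<bar>(LINT x|\<zeta>. f x) - (LINT x|\<zeta>. h x)\<bar> \<le> \<delta> * (LINT x|\<zeta>. \<kappa> x)" if \<zeta>: "\<zeta> \<in> radon_measures" for \<zeta>
      proof -
        have i: "integrable \<zeta> f" "integrable \<zeta> h" "integrable \<zeta> \<kappa>"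
          using \<zeta> hC s(2) by (auto intro: Cc_integrable)
        have "\<bar>(LINT x|\<zeta>. f x) - (LINT x|\<zeta>. h x)\<bar> = \<bar>LINT x|\<zeta>. f x - h x\<bar>"
          using i by simp
        also have "\<dots> \<le> (LINT x|\<zeta>. \<bar>f x - h x\<bar>)" by (rule integral_abs_bound)
        also have "\<dots> \<le> (LINT x|\<zeta>. \<delta> * \<kappa> x)"
          using i h(2) by (intro integral_mono) auto
        finally show ?thesis by simp
      qed
      obtain V1 where V1: "V1 \<in> B" "c \<in> V1" "V1 \<subseteq> {..<c + 1}" using basic[of "{..<c+1}" c] by auto
      obtain V2 where V2: "V2 \<in> B" "(LINT x|\<eta>. h x) \<in> V2" "V2 \<subseteq> ball (LINT x|\<eta>. h x) (e / 4)"
        using basic[of "ball (LINT x|\<eta>. h x) (e / 4)" "LINT x|\<eta>. h x"] e by auto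
      let ?F = "{(\<kappa>, V1), (h, V2)}"
      have "\<eta> \<in> N ?F" using V1 V2 \<eta> by (auto simp: N_def c_def)
      moreover have "N ?F \<subseteq> s"
      proof
        fix \<zeta> assume z: "\<zeta> \<in> N ?F"
        then have \<zeta>: "\<zeta> \<in> radon_measures" and 1: "(LINT x|\<zeta>. \<kappa> x) < c + 1"
          and 2: "\<bar>(LINT x|\<eta>. h x) - (LINT x|\<zeta>. h x)\<bar> < e / 4"
          using V1 V2 by (auto simp: N_def dist_real_def)
        have "\<delta> * (LINT x|\<zeta>. \<kappa> x) \<le> e / 4" "\<delta> * c \<le> e / 4"
          using 1 \<delta> by (metis less_eq_real_def mult_left_mono add_increasing2 zero_le_one order_refl)+
        with est[OF \<zeta>] est[OF \<eta>(1)] 2 e have "dist (LINT x|\<zeta>. f x) (LINT x|\<eta>. f x) < e"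
          unfolding dist_real_def c_def by linarith
        then show "\<zeta> \<in> s" using \<zeta> e s by auto
      qed
      ultimately show ?case using V1(1) V2(1) h(1) \<kappa>(1) by (intro exI[of _ ?F]) auto
    qed
  qed
  show ?thesis
  proof (rule that[of "D \<times> B"])
    show "countable (D \<times> B)" using D B by auto
    show "f \<in> Cc \<and> open V" if "(f, V) \<in> D \<times> B" for f V
      using that D(2) topological_basis_open[OF B(2)] by auto
    show "\<exists>F\<subseteq>D \<times> B. finite F \<and> \<eta> \<in> {\<eta>\<in>radon_measures. \<forall>(f, V)\<in>F. (LINT x|\<eta>. f x) \<in> V} \<and>
         {\<eta>\<in>radon_measures. \<forall>(f, V)\<in>F. (LINT x|\<eta>. f x) \<in> V} \<subseteq> U"
      if "openin vague_topology U" "\<eta> \<in> U" for U \<eta>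
      using key[OF that] unfolding N_def .
  qed
qed

lemma topspace_vague: "topspace vague_topology = radon_measures"
proof -
  have "{\<eta> \<in> radon_measures. (LINT x|\<eta>. (\<lambda>x. 0) x) \<in> (UNIV :: real set)} \<in>
    {{\<eta> \<in> radon_measures. (LINT x|\<eta>. f x) \<in> U} | f U. f \<in> Cc \<and> open U}"
    using Cc_zero open_UNIV by blast
  then show ?thesis unfolding vague_topology_def topology_generated_by_topspace by auto
qed

definition evaluation_events :: "'a::euclidean_space measure set set" where
  "evaluation_events = {{\<eta> \<in> radon_measures. (LINT x|\<eta>. f x) \<in> B} | f B. f \<in> Cc \<and> B \<in> sets borel}"

lemma vague_open_subset: "{U. openin vague_topology U} \<subseteq> Pow radon_measures"
  using openin_subset by (force simp: topspace_vague[symmetric])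

lemma space_vague_borel: "space vague_borel = radon_measures"
  unfolding vague_borel_def by (rule space_measure_of[OF vague_open_subset])

lemma sets_vague_borel_open: "sets vague_borel = sigma_sets radon_measures {U. openin vague_topology U}"
  unfolding vague_borel_def by (rule sets_measure_of[OF vague_open_subset])

lemma evaluation_measurable_vague: "f \<in> Cc \<Longrightarrow> (\<lambda>\<eta>. LINT x|\<eta>. f x) \<in> borel_measurable vague_borel"
proof (rule borel_measurableI)
  fix S :: "real set" assume f: "f \<in> Cc" and S: "open S"
  have "openin vague_topology {\<eta> \<in> radon_measures. (LINT x|\<eta>. f x) \<in> S}"
    unfolding vague_topology_def using f S by (intro topology_generated_by_Basis) blast
  moreover have "(\<lambda>\<eta>. LINT x|\<eta>. f x) -` S \<inter> space vague_borel = {\<eta> \<in> radon_measures. (LINT x|\<eta>. f x) \<in> S}"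
    by (auto simp: space_vague_borel)
  ultimately show "(\<lambda>\<eta>. LINT x|\<eta>. f x) -` S \<inter> space vague_borel \<in> sets vague_borel"
    by (auto simp: sets_vague_borel_open)
qed

text \<open>The countable subbasis makes every open set a countable union of finite intersections of evaluation events.\<close>

theorem sets_vague_borel: "sets vague_borel = sigma_sets radon_measures evaluation_events"
proof
  have sub: "evaluation_events \<subseteq> Pow (radon_measures :: 'a measure set)"
    by (auto simp: evaluation_events_def)
  interpret E: sigma_algebra "radon_measures :: 'a measure set" "sigma_sets radon_measures evaluation_events"
    by (rule sigma_algebra_sigma_sets[OF sub])
  show "sets vague_borel \<subseteq> sigma_sets (radon_measures :: 'a measure set) evaluation_events"
    unfolding sets_vague_borel_open
  proof (rule E.sigma_sets_subset, safe)
    fix U :: "'a measure set" assume U: "openin vague_topology U"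
    obtain C :: "(('a \<Rightarrow> real) \<times> real set) set" where C: "countable C"
      "\<And>f V. (f, V) \<in> C \<Longrightarrow> f \<in> Cc \<and> open V"
      "\<And>U \<eta>. openin vague_topology U \<Longrightarrow> \<eta> \<in> U \<Longrightarrow>
        \<exists>F\<subseteq>C. finite F \<and> \<eta> \<in> {\<eta>\<in>radon_measures. \<forall>(f, V)\<in>F. (LINT x|\<eta>. f x) \<in> V} \<and>
           {\<eta>\<in>radon_measures. \<forall>(f, V)\<in>F. (LINT x|\<eta>. f x) \<in> V} \<subseteq> U"
      by (rule vague_open_countable_subbasis) blast
    define N where "N F = {\<eta>\<in>radon_measures. \<forall>(f, V)\<in>F. (LINT x|\<eta>. f x) \<in> V}"
      for F :: "(('a \<Rightarrow> real) \<times> real set) set"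
    let ?\<F> = "{F. F \<subseteq> C \<and> finite F \<and> N F \<subseteq> U}"
    have "U = (\<Union>F\<in>?\<F>. N F)"
      using C(3)[OF U] unfolding N_def[symmetric] by blast
    moreover have "N F \<in> sigma_sets radon_measures evaluation_events" if "F \<subseteq> C" "finite F" for F
      using that(2,1)
    proof (induction)
      case empty
      have "N {} = radon_measures" by (auto simp: N_def)
      then show ?case by auto
    next
      case (insert p F)
      obtain f V where p: "p = (f, V)" by force
      have "N (insert p F) = {\<eta> \<in> radon_measures. (LINT x|\<eta>. f x) \<in> V} \<inter> N F"
        by (auto simp: N_def p)
      moreover have "f \<in> Cc" "V \<in> sets borel" using C(2)[of f V] insert.prems p by auto
      then have "{\<eta> \<in> radon_measures. (LINT x|\<eta>. f x) \<in> V} \<in> evaluation_events"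
        unfolding evaluation_events_def by blast
      then have "{\<eta> \<in> radon_measures. (LINT x|\<eta>. f x) \<in> V} \<in> sigma_sets radon_measures evaluation_events"
        by (rule sigma_sets.Basic)
      moreover have "N F \<in> sigma_sets radon_measures evaluation_events"
        using insert.IH insert.prems by simp
      ultimately show ?case using E.Int by simp
    qed
    moreover have "countable ?\<F>"
      by (rule countable_subset[OF _ countable_Collect_finite_subset[OF C(1)]]) auto
    moreover have "(\<Union>F\<in>?\<F>. N F) \<in> sigma_sets radon_measures evaluation_events"
      by (rule E.countable_UN''[OF \<open>countable ?\<F>\<close>]) (use calculation(2) in blast)
    ultimately show "U \<in> sigma_sets radon_measures evaluation_events" by simp
  qed
  show "sigma_sets (radon_measures :: 'a measure set) evaluation_events \<subseteq> sets vague_borel"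
  proof -
    have "evaluation_events \<subseteq> sets (vague_borel :: 'a measure measure)"
    proof
      fix A :: "'a measure set" assume "A \<in> evaluation_events"
      then obtain f B where A: "A = {\<eta> \<in> radon_measures. (LINT x|\<eta>. f x) \<in> B}" "f \<in> Cc" "B \<in> sets borel"
        by (auto simp: evaluation_events_def)
      have "(\<lambda>\<eta>. LINT x|\<eta>. f x) -` B \<inter> space vague_borel \<in> sets vague_borel"
        using evaluation_measurable_vague[OF A(2)] A(3) by (rule measurable_sets)
      also have "(\<lambda>\<eta>. LINT x|\<eta>. f x) -` B \<inter> space vague_borel = A"
        by (auto simp: A space_vague_borel)
      finally show "A \<in> sets vague_borel" .
    qed
    then show ?thesis
      using sets.sigma_sets_subset[of evaluation_events vague_borel] by (simp add: space_vague_borel)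
  qed
qed

section \<open>Discrete Radon measures\<close>

lemma emeasure_countable_infsum:
  fixes \<eta> :: "'a::euclidean_space measure"
  assumes s: "sets \<eta> = sets borel" and A: "countable A" and B: "B \<in> sets borel"
  shows "emeasure \<eta> (A \<inter> B) = (\<Sum>\<^sub>\<infinity>x\<in>A. emeasure \<eta> {x} * emeasure (return borel x) B)"
proof -
  have cs: "C \<in> sets \<eta>" if "countable C" for C
    using sets.countable[of C \<eta>] that s by auto
  have summand: "emeasure \<eta> {x} * emeasure (return borel x) B = (if x \<in> B then emeasure \<eta> {x} else 0)" for x
    using B by (simp add: emeasure_return)
  have fin: "(\<Sum>x\<in>F. emeasure \<eta> {x} * emeasure (return borel x) B) = emeasure \<eta> (F \<inter> B)"
    if "finite F" for F
  proof -
    have "emeasure \<eta> (F \<inter> B) = (\<Sum>x\<in>F \<inter> B. emeasure \<eta> {x})"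
      using that s by (intro emeasure_eq_sum_singleton) auto
    also have "\<dots> = (\<Sum>x\<in>F. if x \<in> B then emeasure \<eta> {x} else 0)"
      using that by (simp add: sum.inter_restrict)
    finally show ?thesis by (simp add: summand)
  qed
  have "(\<Sum>\<^sub>\<infinity>x\<in>A. emeasure \<eta> {x} * emeasure (return borel x) B)
      = (SUP F\<in>{F. finite F \<and> F \<subseteq> A}. emeasure \<eta> (F \<inter> B))"
    by (subst nonneg_infsum_complete) (auto simp: fin intro!: SUP_cong)
  also have "\<dots> = emeasure \<eta> (A \<inter> B)"
  proof (rule antisym)
    show "(SUP F\<in>{F. finite F \<and> F \<subseteq> A}. emeasure \<eta> (F \<inter> B)) \<le> emeasure \<eta> (A \<inter> B)"
      using A by (auto intro!: SUP_least emeasure_mono cs intro: countable_subset)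
    define G where "G n = {x\<in>A. to_nat_on A x \<le> n}" for n
    have finG: "finite (G n)" for n
    proof (rule inj_on_finite[of "to_nat_on A" _ "{..n}"])
      show "inj_on (to_nat_on A) (G n)"
        using A by (rule inj_on_subset[OF inj_on_to_nat_on]) (auto simp: G_def)
    qed (auto simp: G_def)
    have "emeasure \<eta> (A \<inter> B) = emeasure \<eta> (\<Union>n. G n \<inter> B)"
      by (rule arg_cong[where f="emeasure \<eta>"]) (auto simp: G_def)
    also have "\<dots> = (SUP n. emeasure \<eta> (G n \<inter> B))"
      using finG by (intro SUP_emeasure_incseq[symmetric])
        (auto intro!: cs intro: countable_finite simp: incseq_def G_def)
    also have "\<dots> \<le> (SUP F\<in>{F. finite F \<and> F \<subseteq> A}. emeasure \<eta> (F \<inter> B))"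
      using finG by (intro SUP_least SUP_upper) (auto simp: G_def)
    finally show "emeasure \<eta> (A \<inter> B) \<le> (SUP F\<in>{F. finite F \<and> F \<subseteq> A}. emeasure \<eta> (F \<inter> B))" .
  qed
  finally show ?thesis ..
qed

lemma countable_sets_borel: "countable A \<Longrightarrow> A \<in> sets (borel :: 'a::euclidean_space measure)"
  by (rule sets.countable) auto

text \<open>The weights of the atoms are determined by the measure, so that only a countable carrier has to be found. In
  this form restrictions, images and finite sums of point masses are seen to be discrete at once.\<close>

lemma discrete_radon_iff:
  "\<eta> \<in> discrete_radon \<longleftrightarrow> \<eta> \<in> radon_measures \<and> (\<exists>A. countable A \<and> emeasure \<eta> (- A) = 0)"
proof
  assume "\<eta> \<in> discrete_radon"
  then obtain A s where \<eta>: "\<eta> \<in> radon_measures" "countable A"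
    and rep: "\<And>B. B \<in> sets borel \<Longrightarrow> emeasure \<eta> B = (\<Sum>\<^sub>\<infinity>x\<in>A. ennreal (s x) * emeasure (return borel x) B)"
    by (auto simp: discrete_radon_def)
  have A: "- A \<in> sets borel" using \<eta>(2) by (intro borel_comp countable_sets_borel)
  have "emeasure \<eta> (- A) = 0"
    unfolding rep[OF A] using A by (intro infsum_0) (simp add: emeasure_return)
  with \<eta> show "\<eta> \<in> radon_measures \<and> (\<exists>A. countable A \<and> emeasure \<eta> (- A) = 0)" by blast
next
  assume "\<eta> \<in> radon_measures \<and> (\<exists>A. countable A \<and> emeasure \<eta> (- A) = 0)"
  then obtain A where \<eta>: "\<eta> \<in> radon_measures" and A: "countable A" "emeasure \<eta> (- A) = 0" by blast
  have s: "sets \<eta> = sets borel" by (rule radon_sets[OF \<eta>])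
  have Ab: "A \<in> sets borel" using A(1) by (rule countable_sets_borel)
  define A' where "A' = {x\<in>A. emeasure \<eta> {x} > 0}"
  have cA': "countable A'" using A(1) by (rule countable_subset[rotated]) (auto simp: A'_def)
  have fin: "emeasure \<eta> {x} = ennreal (measure \<eta> {x})" for x
    using radon_finite[OF \<eta>, of "{x}"] by (simp add: emeasure_eq_ennreal_measure)
  show "\<eta> \<in> discrete_radon"
    unfolding discrete_radon_def
  proof (intro CollectI conjI \<eta> exI[of _ A'] exI[of _ "\<lambda>x. measure \<eta> {x}"] ballI cA')
    show "measure \<eta> {x} > 0" if "x \<in> A'" for x
      using that fin[of x] by (auto simp: A'_def)
    fix B :: "'a set" assume B: "B \<in> sets borel"
    have N: "- A \<in> null_sets \<eta>" using A(2) Ab s by auto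
    have "emeasure \<eta> B = emeasure \<eta> (B - (- A))"
      using B s by (intro emeasure_Diff_null_set[symmetric] N) simp
    also have "B - (- A) = A \<inter> B" by auto
    also have "emeasure \<eta> (A \<inter> B) = (\<Sum>\<^sub>\<infinity>x\<in>A. emeasure \<eta> {x} * emeasure (return borel x) B)"
      by (rule emeasure_countable_infsum[OF s A(1) B])
    also have "\<dots> = (\<Sum>\<^sub>\<infinity>x\<in>A'. emeasure \<eta> {x} * emeasure (return borel x) B)"
      by (rule infsum_cong_neutral) (auto simp: A'_def)
    finally show "emeasure \<eta> B = (\<Sum>\<^sub>\<infinity>x\<in>A'. ennreal (measure \<eta> {x}) * emeasure (return borel x) B)"
      by (simp add: fin)
  qed
qed

lemma discrete_radon_radon: "\<eta> \<in> discrete_radon \<Longrightarrow> \<eta> \<in> radon_measures"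
  by (simp add: discrete_radon_iff)

lemma space_discrete_borel: "space discrete_borel = discrete_radon"
  using discrete_radon_radon by (auto simp: discrete_borel_def space_restrict_space space_vague_borel)

lemma evaluation_measurable:
  "f \<in> Cc \<Longrightarrow> (\<lambda>\<eta>. LINT x|\<eta>. f x) \<in> borel_measurable discrete_borel"
  unfolding discrete_borel_def by (intro measurable_restrict_space1 evaluation_measurable_vague)

lemma measurable_discrete_borelI:
  fixes T :: "'b \<Rightarrow> 'a::euclidean_space measure"
  assumes T: "\<And>\<omega>. \<omega> \<in> space M \<Longrightarrow> T \<omega> \<in> discrete_radon"
    and meas: "\<And>f. f \<in> Cc \<Longrightarrow> (\<lambda>\<omega>. LINT x|T \<omega>. f x) \<in> borel_measurable M"
  shows "T \<in> M \<rightarrow>\<^sub>M discrete_borel"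
  unfolding discrete_borel_def
proof (rule measurable_restrict_space2)
  show "T \<in> space M \<rightarrow> discrete_radon" using T by blast
  show "T \<in> M \<rightarrow>\<^sub>M vague_borel"
  proof (rule measurable_sigma_sets[OF sets_vague_borel])
    show "evaluation_events \<subseteq> Pow radon_measures" by (auto simp: evaluation_events_def)
    show "T \<in> space M \<rightarrow> radon_measures" using T discrete_radon_radon by blast
    fix E :: "'a measure set" assume "E \<in> evaluation_events"
    then obtain f B where E: "E = {\<eta> \<in> radon_measures. (LINT x|\<eta>. f x) \<in> B}" and "f \<in> Cc" "B \<in> sets borel"
      by (auto simp: evaluation_events_def)
    then have "(\<lambda>\<omega>. LINT x|T \<omega>. f x) -` B \<inter> space M \<in> sets M"
      by (intro measurable_sets[OF meas])
    also have "(\<lambda>\<omega>. LINT x|T \<omega>. f x) -` B \<inter> space M = T -` E \<inter> space M"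
      using T discrete_radon_radon by (auto simp: E)
    finally show "T -` E \<inter> space M \<in> sets M" .
  qed
qed

text \<open>Finite intersections of evaluation events form an intersection stable generator.\<close>

definition cylinder :: "(('a::euclidean_space \<Rightarrow> real) \<times> real set) list \<Rightarrow> 'a measure set" where
  "cylinder L = {\<eta> \<in> discrete_radon. \<forall>(f, B)\<in>set L. (LINT x|\<eta>. f x) \<in> B}"

definition cylinders :: "'a::euclidean_space measure set set" where
  "cylinders = {cylinder L | L. set L \<subseteq> Cc \<times> sets borel}"

lemma cylinder_append: "cylinder (L @ M) = cylinder L \<inter> cylinder M"
  by (auto simp: cylinder_def)

lemma cylinder_sets: "set L \<subseteq> Cc \<times> sets borel \<Longrightarrow> cylinder L \<in> sets discrete_borel"
proof (induction L)
  case Nil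
  have "cylinder [] = space (discrete_borel :: 'a measure measure)"
    by (auto simp: cylinder_def space_discrete_borel)
  then show ?case by simp
next
  case (Cons p L)
  obtain f B where p: "p = (f, B)" by force
  have "cylinder (p # L) = ((\<lambda>\<eta>. LINT x|\<eta>. f x) -` B \<inter> space discrete_borel) \<inter> cylinder L"
    by (auto simp: cylinder_def space_discrete_borel p)
  moreover have "(\<lambda>\<eta>. LINT x|\<eta>. f x) -` B \<inter> space discrete_borel \<in> sets discrete_borel"
    using Cons.prems p by (intro measurable_sets[OF evaluation_measurable]) auto
  ultimately show ?case using Cons by auto
qed

lemma sets_discrete_borel: "sets discrete_borel = sigma_sets discrete_radon cylinders"
proof
  show "sigma_sets discrete_radon cylinders \<subseteq> sets (discrete_borel :: 'a measure measure)"
  proof -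
    have "cylinders \<subseteq> sets (discrete_borel :: 'a measure measure)"
      unfolding cylinders_def using cylinder_sets by blast
    from sets.sigma_sets_subset[OF this] show ?thesis by (simp add: space_discrete_borel)
  qed
  have "sets (discrete_borel :: 'a measure measure) = {id -` A \<inter> discrete_radon |A. A \<in> sigma_sets radon_measures evaluation_events}"
    by (auto simp: discrete_borel_def sets_restrict_space sets_vague_borel)
  also have "\<dots> = sigma_sets discrete_radon {id -` A \<inter> discrete_radon |A. A \<in> evaluation_events}"
    using discrete_radon_radon by (intro sigma_sets_vimage_commute) auto
  also have "\<dots> \<subseteq> sigma_sets discrete_radon cylinders"
  proof (rule sigma_sets_mono', safe)
    fix A :: "'a measure set" assume "A \<in> evaluation_events"
    then obtain f B where A: "A = {\<eta> \<in> radon_measures. (LINT x|\<eta>. f x) \<in> B}" and fB: "f \<in> Cc" "B \<in> sets borel"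
      by (auto simp: evaluation_events_def)
    have "id -` A \<inter> discrete_radon = cylinder [(f, B)]"
      using discrete_radon_radon by (auto simp: A cylinder_def)
    moreover have "set [(f, B)] \<subseteq> Cc \<times> sets borel" using fB by auto
    ultimately show "id -` A \<inter> discrete_radon \<in> cylinders"
      unfolding cylinders_def by blast
  qed
  finally show "sets (discrete_borel :: 'a measure measure) \<subseteq> sigma_sets discrete_radon cylinders" .
qed

lemma measure_eqI_cylinder:
  fixes N1 N2 :: "'a::euclidean_space measure measure"
  assumes "finite_measure N1" "sets N1 = sets discrete_borel" "sets N2 = sets discrete_borel"
    and eq: "\<And>L. set L \<subseteq> Cc \<times> sets borel \<Longrightarrow> emeasure N1 (cylinder L) = emeasure N2 (cylinder L)"
  shows "N1 = N2"
proof (rule measure_eqI_generator_eq[where E = cylinders and \<Omega> = discrete_radon and A = "\<lambda>_. discrete_radon"])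
  show "Int_stable (cylinders :: 'a measure set set)"
  proof (rule Int_stableI)
    fix a b :: "'a measure set" assume "a \<in> cylinders" "b \<in> cylinders"
    then obtain L M where "a = cylinder L" "set L \<subseteq> Cc \<times> sets borel" "b = cylinder M" "set M \<subseteq> Cc \<times> sets borel"
      unfolding cylinders_def by blast
    note ab = this
    show "a \<inter> b \<in> cylinders"
      unfolding cylinders_def
      by (intro CollectI exI[of _ "L @ M"]) (simp add: ab cylinder_append)
  qed
  show "cylinders \<subseteq> Pow (discrete_radon :: 'a measure set)" by (auto simp: cylinders_def cylinder_def)
  show "emeasure N1 X = emeasure N2 X" if "X \<in> cylinders" for X
    using that eq by (auto simp: cylinders_def)
  show "sets N1 = sigma_sets discrete_radon cylinders" "sets N2 = sigma_sets discrete_radon cylinders"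
    using assms sets_discrete_borel by auto
  have "(discrete_radon :: 'a measure set) = cylinder []" by (simp add: cylinder_def)
  moreover have "cylinder [] \<in> (cylinders :: 'a measure set set)" unfolding cylinders_def by (auto intro!: exI[of _ "[]"])
  ultimately show "range (\<lambda>_::nat. discrete_radon :: 'a measure set) \<subseteq> cylinders" by auto
  show "emeasure N1 discrete_radon \<noteq> \<infinity>"
    using finite_measure.emeasure_finite[OF assms(1)] by simp
qed auto

section \<open>The Fourier transform determines the law\<close>

text \<open>The value of the characteristic function at \<open>0\<close> is the total mass. Dividing by it reduces the claim to
  probability measures.\<close>

lemma finite_char_eqI:
  fixes M N :: "real measure"
  assumes M: "finite_measure M" and N: "finite_measure N"
    and [simp, measurable_cong]: "sets M = sets borel" "sets N = sets borel"
    and eq: "\<And>t. char M t = char N t"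
  shows "M = N"
proof -
  interpret M: finite_measure M by fact
  interpret N: finite_measure N by fact
  have sp: "space M = UNIV" "space N = UNIV"
    using sets_eq_imp_space_eq[of M borel] sets_eq_imp_space_eq[of N borel] by auto
  define c where "c = measure M UNIV"
  have cN: "c = measure N UNIV"
    using eq[of 0] sp by (simp add: char_def c_def)
  show ?thesis
  proof (cases "c = 0")
    case True
    have "emeasure M A = emeasure N A" for A
    proof -
      have "emeasure M A \<le> emeasure M (space M)" "emeasure N A \<le> emeasure N (space N)"
        by (auto intro: emeasure_space)
      with True cN c_def sp show ?thesis
        by (simp add: M.emeasure_eq_measure N.emeasure_eq_measure)
    qed
    then show ?thesis by (intro measure_eqI) simp_all
  next
    case False
    then have c: "c > 0" by (simp add: c_def zero_less_measure_iff order.not_eq_order_implies_strict)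
    define S where "S L = density L (\<lambda>_. ennreal (1 / c))" for L :: "real measure"
    have S: "real_distribution (S L)" "char (S L) t = char L t /\<^sub>R c"
      and SE: "A \<in> sets borel \<Longrightarrow> emeasure L A = ennreal c * emeasure (S L) A"
      if L: "finite_measure L" "sets L = sets borel" "measure L UNIV = c" for L t A
    proof -
      note [measurable_cong] = L(2)
      have spL: "space L = UNIV" using sets_eq_imp_space_eq[OF L(2)] by simp
      have "emeasure (S L) (space (S L)) = 1"
        using L c finite_measure.emeasure_eq_measure[OF L(1)]
        by (simp add: S_def spL emeasure_density ennreal_mult[symmetric])
      then have "prob_space (S L)" by (rule prob_spaceI)
      then show "real_distribution (S L)"
        by (simp add: real_distribution_def real_distribution_axioms_def S_def L)
      show "char (S L) t = char L t /\<^sub>R c"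
        using c unfolding S_def char_def
        by (subst integral_density) (auto simp: divide_inverse measurable_cong_sets[OF L(2) refl])
      show "emeasure L A = ennreal c * emeasure (S L) A" if "A \<in> sets borel"
        using c that L(2) unfolding S_def
        by (simp add: emeasure_density nn_integral_cmult_indicator ennreal_mult[symmetric] mult.assoc[symmetric])
    qed
    have "S M = S N"
      using S[OF M] S[OF N] eq cN c_def
      by (intro Levy_uniqueness) auto
    then show ?thesis
      using SE[OF M] SE[OF N] cN c_def by (intro measure_eqI) auto
  qed
qed

lemma cos_iexp: "complex_of_real (cos y) = (iexp y + iexp (- y)) / 2"
  using cos_exp_eq[of "complex_of_real y"] by (simp add: cos_of_real)

lemma sin_iexp: "complex_of_real (sin y) = (iexp y - iexp (- y)) / (2 * \<i>)"
  using sin_exp_eq[of "complex_of_real y"] by (simp add: sin_of_real)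

lemma iexp_cos_sin: "iexp y = complex_of_real (cos y) + \<i> * complex_of_real (sin y)"
  by (simp add: exp_Euler cos_of_real sin_of_real)

text \<open>The complex weight \<open>iexp Y\<close> is a combination of the nonnegative weights \<open>1\<close>, \<open>1 + cos Y\<close> and
  \<open>1 + sin Y\<close>. With a nonnegative weight the images of \<open>N1\<close> and \<open>N2\<close> under \<open>X1\<close> and \<open>X2\<close> are finite
  measures, and their integrals against the characters \<open>\<kappa> k\<close> are combinations of the integrals in the
  assumption, since \<open>cos\<close> and \<open>sin\<close> are combinations of \<open>iexp (e * Y)\<close> with \<open>e = 1\<close> and \<open>e = -1\<close>. So the two
  images agree if the characters determine a finite measure. The lemma is applied to the real line with the
  usual characters, and to spaces of measures with the evaluations at \<^const>\<open>Cc\<close> as characters.\<close>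

lemma complex_weight_transfer:
  fixes N1 :: "'a measure" and N2 :: "'b measure" and T :: "'c measure"
    and X1 :: "'a \<Rightarrow> 'c" and X2 :: "'b \<Rightarrow> 'c" and \<kappa> :: "'k \<Rightarrow> 'c \<Rightarrow> complex" and G :: "'c \<Rightarrow> complex"
  assumes N1: "finite_measure N1" and N2: "finite_measure N2"
    and X [measurable]: "X1 \<in> N1 \<rightarrow>\<^sub>M T" "X2 \<in> N2 \<rightarrow>\<^sub>M T"
    and Y [measurable]: "Y1 \<in> borel_measurable N1" "Y2 \<in> borel_measurable N2"
    and \<kappa> [measurable]: "\<And>k. k \<in> K \<Longrightarrow> \<kappa> k \<in> borel_measurable T" and \<kappa>1: "\<And>k x. k \<in> K \<Longrightarrow> norm (\<kappa> k x) \<le> 1"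
    and determine: "\<And>M M'. finite_measure M \<Longrightarrow> finite_measure M' \<Longrightarrow> sets M = sets T \<Longrightarrow> sets M' = sets T \<Longrightarrow>
      (\<And>k. k \<in> K \<Longrightarrow> integral\<^sup>L M (\<kappa> k) = integral\<^sup>L M' (\<kappa> k)) \<Longrightarrow> M = M'"
    and eq: "\<And>k e. k \<in> K \<Longrightarrow> e \<in> {-1, 0, 1} \<Longrightarrow>
      (LINT x|N1. \<kappa> k (X1 x) * iexp (e * Y1 x)) = (LINT x|N2. \<kappa> k (X2 x) * iexp (e * Y2 x))"
    and G [measurable]: "G \<in> borel_measurable T"
    and int: "integrable N1 (\<lambda>x. G (X1 x))" "integrable N2 (\<lambda>x. G (X2 x))"
  shows "(LINT x|N1. G (X1 x) * iexp (Y1 x)) = (LINT x|N2. G (X2 x) * iexp (Y2 x))"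
proof -
  have transfer: "(LINT x|N1. w (Y1 x) *\<^sub>R G (X1 x)) = (LINT x|N2. w (Y2 x) *\<^sub>R G (X2 x))"
    if w: "w \<in> {\<lambda>y. 1, \<lambda>y. 1 + cos y, \<lambda>y. 1 + sin y}" for w :: "real \<Rightarrow> real"
  proof -
    have w0: "w y \<ge> 0" "w y \<le> 2" for y
    proof -
      have "0 \<le> 1 + cos y" "0 \<le> 1 + sin y" "1 + cos y \<le> 2" "1 + sin y \<le> 2"
        using cos_ge_minus_one[of y] sin_ge_minus_one[of y] cos_le_one[of y] sin_le_one[of y] by linarith+
      with w show "w y \<ge> 0" "w y \<le> 2" by auto
    qed
    have [measurable]: "w \<in> borel_measurable borel" using w by auto
    define D1 where "D1 = distr (density N1 (\<lambda>x. ennreal (w (Y1 x)))) T X1"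
    define D2 where "D2 = distr (density N2 (\<lambda>x. ennreal (w (Y2 x)))) T X2"
    have int1: "integral\<^sup>L D1 H = (LINT x|N1. w (Y1 x) *\<^sub>R H (X1 x))" and
      int2: "integral\<^sup>L D2 H = (LINT x|N2. w (Y2 x) *\<^sub>R H (X2 x))"
      if [measurable]: "H \<in> borel_measurable T" for H :: "'c \<Rightarrow> complex"
      unfolding D1_def D2_def using w0 by (simp_all add: integral_distr integral_density)
    have finD: "finite_measure (distr (density N (\<lambda>x. ennreal (w (Y x)))) T X)"
      if N: "finite_measure N" and [measurable]: "X \<in> N \<rightarrow>\<^sub>M T" "Y \<in> borel_measurable N" for N :: "'d measure" and X Y
    proof -
      interpret finite_measure N by fact
      have "emeasure (density N (\<lambda>x. ennreal (w (Y x)))) (space N) = (\<integral>\<^sup>+x. ennreal (w (Y x)) \<partial>N)"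
        by (subst emeasure_density) (auto intro!: nn_integral_cong)
      also have "\<dots> \<le> (\<integral>\<^sup>+x. 2 \<partial>N)"
        using w0 by (intro nn_integral_mono) (metis ennreal_leI ennreal_numeral zero_le_numeral)
      also have "\<dots> < \<infinity>" by (simp add: emeasure_eq_measure ennreal_mult_less_top)
      finally show ?thesis
        by (intro finite_measure.finite_measure_distr finite_measureI) auto
    qed
    have intN: "integrable N (\<lambda>x. \<kappa> k (X x) * iexp (e * Y x))"
      if "finite_measure N" and [measurable]: "X \<in> N \<rightarrow>\<^sub>M T" "Y \<in> borel_measurable N" and k: "k \<in> K"
      for N :: "'d measure" and X Y e k
      using that(1) \<kappa>[OF k] \<kappa>1[OF k]
      by (intro finite_measure.integrable_const_bound[where B = 1]) (auto simp: norm_mult)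
    have "D1 = D2"
    proof (rule determine)
      show "finite_measure D1" "finite_measure D2"
        unfolding D1_def D2_def using N1 N2 by (auto intro!: finD)
      show "sets D1 = sets T" "sets D2 = sets T" by (auto simp: D1_def D2_def)
      fix k assume k: "k \<in> K"
      have e: "(LINT x|N1. \<kappa> k (X1 x) * iexp (e * Y1 x)) = (LINT x|N2. \<kappa> k (X2 x) * iexp (e * Y2 x))"
        if "e \<in> {-1, 0, 1}" for e by (rule eq[OF k that])
      note e0 = e[of 0, simplified] and e1 = e[of 1, simplified] and em = e[of "-1", simplified]
      note i1 = intN[OF N1 X(1) Y(1) k] and i2 = intN[OF N2 X(2) Y(2) k]
      note i10 = i1[of 0, simplified] and i11 = i1[of 1, simplified] and i1m = i1[of "-1", simplified]
      note i20 = i2[of 0, simplified] and i21 = i2[of 1, simplified] and i2m = i2[of "-1", simplified]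
      have "(LINT x|N1. w (Y1 x) *\<^sub>R \<kappa> k (X1 x)) = (LINT x|N2. w (Y2 x) *\<^sub>R \<kappa> k (X2 x))"
      proof -
        consider "w = (\<lambda>y. 1)" | "w = (\<lambda>y. 1 + cos y)" | "w = (\<lambda>y. 1 + sin y)" using w by auto
        then show ?thesis
        proof cases
          case 1
          then show ?thesis using e0 by simp
        next
          case 2
          have *: "w y *\<^sub>R z = z + (1 / 2) * (z * iexp y) + (1 / 2) * (z * iexp (- y))" for y z
            unfolding 2 scaleR_conv_of_real of_real_add cos_iexp by (simp add: field_simps)
          have "(LINT x|N1. w (Y1 x) *\<^sub>R \<kappa> k (X1 x)) = (LINT x|N1. \<kappa> k (X1 x))
             + (1 / 2) * (LINT x|N1. \<kappa> k (X1 x) * iexp (Y1 x)) + (1 / 2) * (LINT x|N1. \<kappa> k (X1 x) * iexp (- Y1 x))"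
            unfolding * using i10 i11 i1m by simp
          also have "\<dots> = (LINT x|N2. w (Y2 x) *\<^sub>R \<kappa> k (X2 x))"
            unfolding * using i20 i21 i2m e0 e1 em by simp
          finally show ?thesis .
        next
          case 3
          have *: "w y *\<^sub>R z = z + (1 / (2 * \<i>)) * (z * iexp y) + (- 1 / (2 * \<i>)) * (z * iexp (- y))" for y z
            unfolding 3 scaleR_conv_of_real of_real_add sin_iexp by (simp add: field_simps)
          have "(LINT x|N1. w (Y1 x) *\<^sub>R \<kappa> k (X1 x)) = (LINT x|N1. \<kappa> k (X1 x))
             + (1 / (2 * \<i>)) * (LINT x|N1. \<kappa> k (X1 x) * iexp (Y1 x)) + (- 1 / (2 * \<i>)) * (LINT x|N1. \<kappa> k (X1 x) * iexp (- Y1 x))"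
            unfolding * using i10 i11 i1m by simp
          also have "\<dots> = (LINT x|N2. w (Y2 x) *\<^sub>R \<kappa> k (X2 x))"
            unfolding * using i20 i21 i2m e0 e1 em by simp
          finally show ?thesis .
        qed
      qed
      then show "integral\<^sup>L D1 (\<kappa> k) = integral\<^sup>L D2 (\<kappa> k)"
        by (simp add: int1[OF \<kappa>[OF k]] int2[OF \<kappa>[OF k]])
    qed
    then show ?thesis using int1[OF G] int2[OF G] by simp
  qed
  have split: "(LINT x|N. G (X x) * iexp (Y x)) =
      ((LINT x|N. (1 + cos (Y x)) *\<^sub>R G (X x)) - (LINT x|N. 1 *\<^sub>R G (X x)))
      + \<i> * ((LINT x|N. (1 + sin (Y x)) *\<^sub>R G (X x)) - (LINT x|N. 1 *\<^sub>R G (X x)))"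
    if [measurable]: "X \<in> N \<rightarrow>\<^sub>M T" "Y \<in> borel_measurable N" and i: "integrable N (\<lambda>x. G (X x))"
    for N :: "'d measure" and X Y
  proof -
    have b: "\<bar>1 + cos y\<bar> \<le> 2" "\<bar>1 + sin y\<bar> \<le> 2" for y :: real
      using cos_ge_minus_one[of y] sin_ge_minus_one[of y] cos_le_one[of y] sin_le_one[of y] by linarith+
    have ic: "integrable N (\<lambda>x. (1 + cos (Y x)) *\<^sub>R G (X x))"
      by (rule Bochner_Integration.integrable_bound[OF integrable_scaleR_right[OF i, of 2]])
        (auto intro!: AE_I2 mult_right_mono b)
    have isin: "integrable N (\<lambda>x. (1 + sin (Y x)) *\<^sub>R G (X x))"
      by (rule Bochner_Integration.integrable_bound[OF integrable_scaleR_right[OF i, of 2]])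
        (auto intro!: AE_I2 mult_right_mono b)
    have "(LINT x|N. G (X x) * iexp (Y x)) =
      (LINT x|N. ((1 + cos (Y x)) *\<^sub>R G (X x) - 1 *\<^sub>R G (X x)) + \<i> * ((1 + sin (Y x)) *\<^sub>R G (X x) - 1 *\<^sub>R G (X x)))"
      by (intro Bochner_Integration.integral_cong refl)
        (simp only: iexp_cos_sin, simp add: scaleR_conv_of_real algebra_simps)
    then show ?thesis using i ic isin by simp
  qed
  show ?thesis
    unfolding split[OF X(1) Y(1) int(1)] split[OF X(2) Y(2) int(2)]
    using transfer[of "\<lambda>y. 1"] transfer[of "\<lambda>y. 1 + cos y"] transfer[of "\<lambda>y. 1 + sin y"] by simp
qed

lemma borel_measurable_iexp:
  assumes [measurable]: "X \<in> borel_measurable N"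
  shows "(\<lambda>\<eta>. iexp (X \<eta>)) \<in> borel_measurable N"
  by measurable

lemma borel_measurable_iexp_mult:
  assumes [measurable]: "X \<in> borel_measurable N" "Y \<in> borel_measurable N"
  shows "(\<lambda>\<eta>. iexp (t * X \<eta>) * iexp (e * Y \<eta>)) \<in> borel_measurable N"
  by measurable

text \<open>The indicator of a cylinder is introduced one evaluation at a time. If the integrals of
  \<open>1\<^sub>C exp (i \<integral>f d\<eta>)\<close> agree for all \<open>f\<close>, then uniqueness on the real line, applied to the
  evaluation at a further function \<open>h\<close>, shows that they still agree after intersecting \<open>C\<close> with an event
  \<open>{\<eta>. \<integral>h d\<eta> \<in> B}\<close>.\<close>

theorem fourier_determines_law:
  fixes N1 N2 :: "'a::euclidean_space measure measure"
  assumes N1: "finite_measure N1" and N2: "finite_measure N2"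
    and s: "sets N1 = sets discrete_borel" "sets N2 = sets discrete_borel"
    and eq: "\<And>f. f \<in> Cc \<Longrightarrow> (LINT \<eta>|N1. iexp (LINT x|\<eta>. f x)) = (LINT \<eta>|N2. iexp (LINT x|\<eta>. f x))"
  shows "N1 = N2"
proof -
  note [measurable_cong] = s
  define C where "C L \<eta> = (indicator (cylinder L) \<eta> :: complex)" for L and \<eta> :: "'a measure"
  have C_meas [measurable]: "C L \<in> borel_measurable discrete_borel" if "set L \<subseteq> Cc \<times> sets borel" for L
    using cylinder_sets[OF that] unfolding C_def[abs_def] by measurable
  have meas1: "(\<lambda>\<eta>. LINT x|\<eta>. f x) \<in> borel_measurable N1" and meas2: "(\<lambda>\<eta>. LINT x|\<eta>. f x) \<in> borel_measurable N2"
    if "f \<in> Cc" for f :: "'a \<Rightarrow> real"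
    using evaluation_measurable[OF that] s by (auto cong: measurable_cong_sets)
  have key: "(LINT \<eta>|N1. C L \<eta> * iexp (LINT x|\<eta>. f x)) = (LINT \<eta>|N2. C L \<eta> * iexp (LINT x|\<eta>. f x))"
    if "set L \<subseteq> Cc \<times> sets borel" "f \<in> Cc" for L f
    using that
  proof (induction L arbitrary: f)
    case Nil
    have "(LINT \<eta>|N. C [] \<eta> * iexp (LINT x|\<eta>. f x)) = (LINT \<eta>|N. iexp (LINT x|\<eta>. f x))"
      if "sets N = sets discrete_borel" for N
      using sets_eq_imp_space_eq[OF that]
      by (intro Bochner_Integration.integral_cong) (auto simp: C_def cylinder_def space_discrete_borel)
    then show ?case using eq[OF Nil(2)] s by simp
  next
    case (Cons p L)
    obtain h B where p: "p = (h, B)" by force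
    have h: "h \<in> Cc" and B: "B \<in> sets borel" and L: "set L \<subseteq> Cc \<times> sets borel"
      using Cons.prems p by auto
    note [measurable] = meas1[OF h] meas2[OF h] meas1[OF Cons.prems(2)] meas2[OF Cons.prems(2)] C_meas[OF L] B
    have restr: "(LINT \<eta>|density N (\<lambda>\<eta>. ennreal (Re (C L \<eta>))). H \<eta>) = (LINT \<eta>|N. C L \<eta> * H \<eta>)"
      if "sets N = sets discrete_borel" "H \<in> borel_measurable N" for N and H :: "'a measure \<Rightarrow> complex"
    proof -
      have [measurable_cong]: "sets N = sets discrete_borel" by fact
      have "(LINT \<eta>|density N (\<lambda>\<eta>. ennreal (Re (C L \<eta>))). H \<eta>) = (LINT \<eta>|N. Re (C L \<eta>) *\<^sub>R H \<eta>)"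
      proof (rule integral_density[OF that(2)])
        have "C L \<in> borel_measurable N"
          using C_meas[OF L] measurable_cong_sets[OF that(1) refl] by blast
        then show "(\<lambda>\<eta>. Re (C L \<eta>)) \<in> borel_measurable N" by measurable
        show "AE \<eta> in N. 0 \<le> Re (C L \<eta>)" by (simp add: C_def indicator_def)
      qed
      also have "\<dots> = (LINT \<eta>|N. C L \<eta> * H \<eta>)"
        by (rule Bochner_Integration.integral_cong) (simp_all add: C_def indicator_def)
      finally show ?thesis .
    qed
    have fin: "finite_measure (density N (\<lambda>\<eta>. ennreal (Re (C L \<eta>))))"
      if N: "finite_measure N" "sets N = sets discrete_borel" for N
    proof -
      have [measurable_cong]: "sets N = sets discrete_borel" by fact
      interpret finite_measure N by fact
      have "emeasure (density N (\<lambda>\<eta>. ennreal (Re (C L \<eta>)))) (space N) = (\<integral>\<^sup>+\<eta>. ennreal (Re (C L \<eta>)) \<partial>N)"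
        by (subst emeasure_density) (auto intro!: nn_integral_cong)
      also have "\<dots> \<le> (\<integral>\<^sup>+\<eta>. 1 \<partial>N)"
        by (intro nn_integral_mono) (auto simp: C_def split: split_indicator)
      also have "\<dots> < \<infinity>" by (simp add: emeasure_eq_measure)
      finally show ?thesis by (intro finite_measureI) auto
    qed
    have cons: "C (p # L) \<eta> = C L \<eta> * indicator B (LINT x|\<eta>. h x)" for \<eta>
      by (auto simp: C_def cylinder_def p split: split_indicator)
    let ?D = "\<lambda>N. density N (\<lambda>\<eta>. ennreal (Re (C L \<eta>)))"
    have "(LINT \<eta>|?D N1. indicator B (LINT x|\<eta>. h x) * iexp (LINT x|\<eta>. f x)) =
      (LINT \<eta>|?D N2. indicator B (LINT x|\<eta>. h x) * iexp (LINT x|\<eta>. f x))"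
    proof (rule complex_weight_transfer[where T = borel and K = UNIV and \<kappa> = "\<lambda>t x. iexp (t * x)"])
      show "finite_measure (?D N1)" "finite_measure (?D N2)" using fin N1 N2 s by auto
      then show "integrable (?D N1) (\<lambda>\<eta>. indicator B (LINT x|\<eta>. h x) :: complex)"
        "integrable (?D N2) (\<lambda>\<eta>. indicator B (LINT x|\<eta>. h x) :: complex)"
        by (auto intro!: finite_measure.integrable_const_bound[where B = 1] split: split_indicator)
      fix t e :: real
      have add: "(LINT x|\<eta>. t * h x + e * f x) = t * (LINT x|\<eta>. h x) + e * (LINT x|\<eta>. f x)"
        if "\<eta> \<in> discrete_radon" for \<eta>
        using that h Cons.prems(2) by (simp add: Cc_integrable discrete_radon_radon)
      have mult: "iexp (t * (LINT x|\<eta>. h x)) * iexp (e * (LINT x|\<eta>. f x)) = iexp (LINT x|\<eta>. t * h x + e * f x)"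
        if "\<eta> \<in> discrete_radon" for \<eta>
        unfolding add[OF that] by (simp add: exp_add distrib_left)
      have "(LINT \<eta>|?D N. iexp (t * (LINT x|\<eta>. h x)) * iexp (e * (LINT x|\<eta>. f x)))
          = (LINT \<eta>|N. C L \<eta> * iexp (LINT x|\<eta>. t * h x + e * f x))"
        if "sets N = sets discrete_borel" "(\<lambda>\<eta>. LINT x|\<eta>. h x) \<in> borel_measurable N"
          "(\<lambda>\<eta>. LINT x|\<eta>. f x) \<in> borel_measurable N" for N
      proof -
        have sp: "space N = discrete_radon"
          using sets_eq_imp_space_eq[OF that(1)] by (simp add: space_discrete_borel)
        have "(LINT \<eta>|?D N. iexp (t * (LINT x|\<eta>. h x)) * iexp (e * (LINT x|\<eta>. f x)))
          = (LINT \<eta>|N. C L \<eta> * (iexp (t * (LINT x|\<eta>. h x)) * iexp (e * (LINT x|\<eta>. f x))))"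
          by (rule restr[OF that(1) borel_measurable_iexp_mult[OF that(2,3)]])
        also have "\<dots> = (LINT \<eta>|N. C L \<eta> * iexp (LINT x|\<eta>. t * h x + e * f x))"
          by (rule Bochner_Integration.integral_cong[OF refl]) (simp only: mult sp)
        finally show ?thesis .
      qed
      moreover have "(\<lambda>x. t * h x + e * f x) \<in> Cc" using h Cons.prems(2) by (intro Cc_add Cc_scale)
      ultimately show "(LINT \<eta>|?D N1. iexp (t * (LINT x|\<eta>. h x)) * iexp (e * (LINT x|\<eta>. f x)))
        = (LINT \<eta>|?D N2. iexp (t * (LINT x|\<eta>. h x)) * iexp (e * (LINT x|\<eta>. f x)))"
        using Cons.IH[OF L] s meas1 meas2 h Cons.prems(2) by simp
    next
      fix M M' :: "real measure"
      assume "finite_measure M" "finite_measure M'" "sets M = sets borel" "sets M' = sets borel"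
        "\<And>k. k \<in> UNIV \<Longrightarrow> (LINT x|M. iexp (k * x)) = (LINT x|M'. iexp (k * x))"
      then show "M = M'" by (intro finite_char_eqI) (auto simp: char_def)
    qed auto
    then show ?case
      using s by (simp add: restr cons mult.assoc)
  qed
  show ?thesis
  proof (rule measure_eqI_cylinder[OF N1 s])
    fix L :: "(('a \<Rightarrow> real) \<times> real set) list" assume L: "set L \<subseteq> Cc \<times> sets borel"
    have "(LINT \<eta>|N1. C L \<eta>) = (LINT \<eta>|N2. C L \<eta>)"
      using key[OF L Cc_zero] by simp
    then have "complex_of_real (measure N1 (cylinder L)) = complex_of_real (measure N2 (cylinder L))"
    proof -
      have "(LINT \<eta>|N. C L \<eta>) = complex_of_real (measure N (cylinder L))"
        if "sets N = sets discrete_borel" for N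
      proof -
        have "cylinder L \<inter> space N = cylinder L"
          using cylinder_sets[OF L] that sets.sets_into_space[of "cylinder L" N] by auto
        moreover have "C L \<eta> = complex_of_real (indicator (cylinder L) \<eta>)" for \<eta>
          by (simp add: C_def indicator_def)
        ultimately show ?thesis
          by (simp only: integral_complex_of_real Bochner_Integration.integral_indicator)
      qed
      from this[OF s(1)] this[OF s(2)] \<open>(LINT \<eta>|N1. C L \<eta>) = (LINT \<eta>|N2. C L \<eta>)\<close>
      show ?thesis by metis
    qed
    then show "emeasure N1 (cylinder L) = emeasure N2 (cylinder L)"
      using N1 N2 by (simp add: finite_measure.emeasure_eq_measure)
  qed
qed

section \<open>Poisson samples\<close>

lemma
  fixes z :: complex
  assumes r: "rate > 0"
  shows integrable_poisson_power: "integrable (measure_pmf (poisson_pmf rate)) (\<lambda>n. z ^ n)"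
    and integral_poisson_power: "(LINT n|measure_pmf (poisson_pmf rate). z ^ n) = exp (rate * (z - 1))"
proof -
  have s: "(\<lambda>n. pmf (poisson_pmf rate) n *\<^sub>R z ^ n) sums (exp (of_real (- rate)) * exp (rate * z))"
  proof -
    have "(\<lambda>n. exp (of_real (- rate)) * ((rate * z) ^ n /\<^sub>R fact n)) sums (exp (of_real (- rate)) * exp (rate * z))"
      by (intro sums_mult exp_converges)
    moreover have "exp (of_real (- rate)) * ((rate * z) ^ n /\<^sub>R fact n) = pmf (poisson_pmf rate) n *\<^sub>R z ^ n" for n
      using r by (simp add: scaleR_conv_of_real exp_of_real[symmetric] power_mult_distrib field_simps del: exp_of_real)
    ultimately show ?thesis by simp
  qed
  have n: "summable (\<lambda>n. norm (pmf (poisson_pmf rate) n *\<^sub>R z ^ n))"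
  proof -
    have "summable (\<lambda>n. exp (- rate) * ((rate * norm z) ^ n /\<^sub>R fact n))"
      by (intro summable_mult summable_exp_generic)
    moreover have "exp (- rate) * ((rate * norm z) ^ n /\<^sub>R fact n) = norm (pmf (poisson_pmf rate) n *\<^sub>R z ^ n)" for n
      using r by (simp add: norm_power power_mult_distrib field_simps)
    ultimately show ?thesis by (simp only:)
  qed
  have i: "integrable (count_space UNIV) (\<lambda>n. pmf (poisson_pmf rate) n *\<^sub>R z ^ n)"
    using n by (simp add: integrable_count_space_nat_iff)
  show "integrable (measure_pmf (poisson_pmf rate)) (\<lambda>n. z ^ n)"
    unfolding measure_pmf_eq_density using i by (subst integrable_density) auto
  have "(LINT n|measure_pmf (poisson_pmf rate). z ^ n) = (LINT n|count_space UNIV. pmf (poisson_pmf rate) n *\<^sub>R z ^ n)"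
    unfolding measure_pmf_eq_density by (subst integral_density) auto
  also have "\<dots> = (\<Sum>n. pmf (poisson_pmf rate) n *\<^sub>R z ^ n)"
    by (rule integral_count_space_nat[OF i])
  also have "\<dots> = exp (of_real (- rate)) * exp (rate * z)"
    using s by (rule sums_unique[symmetric])
  also have "\<dots> = exp (rate * (z - 1))"
    by (simp add: exp_add[symmetric] algebra_simps)
  finally show "(LINT n|measure_pmf (poisson_pmf rate). z ^ n) = exp (rate * (z - 1))" .
qed

lemma indep_vars_PiM_coordinates:
  assumes Q: "prob_space Q" and f: "inj_on f I" and I: "I \<noteq> {}"
  shows "prob_space.indep_vars (PiM UNIV (\<lambda>_::nat. Q)) (\<lambda>_. Q) (\<lambda>i p. p (f i)) I"
proof -
  interpret P: prob_space "PiM UNIV (\<lambda>_::nat. Q)" by (intro prob_space_PiM Q)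
  have "distr (PiM UNIV (\<lambda>_::nat. Q)) Q (\<lambda>p. p (f i)) = Q" for i
    by (rule distr_PiM_component) (auto intro: Q)
  then show ?thesis
    using distr_PiM_reindex[of UNIV "\<lambda>_::nat. Q" f I, OF Q f]
    by (subst P.indep_vars_iff_distr_eq_PiM'[OF I]) auto
qed

lemma
  fixes H :: "'p \<Rightarrow> complex"
  assumes Q: "prob_space Q" and H: "integrable Q H"
  shows integrable_PiM_power: "integrable (PiM UNIV (\<lambda>_::nat. Q)) (\<lambda>p. \<Prod>i<n. H (p i))"
    and integral_PiM_power: "(LINT p|PiM UNIV (\<lambda>_::nat. Q). (\<Prod>i<n. H (p i))) = (LINT q|Q. H q) ^ n"
proof -
  interpret P: prob_space "PiM UNIV (\<lambda>_::nat. Q)" by (intro prob_space_PiM Q)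
  have [measurable]: "H \<in> borel_measurable Q" using H by simp
  have d: "distr (PiM UNIV (\<lambda>_::nat. Q)) Q (\<lambda>p. p i) = Q" for i
    by (rule distr_PiM_component) (auto intro: Q)
  have int: "integrable (PiM UNIV (\<lambda>_::nat. Q)) (\<lambda>p. H (p i))" for i
    using H d[of i] integrable_distr_eq[of "\<lambda>p. p i" "PiM UNIV (\<lambda>_::nat. Q)" Q H] by simp
  have val: "(LINT p|PiM UNIV (\<lambda>_::nat. Q). H (p i)) = (LINT q|Q. H q)" for i
    using d[of i] integral_distr[of "\<lambda>p. p i" "PiM UNIV (\<lambda>_::nat. Q)" Q H] by simp
  have ind: "P.indep_vars (\<lambda>_. borel) (\<lambda>i p. H (p i)) {..<n}" if "n > 0"
  proof -
    have "P.indep_vars (\<lambda>_. Q) (\<lambda>i p. p i) {..<n}"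
      using indep_vars_PiM_coordinates[OF Q, of "\<lambda>i. i" "{..<n}"] that by auto
    then show ?thesis by (rule P.indep_vars_compose2) simp
  qed
  show "integrable (PiM UNIV (\<lambda>_::nat. Q)) (\<lambda>p. \<Prod>i<n. H (p i))"
    using P.indep_vars_integrable[OF _ ind int] by (cases "n = 0") auto
  show "(LINT p|PiM UNIV (\<lambda>_::nat. Q). (\<Prod>i<n. H (p i))) = (LINT q|Q. H q) ^ n"
    using P.indep_vars_lebesgue_integral[OF _ ind int] by (cases "n = 0") (auto simp: val P.prob_space)
qed

text \<open>A Poisson number of independent points that are distributed according to the normalised restriction of
  \<open>M\<close> to \<open>A\<close>. The points come as an infinite sequence; in a sample \<open>(n, p)\<close> only the first \<open>n\<close> of them count.\<close>

definition poisson_sample :: "'p measure \<Rightarrow> 'p set \<Rightarrow> (nat \<times> (nat \<Rightarrow> 'p)) measure" where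
  "poisson_sample M A = measure_pmf (poisson_pmf (measure M A)) \<Otimes>\<^sub>M PiM UNIV (\<lambda>_. uniform_measure M A)"

locale finite_positive_set =
  fixes M :: "'p measure" and A
  assumes A [measurable]: "A \<in> sets M" and pos: "emeasure M A \<noteq> 0" and fin: "emeasure M A \<noteq> \<infinity>"
begin

abbreviation "Q \<equiv> uniform_measure M A"

lemma Q_prob: "prob_space Q"
  by (rule prob_space_uniform_measure[OF pos fin])

lemma mass_pos: "measure M A > 0"
  using pos fin by (metis emeasure_eq_ennreal_measure ennreal_0 infinity_ennreal_def less_eq_real_def measure_nonneg)

lemma sample_prob: "prob_space (poisson_sample M A)"
  unfolding poisson_sample_def
  by (intro prob_space_pair prob_space_PiM Q_prob prob_space_measure_pmf)

lemma Q_density: "Q = density M (\<lambda>x. ennreal (indicator A x / measure M A))"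
  unfolding uniform_measure_def
proof (rule density_cong)
  show "AE x in M. indicator A x / emeasure M A = ennreal (indicator A x / measure M A)"
    using mass_pos fin
    by (auto simp: emeasure_eq_ennreal_measure divide_ennreal[symmetric] split: split_indicator)
qed auto

lemma Q_integral:
  fixes H :: "'p \<Rightarrow> complex"
  assumes "H \<in> borel_measurable M" "set_integrable M A H"
  shows "integrable Q H" and "(LINT q|Q. H q) = (LINT p:A|M. H p) /\<^sub>R measure M A"
proof -
  have *: "(indicator A x / measure M A) *\<^sub>R H x = (indicator A x *\<^sub>R H x) /\<^sub>R measure M A" for x
    by (simp add: divide_inverse mult.commute)
  have "integrable M (\<lambda>x. (indicator A x / measure M A) *\<^sub>R H x)"
    unfolding * using assms(2) unfolding set_integrable_def by (intro integrable_scaleR_right)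
  then show "integrable Q H"
    unfolding Q_density using assms(1) by (subst integrable_density) auto
  show "(LINT q|Q. H q) = (LINT p:A|M. H p) /\<^sub>R measure M A"
  proof -
    have "(LINT q|Q. H q) = (LINT x|M. (indicator A x / measure M A) *\<^sub>R H x)"
      unfolding Q_density using assms(1) by (subst integral_density) auto
    also have "\<dots> = (LINT x|M. (indicator A x *\<^sub>R H x) /\<^sub>R measure M A)"
      by (simp only: *)
    finally show ?thesis
      by (simp only: integral_scaleR_right set_lebesgue_integral_def)
  qed
qed

text \<open>Given the number \<open>n\<close> of points, the expectation of the product is the \<open>n\<close>-th power of the mean of
  \<open>H\<close>, and the generating function of the Poisson distribution turns the powers into an exponential.\<close>

theorem
  fixes H :: "'p \<Rightarrow> complex"
  assumes H [measurable]: "H \<in> borel_measurable M" "set_integrable M A H"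
  shows integrable_sample_prod: "integrable (poisson_sample M A) (\<lambda>(n, p). \<Prod>i<n. H (p i))"
    and integral_sample_prod: "(LINT (n, p)|poisson_sample M A. (\<Prod>i<n. H (p i))) = exp (LINT p:A|M. H p - 1)"
proof -
  let ?N = "measure_pmf (poisson_pmf (measure M A))" and ?P = "PiM UNIV (\<lambda>_::nat. Q)"
  interpret N: prob_space ?N by (rule prob_space_measure_pmf)
  interpret P: prob_space ?P by (intro prob_space_PiM Q_prob)
  interpret NP: pair_prob_space ?N ?P ..
  have [measurable]: "H \<in> borel_measurable Q" using H(1) by simp
  have meas: "(\<lambda>(n, p). \<Prod>i<n. H (p i)) \<in> borel_measurable (?N \<Otimes>\<^sub>M ?P)"
    by measurable
  note iH = Q_integral[OF H]
  have inorm: "integrable Q (\<lambda>q. complex_of_real (norm (H q)))"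
    using iH(1) by auto
  have norm: "(LINT p|?P. norm (\<Prod>i<n. H (p i))) = (LINT q|Q. norm (H q)) ^ n" for n
  proof -
    have "complex_of_real (LINT p|?P. norm (\<Prod>i<n. H (p i))) = (LINT p|?P. (\<Prod>i<n. complex_of_real (norm (H (p i)))))"
      by (simp add: prod_norm[symmetric] integral_complex_of_real[symmetric] del: integral_complex_of_real)
    also have "\<dots> = complex_of_real ((LINT q|Q. norm (H q)) ^ n)"
      by (simp add: integral_PiM_power[OF Q_prob inorm])
    finally show ?thesis using of_real_eq_iff by blast
  qed
  show int: "integrable (poisson_sample M A) (\<lambda>(n, p). \<Prod>i<n. H (p i))"
    unfolding poisson_sample_def
  proof (rule NP.Fubini_integrable[OF meas])
    have "integrable ?N (\<lambda>n. complex_of_real ((LINT q|Q. norm (H q)) ^ n))"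
      using integrable_poisson_power[OF mass_pos, of "complex_of_real (LINT q|Q. norm (H q))"] by simp
    then have "integrable ?N (\<lambda>n. (LINT q|Q. norm (H q)) ^ n)"
      by (simp only: complex_of_real_integrable_eq)
    then show "integrable ?N (\<lambda>n. LINT p|?P. norm (case (n, p) of (n, p) \<Rightarrow> \<Prod>i<n. H (p i)))"
      by (simp add: norm)
    show "AE n in ?N. integrable ?P (\<lambda>p. case (n, p) of (n, p) \<Rightarrow> \<Prod>i<n. H (p i))"
      by (simp add: integrable_PiM_power[OF Q_prob iH(1)])
  qed
  have "(LINT (n, p)|poisson_sample M A. (\<Prod>i<n. H (p i))) = (LINT n|?N. LINT p|?P. (\<Prod>i<n. H (p i)))"
    using NP.integral_fst'[OF int[unfolded poisson_sample_def]] by (simp add: poisson_sample_def)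
  also have "\<dots> = (LINT n|?N. (LINT q|Q. H q) ^ n)"
    by (simp add: integral_PiM_power[OF Q_prob iH(1)])
  also have "\<dots> = exp (measure M A * ((LINT q|Q. H q) - 1))"
    by (rule integral_poisson_power[OF mass_pos])
  also have "measure M A * ((LINT q|Q. H q) - 1) = (LINT p:A|M. H p) - (LINT p:A|M. 1)"
  proof -
    have "(LINT p:A|M. 1 :: complex) = complex_of_real (measure M A)"
      using fin A by (simp add: set_lebesgue_integral_def less_top scaleR_conv_of_real)
    then show ?thesis
      using mass_pos by (simp add: iH(2) scaleR_conv_of_real right_diff_distrib)
  qed
  also have "\<dots> = (LINT p:A|M. H p - 1)"
    using H(2) fin A by (subst set_integral_diff) (auto simp: set_integrable_def less_top)
  finally show "(LINT (n, p)|poisson_sample M A. (\<Prod>i<n. H (p i))) = exp (LINT p:A|M. H p - 1)" .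
qed

lemma AE_sample_in: "AE (n, p) in poisson_sample M A. \<forall>i. p i \<in> A"
proof -
  let ?N = "measure_pmf (poisson_pmf (measure M A))" and ?P = "PiM UNIV (\<lambda>_::nat. Q)"
  interpret N: prob_space ?N by (rule prob_space_measure_pmf)
  interpret P: prob_space ?P by (intro prob_space_PiM Q_prob)
  interpret NP: pair_prob_space ?N ?P ..
  have "AE p in ?P. p i \<in> A" for i
    by (rule AE_PiM_component) (auto intro: Q_prob AE_uniform_measureI)
  then have "AE p in ?P. \<forall>i. p i \<in> A" by (simp add: AE_all_countable)
  then have *: "AE n in ?N. AE p in ?P. \<forall>i. snd (n, p) i \<in> A" by simp
  have "AE x in ?N \<Otimes>\<^sub>M ?P. \<forall>i. snd x i \<in> A"
  proof (rule NP.AE_pair_measure[OF _ *])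
    have [measurable]: "A \<in> sets Q" by simp
    show "{x \<in> space (?N \<Otimes>\<^sub>M ?P). \<forall>i. snd x i \<in> A} \<in> sets (?N \<Otimes>\<^sub>M ?P)"
      by measurable
  qed
  then show ?thesis unfolding poisson_sample_def case_prod_beta .
qed

text \<open>Two of the points are independent, and by diffuseness the second one avoids the value of \<open>f\<close> at the first.\<close>

lemma AE_sample_distinct:
  assumes f [measurable]: "f \<in> borel_measurable M" and diffuse: "\<And>y. emeasure M {x\<in>space M. f x = y} = 0"
  shows "AE (n, p) in poisson_sample M A. inj (\<lambda>i. f (p i) :: 'x::euclidean_space)"
proof -
  let ?N = "measure_pmf (poisson_pmf (measure M A))" and ?P = "PiM UNIV (\<lambda>_::nat. Q)"
  interpret N: prob_space ?N by (rule prob_space_measure_pmf)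
  interpret P: prob_space ?P by (intro prob_space_PiM Q_prob)
  interpret NP: pair_prob_space ?N ?P ..
  interpret Q: prob_space Q by (rule Q_prob)
  interpret QQ: pair_prob_space Q Q ..
  have [measurable]: "f \<in> borel_measurable Q" by simp
  have QQ: "AE (a, b) in Q \<Otimes>\<^sub>M Q. f a \<noteq> f b"
  proof (rule QQ.AE_pair_measure)
    show "{x \<in> space (Q \<Otimes>\<^sub>M Q). case x of (a, b) \<Rightarrow> f a \<noteq> f b} \<in> sets (Q \<Otimes>\<^sub>M Q)"
      by measurable
    show "AE x in Q. AE y in Q. case (x, y) of (a, b) \<Rightarrow> f a \<noteq> f b"
    proof (rule AE_I2)
      fix a
      have "AE b in M. f b \<noteq> f a"
        using diffuse[of "f a"] by (intro AE_I[where N = "{x\<in>space M. f x = f a}"]) auto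
      then show "AE b in Q. case (a, b) of (a, b) \<Rightarrow> f a \<noteq> f b"
        by (intro AE_uniform_measureI) auto
    qed
  qed
  have ne: "AE p in ?P. f (p i) \<noteq> f (p j)" if "i \<noteq> j" for i j
  proof -
    have d: "distr ?P Q (\<lambda>p. p i) = Q" for i
      by (rule distr_PiM_component) (auto intro: Q_prob)
    have ind: "P.indep_vars (\<lambda>_. Q) (\<lambda>b p. p (case_bool i j b)) UNIV"
      using that by (intro indep_vars_PiM_coordinates Q_prob) (auto simp: inj_on_def split: bool.splits)
    have e: "(\<lambda>_::bool. Q) = case_bool Q Q"
      "(\<lambda>b p. p (case_bool i j b)) = case_bool (\<lambda>p :: nat \<Rightarrow> 'p. p i) (\<lambda>p. p j)"
      by (auto simp: fun_eq_iff split: bool.splits)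
    have "P.indep_var Q (\<lambda>p. p i) Q (\<lambda>p. p j)"
      unfolding P.indep_var_def using ind
      by (subst e(1)[symmetric], subst e(2)[symmetric])
    then have dd: "distr ?P (Q \<Otimes>\<^sub>M Q) (\<lambda>p. (p i, p j)) = Q \<Otimes>\<^sub>M Q"
      by (simp add: P.indep_var_distribution_eq d)
    from QQ have "AE x in distr ?P (Q \<Otimes>\<^sub>M Q) (\<lambda>p. (p i, p j)). case x of (a, b) \<Rightarrow> f a \<noteq> f b"
      unfolding dd .
    from AE_distrD[OF _ this] show ?thesis by simp
  qed
  have *: "AE x in ?N \<Otimes>\<^sub>M ?P. f (snd x i) \<noteq> f (snd x j)" if "i \<noteq> j" for i j
  proof (rule NP.AE_pair_measure)
    have [measurable]: "(\<lambda>x. f (snd x i)) \<in> borel_measurable (?N \<Otimes>\<^sub>M ?P)" for i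
      by (intro measurable_compose[OF measurable_compose[OF measurable_snd measurable_component_singleton]]) auto
    show "{x \<in> space (?N \<Otimes>\<^sub>M ?P). f (snd x i) \<noteq> f (snd x j)} \<in> sets (?N \<Otimes>\<^sub>M ?P)"
      by measurable
    show "AE n in ?N. AE p in ?P. f (snd (n, p) i) \<noteq> f (snd (n, p) j)"
      using ne[OF that] by simp
  qed
  have "AE x in ?N \<Otimes>\<^sub>M ?P. i \<noteq> j \<longrightarrow> f (snd x i) \<noteq> f (snd x j)" for i j
    using *[of i j] by (cases "i = j") auto
  then have "AE x in ?N \<Otimes>\<^sub>M ?P. \<forall>i j. i \<noteq> j \<longrightarrow> f (snd x i) \<noteq> f (snd x j)"
    by (simp add: AE_all_countable)
  then have "AE x in ?N \<Otimes>\<^sub>M ?P. inj (\<lambda>i. f (snd x i))"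
    by (rule AE_mp) (auto simp: inj_def intro!: AE_I2)
  then show ?thesis unfolding poisson_sample_def case_prod_beta .
qed

end

section \<open>The restriction to a ball\<close>

text \<open>With \<open>h\<close> and \<open>f\<close> in \<^const>\<open>Cc\<close> these are test functions that may jump at the boundary of \<open>\<Lambda>\<close>. They
  separate the part of a measure in \<open>\<Lambda>\<close> from the part outside.\<close>

definition glue :: "'a set \<Rightarrow> ('a \<Rightarrow> real) \<Rightarrow> ('a \<Rightarrow> real) \<Rightarrow> 'a \<Rightarrow> real" where
  "glue \<Lambda> h f x = (if x \<in> \<Lambda> then h x else f x)"

lemma glue_measurable [measurable]:
  assumes [measurable]: "\<Lambda> \<in> sets borel" "h \<in> borel_measurable borel" "f \<in> borel_measurable borel"
  shows "glue \<Lambda> h f \<in> borel_measurable (borel :: 'a::euclidean_space measure)"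
  unfolding glue_def[abs_def] by measurable

text \<open>The indicator of a closed set is a pointwise limit of continuous cut-off functions.\<close>

lemma glue_approx:
  fixes \<Lambda> :: "'a::euclidean_space set"
  assumes \<Lambda>: "closed \<Lambda>" and h: "h \<in> Cc" and f: "f \<in> Cc"
  obtains k R C where "\<And>n::nat. k n \<in> Cc" "\<And>x. (\<lambda>n. k n x) \<longlonglongrightarrow> glue \<Lambda> h f x"
    "\<And>n x. \<bar>k n x\<bar> \<le> C" "\<And>n x. x \<notin> cball 0 R \<Longrightarrow> k n x = 0"
proof (cases "\<Lambda> = {}")
  case True
  from f obtain R C where "\<And>x. x \<notin> cball 0 R \<Longrightarrow> f x = 0" "\<And>x. \<bar>f x\<bar> \<le> C" by (rule CcE) blast
  with True f show ?thesis by (intro that[of "\<lambda>n. f" C R]) (auto simp: glue_def)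
next
  case False
  from f obtain R C where fR: "\<And>x. x \<notin> cball 0 R \<Longrightarrow> f x = 0" "\<And>x. \<bar>f x\<bar> \<le> C" by (rule CcE) blast
  from h obtain S D where hS: "\<And>x. x \<notin> cball 0 S \<Longrightarrow> h x = 0" "\<And>x. \<bar>h x\<bar> \<le> D" by (rule CcE) blast
  define c where "c n x = max 0 (1 - real n * infdist x \<Lambda>)" for n x
  have c01: "0 \<le> c n x" "c n x \<le> 1" for n x by (auto simp: c_def infdist_nonneg)
  have cc: "continuous_on UNIV (c n)" "continuous_on UNIV (\<lambda>x. 1 - c n x)" for n
    unfolding c_def by (auto intro!: continuous_intros)
  define k where "k n x = h x * c n x + f x * (1 - c n x)" for n x
  show ?thesis
  proof (rule that[of k "D + C" "max R S"])
    show "k n \<in> Cc" for n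
      unfolding k_def[abs_def] by (intro Cc_add Cc_mult_continuous h f cc)
    show "(\<lambda>n. k n x) \<longlonglongrightarrow> glue \<Lambda> h f x" for x
    proof (cases "x \<in> \<Lambda>")
      case True
      then show ?thesis by (simp add: k_def c_def glue_def)
    next
      case x: False
      then have d: "infdist x \<Lambda> > 0"
        using \<Lambda> False by (simp add: infdist_pos_not_in_closed)
      have "eventually (\<lambda>n. real n \<ge> 1 / infdist x \<Lambda>) sequentially"
        by real_asymp
      then have "eventually (\<lambda>n. k n x = glue \<Lambda> h f x) sequentially"
      proof eventually_elim
        case (elim n)
        then have "1 \<le> real n * infdist x \<Lambda>" using d by (simp add: pos_divide_le_eq)
        then show ?case using x by (simp add: k_def c_def glue_def)
      qed
      then show ?thesis by (rule tendsto_eventually)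
    qed
    show "\<bar>k n x\<bar> \<le> D + C" for n x
    proof -
      have "\<bar>k n x\<bar> \<le> \<bar>h x\<bar> * c n x + \<bar>f x\<bar> * (1 - c n x)"
        unfolding k_def using c01[of n x] by (intro order_trans[OF abs_triangle_ineq]) (simp add: abs_mult)
      also have "\<dots> \<le> \<bar>h x\<bar> * 1 + \<bar>f x\<bar> * 1"
        using c01[of n x] by (intro add_mono mult_left_mono) auto
      finally show ?thesis using fR(2)[of x] hS(2)[of x] by simp
    qed
    show "k n x = 0" if "x \<notin> cball 0 (max R S)" for n x
      using fR(1)[of x] hS(1)[of x] that by (simp add: k_def)
  qed
qed

lemma glue_bounds:
  fixes \<Lambda> :: "'a::euclidean_space set"
  assumes h: "h \<in> Cc" and f: "f \<in> Cc"
  obtains R C where "\<And>x. \<bar>glue \<Lambda> h f x\<bar> \<le> C" "\<And>x. x \<notin> cball 0 R \<Longrightarrow> glue \<Lambda> h f x = 0"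
proof -
  from f obtain R C where fR: "\<And>x. x \<notin> cball 0 R \<Longrightarrow> f x = 0" "\<And>x. \<bar>f x\<bar> \<le> C" by (rule CcE) blast
  from h obtain S D where hS: "\<And>x. x \<notin> cball 0 S \<Longrightarrow> h x = 0" "\<And>x. \<bar>h x\<bar> \<le> D" by (rule CcE) blast
  show ?thesis
  proof (rule that[of "max C D" "max R S"])
    show "\<bar>glue \<Lambda> h f x\<bar> \<le> max C D" for x
      using fR(2)[of x] hS(2)[of x] by (auto simp: glue_def)
    show "glue \<Lambda> h f x = 0" if "x \<notin> cball 0 (max R S)" for x
      using fR(1)[of x] hS(1)[of x] that by (simp add: glue_def)
  qed
qed

lemma glue_integrable:
  assumes \<eta>: "\<eta> \<in> radon_measures" and \<Lambda>: "closed \<Lambda>" and h: "h \<in> Cc" and f: "f \<in> Cc"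
  shows "integrable \<eta> (glue \<Lambda> h f)"
proof -
  obtain R C where RC: "\<And>x. \<bar>glue \<Lambda> h f x\<bar> \<le> C" "\<And>x. x \<notin> cball 0 R \<Longrightarrow> glue \<Lambda> h f x = 0"
    using glue_bounds[OF h f] by metis
  have "glue \<Lambda> h f \<in> borel_measurable borel"
    using \<Lambda> by (intro glue_measurable Cc_measurable h f) auto
  then show ?thesis by (rule radon_integrable[OF \<eta> _ RC(2,1)])
qed

lemma LINT_tendsto_dominated:
  fixes \<eta> :: "'a::euclidean_space measure"
  assumes \<eta>: "\<eta> \<in> radon_measures" and k: "\<And>n. k n \<in> Cc" "\<And>x. (\<lambda>n. k n x) \<longlonglongrightarrow> g x"
    and g: "g \<in> borel_measurable borel"
    and b: "\<And>n x. \<bar>k n x\<bar> \<le> C" "\<And>n x. x \<notin> cball 0 R \<Longrightarrow> k n x = 0"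
  shows "(\<lambda>n. LINT x|\<eta>. k n x) \<longlonglongrightarrow> (LINT x|\<eta>. g x)"
proof (rule integral_dominated_convergence[where w = "\<lambda>x. C * indicator (cball 0 R) x"])
  note [measurable_cong] = radon_sets[OF \<eta>]
  show "g \<in> borel_measurable \<eta>" using g by measurable
  show "k n \<in> borel_measurable \<eta>" for n using Cc_measurable[OF k(1)] by measurable
  show "integrable \<eta> (\<lambda>x. C * indicator (cball 0 R) x)"
    by (rule radon_integrable[OF \<eta>, of _ R "\<bar>C\<bar>"]) (auto simp: indicator_def)
  show "AE x in \<eta>. (\<lambda>n. k n x) \<longlonglongrightarrow> g x" using k(2) by simp
  show "AE x in \<eta>. norm (k n x) \<le> C * indicator (cball 0 R) x" for n
    using b(1)[of n] b(2)[of _ n] by (intro AE_I2) (auto simp: indicator_def)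
qed

lemma glue_evaluation_measurable:
  assumes \<Lambda>: "closed \<Lambda>" and h: "h \<in> Cc" and f: "f \<in> Cc"
  shows "(\<lambda>\<eta>. LINT x|\<eta>. glue \<Lambda> h f x) \<in> borel_measurable discrete_borel"
proof -
  obtain k R C where k: "\<And>n::nat. k n \<in> Cc" "\<And>x. (\<lambda>n. k n x) \<longlonglongrightarrow> glue \<Lambda> h f x"
    "\<And>n x. \<bar>k n x\<bar> \<le> C" "\<And>n x. x \<notin> cball 0 R \<Longrightarrow> k n x = 0"
    using glue_approx[OF assms] by metis
  have g: "glue \<Lambda> h f \<in> borel_measurable borel"
    using \<Lambda> by (intro glue_measurable Cc_measurable h f) auto
  show ?thesis
  proof (rule borel_measurable_LIMSEQ_real)
    show "(\<lambda>n. LINT x|\<eta>. k n x) \<longlonglongrightarrow> (LINT x|\<eta>. glue \<Lambda> h f x)" if "\<eta> \<in> space discrete_borel" for \<eta>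
      using that by (intro LINT_tendsto_dominated[OF _ k(1,2) g k(3,4)])
        (auto simp: space_discrete_borel discrete_radon_radon)
    show "(\<lambda>\<eta>. LINT x|\<eta>. k n x) \<in> borel_measurable discrete_borel" for n
      by (rule evaluation_measurable[OF k(1)])
  qed
qed

definition restrict_measure :: "'a::euclidean_space set \<Rightarrow> 'a measure \<Rightarrow> 'a measure" where
  "restrict_measure \<Lambda> \<eta> = density \<eta> (indicator \<Lambda>)"

lemma restrict_measure_discrete:
  assumes \<eta>: "\<eta> \<in> discrete_radon" and \<Lambda>: "\<Lambda> \<in> sets borel"
  shows "restrict_measure \<Lambda> \<eta> \<in> discrete_radon"
proof -
  have r: "\<eta> \<in> radon_measures" by (rule discrete_radon_radon[OF \<eta>])
  have s: "sets \<eta> = sets borel" by (rule radon_sets[OF r])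
  have em: "emeasure (restrict_measure \<Lambda> \<eta>) B \<le> emeasure \<eta> B" if "B \<in> sets borel" for B
    using that \<Lambda> s unfolding restrict_measure_def
    by (subst emeasure_restricted) (auto intro!: emeasure_mono)
  obtain A where A: "countable A" "emeasure \<eta> (- A) = 0"
    using \<eta> by (auto simp: discrete_radon_iff)
  have "- A \<in> sets borel" using A(1) by (intro borel_comp countable_sets_borel)
  with em[of "- A"] A have "emeasure (restrict_measure \<Lambda> \<eta>) (- A) = 0" by simp
  moreover have "emeasure (restrict_measure \<Lambda> \<eta>) K < \<infinity>" if "compact K" for K
    using em[of K] radon_finite[OF r that] compact_imp_closed[OF that] by (simp add: le_less_trans)
  ultimately show ?thesis
    using A(1) s by (auto simp: discrete_radon_iff radon_measures_def restrict_measure_def)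
qed

lemma restrict_measure_integral:
  assumes \<eta>: "\<eta> \<in> radon_measures" and \<Lambda>: "\<Lambda> \<in> sets borel" and h: "h \<in> borel_measurable borel"
  shows "(LINT x|restrict_measure \<Lambda> \<eta>. h x) = (LINT x|\<eta>. glue \<Lambda> h (\<lambda>x. 0) x)"
proof -
  note [measurable_cong] = radon_sets[OF \<eta>]
  note [measurable] = \<Lambda> h
  have "restrict_measure \<Lambda> \<eta> = density \<eta> (\<lambda>x. ennreal (indicator \<Lambda> x))"
    unfolding restrict_measure_def by (rule arg_cong[where f = "density \<eta>"]) (auto simp: indicator_def fun_eq_iff)
  then have "(LINT x|restrict_measure \<Lambda> \<eta>. h x) = (LINT x|\<eta>. indicator \<Lambda> x *\<^sub>R h x)"
    by (simp add: integral_density)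
  also have "\<dots> = (LINT x|\<eta>. glue \<Lambda> h (\<lambda>x. 0) x)"
    by (rule Bochner_Integration.integral_cong) (auto simp: glue_def)
  finally show ?thesis .
qed

lemma restrict_measure_measurable:
  assumes "closed \<Lambda>"
  shows "restrict_measure \<Lambda> \<in> discrete_borel \<rightarrow>\<^sub>M discrete_borel"
proof (rule measurable_discrete_borelI)
  have L: "\<Lambda> \<in> sets borel" using assms by simp
  fix f :: "'a \<Rightarrow> real" assume f: "f \<in> Cc"
  have "(\<lambda>\<eta>. LINT x|\<eta>. glue \<Lambda> f (\<lambda>x. 0) x) \<in> borel_measurable discrete_borel"
    by (rule glue_evaluation_measurable[OF assms f Cc_zero])
  then show "(\<lambda>\<eta>. LINT x|restrict_measure \<Lambda> \<eta>. f x) \<in> borel_measurable discrete_borel"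
    by (rule measurable_cong[THEN iffD1, rotated])
      (simp add: restrict_measure_integral[OF _ L Cc_measurable[OF f]] space_discrete_borel discrete_radon_radon)
qed (use assms in \<open>auto simp: space_discrete_borel intro!: restrict_measure_discrete\<close>)

text \<open>The sum of the point masses \<open>snd (p i)\<close> at \<open>fst (p i)\<close> over \<open>i < n\<close>; weights at coinciding points add up.\<close>

definition config_measure :: "nat \<times> (nat \<Rightarrow> 'a::euclidean_space \<times> real) \<Rightarrow> 'a measure" where
  "config_measure = (\<lambda>(n, p). distr (density (count_space {..<n}) (\<lambda>i. ennreal (snd (p i)))) borel (\<lambda>i. fst (p i)))"

lemma sets_config_measure [simp, measurable_cong]: "sets (config_measure np) = sets borel"
  by (cases np) (simp add: config_measure_def)

lemma nn_integral_config_measure: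
  "f \<in> borel_measurable borel \<Longrightarrow>
    (\<integral>\<^sup>+x. f x \<partial>config_measure (n, p)) = (\<Sum>i<n. ennreal (snd (p i)) * f (fst (p i)))"
  by (simp add: config_measure_def nn_integral_distr nn_integral_density nn_integral_count_space_finite)

lemma emeasure_config_measure:
  "B \<in> sets borel \<Longrightarrow> emeasure (config_measure (n, p)) B = (\<Sum>i<n. ennreal (snd (p i)) * indicator B (fst (p i)))"
  using nn_integral_config_measure[of "indicator B" n p] by simp

lemma integral_config_measure:
  fixes f :: "'a::euclidean_space \<Rightarrow> real"
  assumes "f \<in> borel_measurable borel" "\<And>i. snd (p i) \<ge> 0"
  shows "(LINT x|config_measure (n, p). f x) = (\<Sum>i<n. snd (p i) * f (fst (p i)))"
  using assms by (simp add: config_measure_def integral_distr integral_density lebesgue_integral_count_space_finite)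

lemma config_measure_discrete: "config_measure np \<in> discrete_radon"
proof -
  obtain n p where np: "np = (n, p)" by force
  let ?A = "(\<lambda>i. fst (p i)) ` {..<n}"
  have A: "countable ?A" by simp
  have "- ?A \<in> sets borel" using A by (intro borel_comp countable_sets_borel)
  then have "emeasure (config_measure np) (- ?A) = 0"
    unfolding np by (subst emeasure_config_measure) auto
  moreover have "emeasure (config_measure np) K < \<infinity>" if "compact K" for K
    unfolding np using compact_imp_closed[OF that]
    by (subst emeasure_config_measure) (auto simp: ennreal_mult_less_top less_top[symmetric] indicator_def)
  ultimately show ?thesis
    unfolding discrete_radon_iff radon_measures_def using A by (intro conjI exI[of _ ?A] CollectI) auto
qed

text \<open>The intensity is finite above every ball, and its projection to the space has no atoms. The radius \<open>R0\<close> singles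
  out the ball in which the points are made explicit; the mass above it must be positive for the points to be
  distributed according to the normalised intensity.\<close>

locale marked_law =
  fixes m :: "('a::euclidean_space \<times> real) measure" and \<mu> :: "'a measure measure" and R0 :: real
  assumes sets_m [measurable_cong]: "sets m = sets mark_space"
    and m_fin: "\<And>R. emeasure m (cball 0 R \<times> {0<..}) < \<infinity>"
    and m_diffuse: "\<And>x. emeasure m ({x} \<times> {0<..}) = 0"
    and m_pos: "emeasure m (cball 0 R0 \<times> {0<..}) \<noteq> 0"
    and law: "random_measure_law m \<mu>"
begin

lemma space_m: "space m = UNIV \<times> {0<..}"
  using sets_eq_imp_space_eq[OF sets_m] by simp

lemma sets_mu [measurable_cong, simp]: "sets \<mu> = sets discrete_borel"
  using law by (simp add: random_measure_law_def)

lemma space_mu: "space \<mu> = discrete_radon"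
  using sets_eq_imp_space_eq[OF sets_mu] by (simp add: space_discrete_borel)

sublocale prob_space \<mu>
  using law by (simp add: random_measure_law_def)

abbreviation "\<Lambda> \<equiv> cball 0 R0 :: 'a set"
abbreviation "A \<equiv> \<Lambda> \<times> {0<..} :: ('a \<times> real) set"

lemma strip_sets [measurable]: "B \<in> sets borel \<Longrightarrow> B \<times> {0<..} \<in> sets m"
  by (simp add: sets_m) (intro pair_measureI, auto simp: sets_restrict_space)

lemma mark_functions [measurable]:
  "fst \<in> m \<rightarrow>\<^sub>M borel" "snd \<in> borel_measurable m"
  using measurable_cong_sets[OF sets_m refl, of borel] borel_measurable_mark
  by (auto intro: measurable_fst'')

definition psi :: "('a \<Rightarrow> real) \<Rightarrow> 'a \<times> real \<Rightarrow> complex" where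
  "psi k p = iexp (snd p * k (fst p)) - 1"

lemma psi_measurable:
  assumes [measurable]: "k \<in> borel_measurable borel"
  shows "psi k \<in> borel_measurable m"
  unfolding psi_def[abs_def] by measurable

lemma norm_psi_le: "norm (psi k p) \<le> 2"
  unfolding psi_def by (rule order_trans[OF norm_triangle_ineq4]) simp

lemma bounded_strip_integrable: "integrable m (\<lambda>p. 2 * indicator (cball 0 R) (fst p) :: real)"
proof (rule integrableI_bounded_set[where A = "cball 0 R \<times> {0<..}" and B = 2])
  show "emeasure m (cball 0 R \<times> {0<..}) < \<infinity>" by (rule m_fin)
  have "(\<lambda>x. 2 * indicator (cball 0 R) x :: real) \<in> borel_measurable (borel :: 'a measure)"
    by (intro borel_measurable_times borel_measurable_const borel_measurable_indicator) simp
  from measurable_compose[OF mark_functions(1) this]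
  show "(\<lambda>p. 2 * indicator (cball 0 R) (fst p) :: real) \<in> borel_measurable m" .
  show "cball 0 R \<times> {0<..} \<in> sets m" by measurable
qed (auto simp: space_m indicator_def)

lemma psi_bound: "(\<And>x. x \<notin> cball 0 R \<Longrightarrow> k x = 0) \<Longrightarrow> norm (psi k p) \<le> 2 * indicator (cball 0 R) (fst p)"
  using norm_psi_le[of k p] by (cases "fst p \<in> cball 0 R") (auto simp: psi_def)

lemma psi_integrable:
  assumes k: "k \<in> borel_measurable borel" "\<And>x. x \<notin> cball 0 R \<Longrightarrow> k x = 0"
  shows "integrable m (psi k)"
  by (rule Bochner_Integration.integrable_bound[OF bounded_strip_integrable[of R] psi_measurable[OF k(1)]])
    (use psi_bound[of R k, OF k(2)] in auto)

lemma fourier_Cc: "f \<in> Cc \<Longrightarrow> (LINT \<eta>|\<mu>. iexp (LINT x|\<eta>. f x)) = exp (LINT p|m. psi f p)"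
  using law by (simp add: random_measure_law_def has_fourier_transform_def psi_def case_prod_beta)

text \<open>Dominated convergence on both sides: bounded test functions with a common bounded support are dominated
  by an integrable function with respect to each Radon measure, and the exponents are dominated because \<open>m\<close> is
  finite above bounded sets.\<close>

lemma fourier_glue:
  assumes L: "closed L" and h: "h \<in> Cc" and f: "f \<in> Cc"
  shows "(LINT \<eta>|\<mu>. iexp (LINT x|\<eta>. glue L h f x)) = exp (LINT p|m. psi (glue L h f) p)"
proof -
  obtain k R C where k: "\<And>n::nat. k n \<in> Cc" "\<And>x. (\<lambda>n. k n x) \<longlonglongrightarrow> glue L h f x"
    "\<And>n x. \<bar>k n x\<bar> \<le> C" "\<And>n x. x \<notin> cball 0 R \<Longrightarrow> k n x = 0"
    using glue_approx[OF assms] by metis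
  have g: "glue L h f \<in> borel_measurable borel"
    using L by (intro glue_measurable Cc_measurable h f) auto
  have lim: "(\<lambda>n. LINT x|\<eta>. k n x) \<longlonglongrightarrow> (LINT x|\<eta>. glue L h f x)" if "\<eta> \<in> space \<mu>" for \<eta>
    using that by (intro LINT_tendsto_dominated[OF _ k(1,2) g k(3,4)]) (simp add: space_mu discrete_radon_radon)
  have 1: "(\<lambda>n. LINT \<eta>|\<mu>. iexp (LINT x|\<eta>. k n x)) \<longlonglongrightarrow> (LINT \<eta>|\<mu>. iexp (LINT x|\<eta>. glue L h f x))"
  proof (rule integral_dominated_convergence[where w = "\<lambda>_. 1"])
    have [measurable]: "(\<lambda>\<eta>. LINT x|\<eta>. glue L h f x) \<in> borel_measurable \<mu>"
      using glue_evaluation_measurable[OF assms] measurable_cong_sets[OF sets_mu refl] by blast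
    show "(\<lambda>\<eta>. iexp (LINT x|\<eta>. glue L h f x)) \<in> borel_measurable \<mu>"
      by (rule borel_measurable_iexp) fact
    show "(\<lambda>\<eta>. iexp (LINT x|\<eta>. k n x)) \<in> borel_measurable \<mu>" for n
      using evaluation_measurable[OF k(1)[of n]] measurable_cong_sets[OF sets_mu refl]
      by (intro borel_measurable_iexp) blast
    show "AE \<eta> in \<mu>. (\<lambda>n. iexp (LINT x|\<eta>. k n x)) \<longlonglongrightarrow> iexp (LINT x|\<eta>. glue L h f x)"
      by (intro AE_I2 tendsto_intros lim)
  qed auto
  have 2: "(\<lambda>n. LINT p|m. psi (k n) p) \<longlonglongrightarrow> (LINT p|m. psi (glue L h f) p)"
  proof (rule integral_dominated_convergence[where w = "\<lambda>p. 2 * indicator (cball 0 R) (fst p)"])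
    show "AE p in m. (\<lambda>n. psi (k n) p) \<longlonglongrightarrow> psi (glue L h f) p"
      unfolding psi_def by (intro AE_I2 tendsto_intros k(2))
    show "AE p in m. norm (psi (k n) p) \<le> 2 * indicator (cball 0 R) (fst p)" for n
      using psi_bound[of R "k n", OF k(4)] by auto
    show "integrable m (\<lambda>p. 2 * indicator (cball 0 R) (fst p) :: real)"
      by (rule bounded_strip_integrable)
  qed (intro psi_measurable g Cc_measurable k(1))+
  have "(\<lambda>n. LINT \<eta>|\<mu>. iexp (LINT x|\<eta>. k n x)) \<longlonglongrightarrow> exp (LINT p|m. psi (glue L h f) p)"
    unfolding fourier_Cc[OF k(1)] by (intro tendsto_exp 2)
  with 1 show ?thesis by (rule LIMSEQ_unique)
qed

lemma psi_zero [simp]: "psi (\<lambda>x. 0) p = 0"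
  by (simp add: psi_def)

lemma Cc_psi_integrable:
  assumes f: "f \<in> Cc" shows "integrable m (psi f)"
proof -
  from f obtain R where "\<And>x. x \<notin> cball 0 R \<Longrightarrow> f x = 0" by (rule CcE) blast
  then show ?thesis by (rule psi_integrable[OF Cc_measurable[OF f]])
qed

abbreviation "outer_strip \<equiv> (- \<Lambda>) \<times> {0<..} :: ('a \<times> real) set"

lemma exp_psi_glue:
  assumes h: "h \<in> Cc" and f: "f \<in> Cc"
  shows "exp (LINT p|m. psi (glue \<Lambda> h f) p) = exp (LINT p:A|m. psi h p) * exp (LINT p:outer_strip|m. psi f p)"
proof -
  have i: "set_integrable m A (psi h)" "set_integrable m outer_strip (psi f)"
    unfolding set_integrable_def
    by (intro integrable_mult_indicator Cc_psi_integrable h f strip_sets; measurable)+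
  have "(LINT p|m. psi (glue \<Lambda> h f) p) = (LINT p|m. indicator A p *\<^sub>R psi h p + indicator outer_strip p *\<^sub>R psi f p)"
    by (rule Bochner_Integration.integral_cong) (auto simp: psi_def glue_def space_m indicator_def)
  also have "\<dots> = (LINT p:A|m. psi h p) + (LINT p:outer_strip|m. psi f p)"
    using i unfolding set_integrable_def set_lebesgue_integral_def by simp
  finally show ?thesis by (simp add: exp_add)
qed

sublocale strip: finite_positive_set m A
  by unfold_locales (use m_fin[of R0] m_pos strip_sets[of \<Lambda>] in auto)

lemma space_sample_pos: "(n, p) \<in> space (poisson_sample m A) \<Longrightarrow> snd (p i) > 0"
  by (auto simp: poisson_sample_def space_pair_measure space_PiM PiE_iff space_m)
    (metis UNIV_I greaterThan_iff mem_Sigma_iff prod.collapse)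

lemma config_measure_measurable [measurable]: "config_measure \<in> poisson_sample m A \<rightarrow>\<^sub>M discrete_borel"
proof (rule measurable_discrete_borelI)
  fix f :: "'a \<Rightarrow> real" assume f: "f \<in> Cc"
  note [measurable] = Cc_measurable[OF f]
  have [measurable]: "snd \<in> borel_measurable strip.Q" "fst \<in> strip.Q \<rightarrow>\<^sub>M borel"
    using mark_functions by auto
  have "(\<lambda>(n, p). \<Sum>i<n. snd (p i) * f (fst (p i))) \<in> borel_measurable (poisson_sample m A)"
    unfolding poisson_sample_def by measurable
  then show "(\<lambda>np. LINT x|config_measure np. f x) \<in> borel_measurable (poisson_sample m A)"
    by (rule measurable_cong[THEN iffD1, rotated])
      (auto simp: integral_config_measure space_sample_pos[THEN less_imp_le])
qed (rule config_measure_discrete)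

definition sample_law :: "'a measure measure" where
  "sample_law = distr (poisson_sample m A) discrete_borel config_measure"

lemma sets_sample_law [simp, measurable_cong]: "sets sample_law = sets discrete_borel"
  by (simp add: sample_law_def)

lemma prob_space_sample_law: "prob_space sample_law"
  unfolding sample_law_def
  by (rule prob_space.prob_space_distr[OF strip.sample_prob config_measure_measurable])

lemma borel_measurable_discrete_evaluation:
  assumes "sets N = sets discrete_borel" "f \<in> Cc"
  shows "(\<lambda>\<eta>. LINT x|\<eta>. f x) \<in> borel_measurable N"
  using evaluation_measurable[OF assms(2)] measurable_cong_sets[OF assms(1) refl] by blast

text \<open>The exponential of the sum over the points is a product over the points.\<close>

lemma fourier_sample_law:
  assumes h: "h \<in> Cc"
  shows "(LINT \<eta>|sample_law. iexp (LINT x|\<eta>. h x)) = exp (LINT p:A|m. psi h p)"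
proof -
  note [measurable] = Cc_measurable[OF h]
  have "(\<lambda>\<eta>. iexp (LINT x|\<eta>. h x)) \<in> borel_measurable discrete_borel"
    by (intro borel_measurable_iexp evaluation_measurable h)
  then have "(LINT \<eta>|sample_law. iexp (LINT x|\<eta>. h x)) = (LINT np|poisson_sample m A. iexp (LINT x|config_measure np. h x))"
    unfolding sample_law_def by (rule integral_distr[OF config_measure_measurable])
  also have "\<dots> = (LINT (n, p)|poisson_sample m A. (\<Prod>i<n. iexp (snd (p i) * h (fst (p i)))))"
    by (rule Bochner_Integration.integral_cong[OF refl])
      (auto simp: integral_config_measure space_sample_pos[THEN less_imp_le] exp_sum[symmetric] sum_distrib_left)
  also have "\<dots> = exp (LINT p:A|m. iexp (snd p * h (fst p)) - 1)"
  proof (rule strip.integral_sample_prod)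
    show meas: "(\<lambda>p. iexp (snd p * h (fst p))) \<in> borel_measurable m" by measurable
    show "set_integrable m A (\<lambda>p. iexp (snd p * h (fst p)))"
      unfolding set_integrable_def
    proof (rule integrableI_bounded_set[where A = A and B = 1])
      show "(\<lambda>x. indicat_real A x *\<^sub>R iexp (snd x * h (fst x))) \<in> borel_measurable m"
        using meas by measurable
    qed (use m_fin[of R0] in \<open>auto simp: indicator_def\<close>)
  qed
  finally show ?thesis by (simp add: psi_def)
qed

lemma restrict_measure_measurable_mu [measurable]: "restrict_measure \<Lambda> \<in> \<mu> \<rightarrow>\<^sub>M discrete_borel"
  using restrict_measure_measurable[OF closed_cball] measurable_cong_sets[OF sets_mu refl] by blast

text \<open>The exponents add up to a single glued test function, and the integral over \<open>m\<close> splits into the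
  parts above the ball and above its complement.\<close>

lemma fourier_restrict_glue:
  assumes h: "h \<in> Cc" and f: "f \<in> Cc"
  shows "(LINT \<eta>|\<mu>. iexp (LINT x|restrict_measure \<Lambda> \<eta>. h x) * iexp (e * (LINT x|\<eta>. glue \<Lambda> (\<lambda>x. 0) f x)))
    = exp (LINT p:A|m. psi h p) * exp (LINT p:outer_strip|m. psi (\<lambda>x. e * f x) p)"
proof -
  have ef: "(\<lambda>x. e * f x) \<in> Cc" by (rule Cc_scale[OF f])
  have "iexp (LINT x|restrict_measure \<Lambda> \<eta>. h x) * iexp (e * (LINT x|\<eta>. glue \<Lambda> (\<lambda>x. 0) f x))
      = iexp (LINT x|\<eta>. glue \<Lambda> h (\<lambda>x. e * f x) x)" if "\<eta> \<in> space \<mu>" for \<eta>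
  proof -
    have r: "\<eta> \<in> radon_measures" using that by (simp add: space_mu discrete_radon_radon)
    have "(LINT x|\<eta>. glue \<Lambda> h (\<lambda>x. e * f x) x) = (LINT x|\<eta>. glue \<Lambda> h (\<lambda>x. 0) x + e * glue \<Lambda> (\<lambda>x. 0) f x)"
      by (rule Bochner_Integration.integral_cong) (auto simp: glue_def)
    also have "\<dots> = (LINT x|\<eta>. glue \<Lambda> h (\<lambda>x. 0) x) + e * (LINT x|\<eta>. glue \<Lambda> (\<lambda>x. 0) f x)"
      using glue_integrable[OF r closed_cball h Cc_zero] glue_integrable[OF r closed_cball Cc_zero f] by simp
    also have "(LINT x|\<eta>. glue \<Lambda> h (\<lambda>x. 0) x) = (LINT x|restrict_measure \<Lambda> \<eta>. h x)"
      by (rule restrict_measure_integral[OF r _ Cc_measurable[OF h], symmetric]) simp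
    finally show ?thesis by (simp add: exp_add distrib_left)
  qed
  then have "(LINT \<eta>|\<mu>. iexp (LINT x|restrict_measure \<Lambda> \<eta>. h x) * iexp (e * (LINT x|\<eta>. glue \<Lambda> (\<lambda>x. 0) f x)))
    = (LINT \<eta>|\<mu>. iexp (LINT x|\<eta>. glue \<Lambda> h (\<lambda>x. e * f x) x))"
    by (intro Bochner_Integration.integral_cong refl)
  also have "\<dots> = exp (LINT p:A|m. psi h p) * exp (LINT p:outer_strip|m. psi (\<lambda>x. e * f x) p)"
    by (simp only: fourier_glue[OF closed_cball h ef] exp_psi_glue[OF h ef])
  finally show ?thesis .
qed

theorem distr_restrict_measure: "distr \<mu> discrete_borel (restrict_measure \<Lambda>) = sample_law"
proof (rule fourier_determines_law)
  show "finite_measure (distr \<mu> discrete_borel (restrict_measure \<Lambda>))"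
    by (rule finite_measure_distr) measurable
  show "finite_measure sample_law"
    by (rule prob_space.finite_measure[OF prob_space_sample_law])
  fix h :: "'a \<Rightarrow> real" assume h: "h \<in> Cc"
  have "(LINT \<eta>|distr \<mu> discrete_borel (restrict_measure \<Lambda>). iexp (LINT x|\<eta>. h x))
      = (LINT \<eta>|\<mu>. iexp (LINT x|restrict_measure \<Lambda> \<eta>. h x))"
    by (intro integral_distr restrict_measure_measurable_mu borel_measurable_iexp evaluation_measurable h)
  also have "\<dots> = exp (LINT p:A|m. psi h p)"
    using fourier_restrict_glue[OF h Cc_zero, of 0] by simp
  finally show "(LINT \<eta>|distr \<mu> discrete_borel (restrict_measure \<Lambda>). iexp (LINT x|\<eta>. h x)) =
      (LINT \<eta>|sample_law. iexp (LINT x|\<eta>. h x))"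
    by (simp only: fourier_sample_law[OF h])
qed auto

text \<open>The restriction of \<open>\<eta>\<close> to the ball and the integral of \<open>f\<close> over the outside are compared with the two
  components of the product \<open>sample_law \<Otimes>\<^sub>M \<mu>\<close>. Their joint Fourier transforms agree because both are
  products of an inner and an outer factor.\<close>

theorem restriction_independent:
  fixes G :: "'a measure \<Rightarrow> complex"
  assumes G: "G \<in> borel_measurable discrete_borel" "integrable sample_law G" and f: "f \<in> Cc"
  shows "(LINT \<eta>|\<mu>. G (restrict_measure \<Lambda> \<eta>) * iexp (LINT x|\<eta>. glue \<Lambda> (\<lambda>x. 0) f x))
    = (LINT \<eta>|sample_law. G \<eta>) * exp (LINT p:outer_strip|m. psi f p)"
proof -
  interpret S: prob_space sample_law by (rule prob_space_sample_law)
  interpret SM: pair_prob_space sample_law \<mu> ..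
  define Y where "Y \<eta> = (LINT x|\<eta>. glue \<Lambda> (\<lambda>x. 0) f x)" for \<eta>
  have Y [measurable]: "Y \<in> borel_measurable \<mu>"
    using glue_evaluation_measurable[OF closed_cball Cc_zero f] measurable_cong_sets[OF sets_mu refl]
    unfolding Y_def[abs_def] by blast
  have Y_int: "(LINT \<eta>|\<mu>. iexp (e * Y \<eta>)) = exp (LINT p:outer_strip|m. psi (\<lambda>x. e * f x) p)" for e
    using fourier_restrict_glue[OF Cc_zero f, of e] by (simp add: Y_def)
  have bounded: "integrable \<mu> (\<lambda>\<eta>. iexp (e * Y \<eta>))" for e
    by (rule integrable_const_bound[where B = 1]) auto
  have pair: "integrable (sample_law \<Otimes>\<^sub>M \<mu>) (\<lambda>x. a (fst x) * iexp (e * Y (snd x)))"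
    "(LINT x|(sample_law \<Otimes>\<^sub>M \<mu>). a (fst x) * iexp (e * Y (snd x))) = (LINT \<eta>|sample_law. a \<eta>) * (LINT \<eta>|\<mu>. iexp (e * Y \<eta>))"
    if a: "integrable sample_law a" for a :: "'a measure \<Rightarrow> complex" and e
  proof -
    have [measurable]: "a \<in> borel_measurable sample_law" using a by simp
    show i: "integrable (sample_law \<Otimes>\<^sub>M \<mu>) (\<lambda>x. a (fst x) * iexp (e * Y (snd x)))"
      by (rule SM.Fubini_integrable) (use a bounded in \<open>auto simp: norm_mult prob_space\<close>)
    show "(LINT x|(sample_law \<Otimes>\<^sub>M \<mu>). a (fst x) * iexp (e * Y (snd x))) = (LINT \<eta>|sample_law. a \<eta>) * (LINT \<eta>|\<mu>. iexp (e * Y \<eta>))"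
      using SM.integral_fst'[OF i] by simp
  qed
  have "(LINT \<eta>|\<mu>. G (restrict_measure \<Lambda> \<eta>) * iexp (Y \<eta>)) = (LINT x|(sample_law \<Otimes>\<^sub>M \<mu>). G (fst x) * iexp (Y (snd x)))"
  proof (rule complex_weight_transfer[where T = discrete_borel and K = Cc and \<kappa> = "\<lambda>h \<eta>. iexp (LINT x|\<eta>. h x)"])
    show "finite_measure \<mu>" "finite_measure (sample_law \<Otimes>\<^sub>M \<mu>)"
      by (rule finite_measure_axioms, rule SM.P.finite_measure_axioms)
    show "(\<lambda>\<eta>. iexp (LINT x|\<eta>. h x)) \<in> borel_measurable discrete_borel" if "h \<in> Cc" for h :: "'a \<Rightarrow> real"
      using that by (intro borel_measurable_iexp evaluation_measurable)
    show "M = M'" if "finite_measure M" "finite_measure M'" "sets M = sets discrete_borel" "sets M' = sets discrete_borel"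
      "\<And>h. h \<in> Cc \<Longrightarrow> (LINT \<eta>|M. iexp (LINT x|\<eta>. h x)) = (LINT \<eta>|M'. iexp (LINT x|\<eta>. h x))"
      for M M' :: "'a measure measure"
      using that by (rule fourier_determines_law)
    show "(LINT \<eta>|\<mu>. iexp (LINT x|restrict_measure \<Lambda> \<eta>. h x) * iexp (e * Y \<eta>)) =
      (LINT x|(sample_law \<Otimes>\<^sub>M \<mu>). iexp (integral\<^sup>L (fst x) h) * iexp (e * Y (snd x)))" if h: "h \<in> Cc" for h e
    proof -
      have "integrable sample_law (\<lambda>\<eta>. iexp (LINT x|\<eta>. h x))"
        by (rule S.integrable_const_bound[where B = 1])
          (auto intro!: borel_measurable_iexp borel_measurable_discrete_evaluation h)
      from pair(2)[OF this, of e] show ?thesis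
        using fourier_restrict_glue[OF h f, of e] unfolding Y_def[symmetric]
        by (simp only: Y_int fourier_sample_law[OF h])
    qed
    show "integrable \<mu> (\<lambda>\<eta>. G (restrict_measure \<Lambda> \<eta>))"
      using G(2) unfolding distr_restrict_measure[symmetric]
      by (subst (asm) integrable_distr_eq) (auto intro: G)
    have "integrable (sample_law \<Otimes>\<^sub>M \<mu>) (\<lambda>x. G (fst x) * iexp (0 * Y (snd x)))"
      by (rule pair(1)[OF G(2)])
    then show "integrable (sample_law \<Otimes>\<^sub>M \<mu>) (\<lambda>x. G (fst x))" by simp
  qed (use G Y in \<open>auto simp: measurable_cong_sets[OF sets_sample_law refl]\<close>)
  also have "\<dots> = (LINT \<eta>|sample_law. G \<eta>) * exp (LINT p:outer_strip|m. psi f p)"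
    using pair(2)[OF G(2), of 1] Y_int[of 1] by simp
  finally show ?thesis by (simp add: Y_def)
qed

end

section \<open>Measurability of functionals of the atoms\<close>

lemma measure_compact_measurable:
  fixes C :: "'a::euclidean_space set"
  assumes C: "compact C"
  shows "(\<lambda>\<eta>. measure \<eta> C) \<in> borel_measurable discrete_borel"
proof -
  obtain r where r: "C \<subseteq> cball 0 r"
    using bounded_subset_ballD[OF compact_imp_bounded[OF C], of 0] ball_subset_cball by (metis order_trans)
  define h where "h x = max 0 (min 1 (r + 1 - norm x))" for x :: 'a
  have h: "h \<in> Cc"
    by (rule CcI[of _ "cball 0 (r + 1)"]) (auto simp: h_def[abs_def] intro!: continuous_intros)
  have Cb: "C \<in> sets borel" "closed C" using compact_imp_closed[OF C] borel_closed by auto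
  have "measure \<eta> C = (LINT x|\<eta>. glue C h (\<lambda>x. 0) x)" if "\<eta> \<in> discrete_radon" for \<eta>
  proof -
    have s: "sets \<eta> = sets borel" by (rule radon_sets[OF discrete_radon_radon[OF that]])
    have "(LINT x|\<eta>. glue C h (\<lambda>x. 0) x) = (LINT x|\<eta>. indicator C x)"
      using r by (intro Bochner_Integration.integral_cong) (force simp: glue_def h_def)+
    also have "\<dots> = measure \<eta> C"
      using sets.sets_into_space[of C \<eta>] Cb s by (simp add: Int_absorb2)
    finally show ?thesis ..
  qed
  then show ?thesis
    using glue_evaluation_measurable[OF Cb(2) h Cc_zero]
    by (subst measurable_cong[where g = "\<lambda>\<eta>. LINT x|\<eta>. glue C h (\<lambda>x. 0) x"]) (auto simp: space_discrete_borel)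
qed

text \<open>The restriction of \<open>\<eta>\<close> to a ball, scaled to a total mass of at most \<open>1\<close>. As a function of \<open>\<eta>\<close> it is a
  subprobability kernel, and integrals against such kernels depend measurably on \<open>\<eta>\<close>.\<close>

definition sub_kernel :: "real \<Rightarrow> 'a::euclidean_space measure \<Rightarrow> 'a measure" where
  "sub_kernel R \<eta> = density \<eta> (\<lambda>x. ennreal (indicator (cball 0 R) x / (1 + measure \<eta> (cball 0 R))))"

lemma sets_sub_kernel: "\<eta> \<in> radon_measures \<Longrightarrow> sets (sub_kernel R \<eta>) = sets borel"
  by (simp add: sub_kernel_def radon_sets)

lemma nn_integral_sub_kernel:
  assumes \<eta>: "\<eta> \<in> radon_measures" and f: "f \<in> borel_measurable borel"
  shows "(\<integral>\<^sup>+x. f x \<partial>sub_kernel R \<eta>) = ennreal (1 / (1 + measure \<eta> (cball 0 R))) * (\<integral>\<^sup>+x\<in>cball 0 R. f x \<partial>\<eta>)"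
proof -
  note [measurable_cong] = radon_sets[OF \<eta>]
  have [measurable]: "f \<in> borel_measurable \<eta>" using f by measurable
  have cb [measurable]: "cball 0 R \<in> sets \<eta>"
    unfolding radon_sets[OF \<eta>] by (rule borel_closed[OF closed_cball])
  have "(\<integral>\<^sup>+x. f x \<partial>sub_kernel R \<eta>) = (\<integral>\<^sup>+x. ennreal (indicator (cball 0 R) x / (1 + measure \<eta> (cball 0 R))) * f x \<partial>\<eta>)"
    unfolding sub_kernel_def
  proof (rule nn_integral_density)
    show "(\<lambda>x. ennreal (indicator (cball 0 R) x / (1 + measure \<eta> (cball 0 R)))) \<in> borel_measurable \<eta>"
      by (intro measurable_compose[OF _ measurable_ennreal] borel_measurable_divide
          borel_measurable_indicator borel_measurable_const cb)
  qed simp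
  also have "\<dots> = (\<integral>\<^sup>+x. ennreal (1 / (1 + measure \<eta> (cball 0 R))) * (f x * indicator (cball 0 R) x) \<partial>\<eta>)"
    by (rule nn_integral_cong) (auto simp: indicator_def)
  also have "\<dots> = ennreal (1 / (1 + measure \<eta> (cball 0 R))) * (\<integral>\<^sup>+x\<in>cball 0 R. f x \<partial>\<eta>)"
    by (rule nn_integral_cmult) measurable
  finally show ?thesis .
qed

lemma emeasure_sub_kernel:
  assumes \<eta>: "\<eta> \<in> radon_measures" and B: "B \<in> sets borel"
  shows "emeasure (sub_kernel R \<eta>) B = ennreal (measure \<eta> (cball 0 R \<inter> B) / (1 + measure \<eta> (cball 0 R)))"
proof -
  have s: "sets \<eta> = sets borel" by (rule radon_sets[OF \<eta>])
  have fin: "emeasure \<eta> (cball 0 R \<inter> B) = ennreal (measure \<eta> (cball 0 R \<inter> B))"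
    using emeasure_mono[of "cball 0 R \<inter> B" "cball 0 R" \<eta>] radon_finite[OF \<eta>, of "cball 0 R"] s
    by (intro emeasure_eq_ennreal_measure) (auto simp: top_unique)
  have "emeasure (sub_kernel R \<eta>) B = (\<integral>\<^sup>+x. indicator B x \<partial>sub_kernel R \<eta>)"
    using B sets_sub_kernel[OF \<eta>, of R] by simp
  also have "\<dots> = ennreal (1 / (1 + measure \<eta> (cball 0 R))) * (\<integral>\<^sup>+x\<in>cball 0 R. indicator B x \<partial>\<eta>)"
    using B by (intro nn_integral_sub_kernel[OF \<eta>]) simp
  also have "(\<integral>\<^sup>+x\<in>cball 0 R. indicator B x \<partial>\<eta>) = (\<integral>\<^sup>+x. indicator (cball 0 R \<inter> B) x \<partial>\<eta>)"
    by (rule nn_integral_cong) (auto simp: indicator_def)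
  also have "\<dots> = ennreal (measure \<eta> (cball 0 R \<inter> B))"
    using B s by (simp add: fin)
  also have "ennreal (1 / (1 + measure \<eta> (cball 0 R))) * \<dots> = ennreal (measure \<eta> (cball 0 R \<inter> B) / (1 + measure \<eta> (cball 0 R)))"
    by (subst ennreal_mult[symmetric]) auto
  finally show ?thesis .
qed

lemma sub_kernel_measurable [measurable]: "sub_kernel R \<in> discrete_borel \<rightarrow>\<^sub>M subprob_algebra borel"
proof (rule measurable_subprob_algebra_generated[where G = "Collect closed" and \<Omega> = UNIV])
  show "sets borel = sigma_sets UNIV (Collect closed)"
    unfolding borel_eq_closed by (rule sets_measure_of) simp
  show "Int_stable (Collect (closed :: 'a set \<Rightarrow> bool))" by (auto simp: Int_stable_def)
  fix \<eta> :: "'a measure" assume "\<eta> \<in> space discrete_borel"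
  then have \<eta>: "\<eta> \<in> radon_measures" by (simp add: space_discrete_borel discrete_radon_radon)
  show "sets (sub_kernel R \<eta>) = sets borel" by (rule sets_sub_kernel[OF \<eta>])
  have sp: "space (sub_kernel R \<eta>) = UNIV" using sets_eq_imp_space_eq[OF sets_sub_kernel[OF \<eta>, of R]] by simp
  show "subprob_space (sub_kernel R \<eta>)"
    by (rule subprob_spaceI)
      (simp_all add: sp emeasure_sub_kernel[OF \<eta>] ennreal_le_1 divide_le_eq_1 add_pos_nonneg)
next
  have *: "(\<lambda>\<eta>. emeasure (sub_kernel R \<eta>) C) \<in> borel_measurable discrete_borel" if "closed C" for C :: "'a set"
  proof -
    have [measurable]: "(\<lambda>\<eta>. measure \<eta> (cball 0 R \<inter> C)) \<in> borel_measurable discrete_borel"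
      "(\<lambda>\<eta>. measure \<eta> (cball (0::'a) R)) \<in> borel_measurable discrete_borel"
      using that by (auto intro!: measure_compact_measurable compact_Int_closed)
    have "(\<lambda>\<eta>. ennreal (measure \<eta> (cball 0 R \<inter> C) / (1 + measure \<eta> (cball 0 R)))) \<in> borel_measurable discrete_borel"
      by measurable
    then show ?thesis
      using that by (subst measurable_cong[where g = "\<lambda>\<eta>. ennreal (measure \<eta> (cball 0 R \<inter> C) / (1 + measure \<eta> (cball 0 R)))"])
        (auto simp: space_discrete_borel emeasure_sub_kernel discrete_radon_radon)
  qed
  show "(\<lambda>\<eta>. emeasure (sub_kernel R \<eta>) C) \<in> borel_measurable discrete_borel" if "C \<in> Collect closed" for C :: "'a set"
    using * that by simp
  show "(\<lambda>\<eta>. emeasure (sub_kernel R \<eta>) (UNIV :: 'a set)) \<in> borel_measurable discrete_borel"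
    by (rule *) simp
qed auto

text \<open>The set \<open>{x}\<close> is the section of the diagonal, which is measurable.\<close>

lemma singleton_sub_kernel_measurable:
  "(\<lambda>(\<eta>, x). measure (sub_kernel R \<eta>) {x}) \<in> borel_measurable (discrete_borel \<Otimes>\<^sub>M (borel :: 'a::euclidean_space measure))"
proof -
  let ?M = "discrete_borel \<Otimes>\<^sub>M (borel :: 'a measure)"
  have "{p \<in> space (?M \<Otimes>\<^sub>M (borel :: 'a measure)). snd p = snd (fst p)} \<in> sets (?M \<Otimes>\<^sub>M (borel :: 'a measure))"
    by measurable
  also have "{p \<in> space (?M \<Otimes>\<^sub>M (borel :: 'a measure)). snd p = snd (fst p)} = (SIGMA q:space ?M. {snd q})"
    by (auto simp: space_pair_measure)
  finally have "(\<lambda>q. measure (sub_kernel R (fst q)) {snd q}) \<in> borel_measurable ?M"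
    by (rule measure_measurable_subprob_algebra2) measurable
  then show ?thesis unfolding case_prod_beta .
qed

text \<open>For a discrete measure this is the sum of \<open>k x s * s\<close> over the atoms \<open>x\<close> in the ball and their weights
  \<open>s\<close>. As an integral over \<open>\<eta>\<close> it also makes sense for infinitely many atoms and is amenable to kernels. Points
  that are not atoms contribute \<open>0\<close>, so only the values of \<open>k\<close> at positive weights matter.\<close>

definition atom_sum :: "real \<Rightarrow> ('a \<Rightarrow> real \<Rightarrow> ennreal) \<Rightarrow> 'a::euclidean_space measure \<Rightarrow> ennreal" where
  "atom_sum R k \<eta> = (\<integral>\<^sup>+x\<in>cball 0 R. (if measure \<eta> {x} > 0 then k x (measure \<eta> {x}) else 0) \<partial>\<eta>)"

lemma mark_extension_measurable:
  fixes k :: "'a::euclidean_space \<Rightarrow> real \<Rightarrow> ennreal"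
  assumes k: "(\<lambda>(x, s). k x s) \<in> borel_measurable mark_space"
  shows "(\<lambda>(x, s). if s > 0 then k x s else 0) \<in> borel_measurable (borel \<Otimes>\<^sub>M borel)"
proof -
  have 1: "(\<lambda>p. if snd p > 0 then snd p else 1) \<in> (borel :: 'a measure) \<Otimes>\<^sub>M borel \<rightarrow>\<^sub>M lborel_pos"
    by (rule measurable_restrict_space2) auto
  have "(\<lambda>p. (fst p, if snd p > 0 then snd p else 1)) \<in> (borel :: 'a measure) \<Otimes>\<^sub>M borel \<rightarrow>\<^sub>M mark_space"
    by (rule measurable_Pair[OF _ 1]) measurable
  from measurable_compose[OF this k]
  have [measurable]: "(\<lambda>p. k (fst p) (if snd p > 0 then snd p else 1)) \<in> borel_measurable ((borel :: 'a measure) \<Otimes>\<^sub>M borel)"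
    by simp
  have "(\<lambda>p. if snd p > 0 then k (fst p) (if snd p > 0 then snd p else 1) else 0) \<in> borel_measurable ((borel :: 'a measure) \<Otimes>\<^sub>M borel)"
    by measurable
  also have "(\<lambda>p. if snd p > 0 then k (fst p) (if snd p > 0 then snd p else 1) else 0) = (\<lambda>(x, s). if s > 0 then k x s else 0)"
    by (auto simp: fun_eq_iff)
  finally show ?thesis .
qed

text \<open>Inside the ball the weight of an atom is its weight under the scaled kernel times the scaling factor \<open>c\<close>. So
  the integrand is jointly measurable in \<open>(\<eta>, x)\<close>.\<close>

theorem atom_sum_measurable:
  fixes k :: "'a::euclidean_space \<Rightarrow> real \<Rightarrow> ennreal"
  assumes k: "(\<lambda>(x, s). k x s) \<in> borel_measurable mark_space"
  shows "atom_sum R k \<in> borel_measurable discrete_borel"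
proof -
  define c where "c \<eta> = 1 + measure \<eta> (cball 0 R)" for \<eta> :: "'a measure"
  have c1: "c \<eta> \<ge> 1" for \<eta> by (simp add: c_def)
  have [measurable]: "c \<in> borel_measurable discrete_borel"
    unfolding c_def[abs_def] using measure_compact_measurable[of "cball (0::'a) R"] by measurable
  define k' where "k' x s = (if s > 0 then k x s else 0)" for x s
  have k' [measurable]: "(\<lambda>p. k' (fst p) (snd p)) \<in> borel_measurable (borel \<Otimes>\<^sub>M borel)"
    using mark_extension_measurable[OF k] unfolding k'_def case_prod_beta .
  have [measurable]: "(\<lambda>p. measure (sub_kernel R (fst p)) {snd p}) \<in> borel_measurable (discrete_borel \<Otimes>\<^sub>M (borel :: 'a measure))"
    using singleton_sub_kernel_measurable[of R] unfolding case_prod_beta .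
  have "(\<lambda>p. (snd p, c (fst p) * measure (sub_kernel R (fst p)) {snd p})) \<in> discrete_borel \<Otimes>\<^sub>M (borel :: 'a measure) \<rightarrow>\<^sub>M borel \<Otimes>\<^sub>M borel"
    by measurable
  from measurable_compose[OF this k']
  have "(\<lambda>(\<eta>, x). k' x (c \<eta> * measure (sub_kernel R \<eta>) {x})) \<in> borel_measurable (discrete_borel \<Otimes>\<^sub>M (borel :: 'a measure))"
    unfolding case_prod_beta fst_conv snd_conv .
  from nn_integral_measurable_subprob_algebra2[OF this sub_kernel_measurable]
  have "(\<lambda>\<eta>. \<integral>\<^sup>+x. k' x (c \<eta> * measure (sub_kernel R \<eta>) {x}) \<partial>sub_kernel R \<eta>) \<in> borel_measurable discrete_borel" .
  then have "(\<lambda>\<eta>. ennreal (c \<eta>) * (\<integral>\<^sup>+x. k' x (c \<eta> * measure (sub_kernel R \<eta>) {x}) \<partial>sub_kernel R \<eta>)) \<in> borel_measurable discrete_borel"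
    by measurable
  moreover have "atom_sum R k \<eta> = ennreal (c \<eta>) * (\<integral>\<^sup>+x. k' x (c \<eta> * measure (sub_kernel R \<eta>) {x}) \<partial>sub_kernel R \<eta>)"
    if "\<eta> \<in> space discrete_borel" for \<eta>
  proof -
    have \<eta>: "\<eta> \<in> radon_measures" using that by (simp add: space_discrete_borel discrete_radon_radon)
    have w: "c \<eta> * measure (sub_kernel R \<eta>) {x} = measure \<eta> {x}" if "x \<in> cball 0 R" for x
    proof -
      have "cball 0 R \<inter> {x} = {x}" using that by auto
      then have "measure (sub_kernel R \<eta>) {x} = measure \<eta> {x} / c \<eta>"
        using emeasure_sub_kernel[OF \<eta>, of "{x}" R] c1[of \<eta>] by (simp add: measure_def c_def)
      then show ?thesis using c1[of \<eta>] by simp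
    qed
    have kx: "(\<lambda>x. k' x (c \<eta> * measure (sub_kernel R \<eta>) {x})) \<in> borel_measurable borel"
    proof -
      have "(\<lambda>x. (\<eta>, x)) \<in> borel \<rightarrow>\<^sub>M discrete_borel \<Otimes>\<^sub>M (borel :: 'a measure)" using that by measurable
      from measurable_compose[OF this \<open>(\<lambda>(\<eta>, x). k' x (c \<eta> * measure (sub_kernel R \<eta>) {x})) \<in> borel_measurable (discrete_borel \<Otimes>\<^sub>M (borel :: 'a measure))\<close>]
      show ?thesis by simp
    qed
    have "ennreal (c \<eta>) * (\<integral>\<^sup>+x. k' x (c \<eta> * measure (sub_kernel R \<eta>) {x}) \<partial>sub_kernel R \<eta>)
       = ennreal (c \<eta>) * (ennreal (1 / c \<eta>) * (\<integral>\<^sup>+x\<in>cball 0 R. k' x (c \<eta> * measure (sub_kernel R \<eta>) {x}) \<partial>\<eta>))"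
      by (subst nn_integral_sub_kernel[OF \<eta> kx]) (simp add: c_def)
    also have "\<dots> = (\<integral>\<^sup>+x\<in>cball 0 R. k' x (c \<eta> * measure (sub_kernel R \<eta>) {x}) \<partial>\<eta>)"
      using c1[of \<eta>] by (simp add: mult.assoc[symmetric] ennreal_mult[symmetric])
    also have "\<dots> = atom_sum R k \<eta>"
      unfolding atom_sum_def by (rule nn_integral_cong) (auto simp: indicator_def k'_def w)
    finally show ?thesis ..
  qed
  ultimately show ?thesis by (subst measurable_cong) auto
qed

lemma atoms_iff:
  assumes \<eta>: "\<eta> \<in> radon_measures" shows "x \<in> atoms \<eta> \<longleftrightarrow> measure \<eta> {x} > 0"
    and radon_singleton: "emeasure \<eta> {x} = ennreal (measure \<eta> {x})"
proof -
  show *: "emeasure \<eta> {x} = ennreal (measure \<eta> {x})"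
    using radon_finite[OF \<eta>, of "{x}"] by (simp add: emeasure_eq_ennreal_measure)
  show "x \<in> atoms \<eta> \<longleftrightarrow> measure \<eta> {x} > 0" by (simp add: atoms_def *)
qed

lemma sum_mult_indicator_singleton:
  fixes f :: "'a \<Rightarrow> 'b::semiring_1"
  assumes "finite F" "x \<notin> F \<Longrightarrow> f x = 0"
  shows "(\<Sum>a\<in>F. f a * indicator {a} x) = f x"
proof -
  have "(\<Sum>a\<in>F. f a * indicator {a} x) = (\<Sum>a\<in>F. if a = x then f x else 0)"
    by (rule sum.cong) (auto simp: indicator_def)
  then show ?thesis using assms by (auto simp: sum.delta)
qed

lemma nn_integral_finite_support:
  assumes \<eta>: "\<eta> \<in> radon_measures" and F: "finite F" and f: "\<And>x. x \<notin> F \<Longrightarrow> f x = 0"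
  shows "(\<integral>\<^sup>+x. f x \<partial>\<eta>) = (\<Sum>x\<in>F. f x * ennreal (measure \<eta> {x}))"
proof -
  have s: "{x} \<in> sets \<eta>" for x using radon_sets[OF \<eta>] by simp
  have eq: "(\<Sum>a\<in>F. f a * indicator {a} x) = f x" for x
    by (rule sum_mult_indicator_singleton[OF F]) (rule f)
  have "(\<integral>\<^sup>+x. f x \<partial>\<eta>) = (\<integral>\<^sup>+x. (\<Sum>a\<in>F. f a * indicator {a} x) \<partial>\<eta>)"
    by (simp only: eq)
  also have "\<dots> = (\<Sum>a\<in>F. \<integral>\<^sup>+x. f a * indicator {a} x \<partial>\<eta>)"
    by (intro nn_integral_sum borel_measurable_times_ennreal borel_measurable_const borel_measurable_indicator s)
  also have "\<dots> = (\<Sum>x\<in>F. f x * ennreal (measure \<eta> {x}))"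
    using s by (simp add: nn_integral_cmult_indicator radon_singleton[OF \<eta>])
  finally show ?thesis .
qed

lemma integral_finite_support:
  fixes f :: "'a::euclidean_space \<Rightarrow> real"
  assumes \<eta>: "\<eta> \<in> radon_measures" and F: "finite F" and f: "\<And>x. x \<notin> F \<Longrightarrow> f x = 0"
  shows "(LINT x|\<eta>. f x) = (\<Sum>x\<in>F. f x * measure \<eta> {x})"
proof -
  have s: "{x} \<in> sets \<eta>" for x using radon_sets[OF \<eta>] by simp
  have sp: "{x} \<inter> space \<eta> = {x}" for x using radon_space[OF \<eta>] by simp
  have i: "integrable \<eta> (\<lambda>x. f a * indicator {a} x)" for a
    using radon_finite[OF \<eta>, of "{a}"] by (intro integrable_mult_right integrable_real_indicator s) auto
  have eq: "(\<Sum>a\<in>F. f a * indicator {a} x) = f x" for x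
    by (rule sum_mult_indicator_singleton[OF F]) (rule f)
  have "(LINT x|\<eta>. f x) = (LINT x|\<eta>. (\<Sum>a\<in>F. f a * indicator {a} x))"
    by (simp only: eq)
  also have "\<dots> = (\<Sum>a\<in>F. LINT x|\<eta>. f a * indicator {a} x)"
    by (rule Bochner_Integration.integral_sum) (rule i)
  also have "\<dots> = (\<Sum>x\<in>F. f x * measure \<eta> {x})"
    by (simp add: sp)
  finally show ?thesis .
qed

lemma atom_sum_finite:
  assumes \<eta>: "\<eta> \<in> radon_measures" and F: "finite (atoms \<eta> \<inter> cball 0 R)"
  shows "atom_sum R k \<eta> = (\<Sum>x\<in>atoms \<eta> \<inter> cball 0 R. k x (measure \<eta> {x}) * ennreal (measure \<eta> {x}))"
  unfolding atom_sum_def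
  by (subst nn_integral_finite_support[OF \<eta> F]) (auto simp: indicator_def atoms_iff[OF \<eta>] intro!: sum.cong)

lemma atoms_restrict_measure:
  assumes \<eta>: "\<eta> \<in> radon_measures"
  shows "atoms (restrict_measure (cball 0 R) \<eta>) \<inter> cball 0 R = atoms \<eta> \<inter> cball 0 R"
    and "x \<in> cball 0 R \<Longrightarrow> measure (restrict_measure (cball 0 R) \<eta>) {x} = measure \<eta> {x}"
proof -
  have em: "emeasure (restrict_measure (cball 0 R) \<eta>) {x} = emeasure \<eta> {x}" if "x \<in> cball 0 R" for x
  proof -
    have "cball 0 R \<inter> {x} = {x}" using that by auto
    then show ?thesis
      unfolding restrict_measure_def using radon_sets[OF \<eta>] by (subst emeasure_restricted) auto
  qed
  then show "atoms (restrict_measure (cball 0 R) \<eta>) \<inter> cball 0 R = atoms \<eta> \<inter> cball 0 R"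
    by (auto simp: atoms_def)
  show "x \<in> cball 0 R \<Longrightarrow> measure (restrict_measure (cball 0 R) \<eta>) {x} = measure \<eta> {x}"
    by (simp add: measure_def em)
qed

abbreviation atom_count :: "real \<Rightarrow> 'a::euclidean_space measure \<Rightarrow> ennreal" where
  "atom_count R \<equiv> atom_sum R (\<lambda>x s. ennreal (1 / s))"

lemma atom_count_measurable [measurable]: "atom_count R \<in> borel_measurable discrete_borel"
  by (rule atom_sum_measurable) (simp add: case_prod_beta)

text \<open>Any \<open>n\<close> atoms in the ball contribute \<open>n\<close> to \<open>atom_count\<close>.\<close>

lemma finite_atoms_iff:
  assumes \<eta>: "\<eta> \<in> radon_measures"
  shows "atom_count R \<eta> < \<infinity> \<longleftrightarrow> finite (atoms \<eta> \<inter> cball 0 R)"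
proof
  assume "finite (atoms \<eta> \<inter> cball 0 R)"
  then show "atom_count R \<eta> < \<infinity>"
    by (subst atom_sum_finite[OF \<eta>]) (auto simp: ennreal_mult_eq_top_iff less_top[symmetric])
next
  assume fin: "atom_count R \<eta> < \<infinity>"
  show "finite (atoms \<eta> \<inter> cball 0 R)"
  proof (rule ccontr)
    assume inf: "infinite (atoms \<eta> \<inter> cball 0 R)"
    have "of_nat n \<le> atom_count R \<eta>" for n
    proof -
      obtain F where F: "finite F" "card F = n" "F \<subseteq> atoms \<eta> \<inter> cball 0 R"
        using infinite_arbitrarily_large[OF inf] by metis
      have "ennreal (1 / measure \<eta> {x}) * ennreal (measure \<eta> {x}) = 1" if "x \<in> F" for x
        using that F(3) by (subst ennreal_mult[symmetric]) (auto simp: atoms_iff[OF \<eta>])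
      then have "of_nat n = (\<Sum>x\<in>F. (ennreal (1 / measure \<eta> {x}) * indicator F x) * ennreal (measure \<eta> {x}))"
        using F by (simp add: indicator_def)
      also have "\<dots> = (\<integral>\<^sup>+x. ennreal (1 / measure \<eta> {x}) * indicator F x \<partial>\<eta>)"
        by (rule nn_integral_finite_support[OF \<eta> F(1), symmetric]) simp
      also have "\<dots> \<le> atom_count R \<eta>"
        unfolding atom_sum_def using F(3)
        by (intro nn_integral_mono) (auto simp: indicator_def atoms_iff[OF \<eta>])
      finally show ?thesis .
    qed
    moreover obtain n where "atom_count R \<eta> < of_nat n"
      using ennreal_Ex_less_of_nat fin by auto
    ultimately show False using not_le by blast
  qed
qed

definition atom_product :: "real \<Rightarrow> ('a::euclidean_space \<Rightarrow> real \<Rightarrow> real) \<Rightarrow> 'a measure \<Rightarrow> real" where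
  "atom_product R \<rho> \<eta> = (\<Prod>x\<in>atoms \<eta> \<inter> cball 0 R. \<rho> x (measure \<eta> {x}))"

text \<open>The product is the exponential of a sum of logarithms over the atoms; the positive and the negative parts of the
  logarithms are summed separately.\<close>

lemma atom_product_measurable:
  fixes \<rho> :: "'a::euclidean_space \<Rightarrow> real \<Rightarrow> real"
  assumes \<rho>: "(\<lambda>(x, s). \<rho> x s) \<in> borel_measurable mark_space" and pos: "\<And>x s. s > 0 \<Longrightarrow> \<rho> x s > 0"
  shows "(\<lambda>\<eta>. if atom_count R \<eta> < \<infinity> then atom_product R \<rho> \<eta> else 1) \<in> borel_measurable discrete_borel"
proof -
  define kp where "kp x s = ennreal (max 0 (ln (\<rho> x s)) / s)" for x s
  define km where "km x s = ennreal (max 0 (- ln (\<rho> x s)) / s)" for x s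
  have [measurable]: "(\<lambda>p. \<rho> (fst p) (snd p)) \<in> borel_measurable mark_space"
    using \<rho> by (simp add: case_prod_beta)
  have [measurable]: "atom_sum R kp \<in> borel_measurable discrete_borel" "atom_sum R km \<in> borel_measurable discrete_borel"
    unfolding kp_def km_def by (intro atom_sum_measurable; simp add: case_prod_beta)+
  have "(\<lambda>\<eta>. if atom_count R \<eta> < \<infinity> then exp (enn2real (atom_sum R kp \<eta>) - enn2real (atom_sum R km \<eta>)) else 1)
      \<in> borel_measurable discrete_borel"
    by measurable
  moreover have "exp (enn2real (atom_sum R kp \<eta>) - enn2real (atom_sum R km \<eta>)) = atom_product R \<rho> \<eta>"
    if "atom_count R \<eta> < \<infinity>" "\<eta> \<in> space discrete_borel" for \<eta>
  proof -
    have \<eta>: "\<eta> \<in> radon_measures" using that by (simp add: space_discrete_borel discrete_radon_radon)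
    have F: "finite (atoms \<eta> \<inter> cball 0 R)" using that finite_atoms_iff[OF \<eta>] by blast
    have w: "measure \<eta> {x} > 0" if "x \<in> atoms \<eta> \<inter> cball 0 R" for x using that by (auto simp: atoms_iff[OF \<eta>])
    have sum: "enn2real (atom_sum R (\<lambda>x s. ennreal (g x s / s)) \<eta>) = (\<Sum>x\<in>atoms \<eta> \<inter> cball 0 R. g x (measure \<eta> {x}))"
      if g: "\<And>x s. g x s \<ge> (0::real)" for g
    proof -
      have "atom_sum R (\<lambda>x s. ennreal (g x s / s)) \<eta> = (\<Sum>x\<in>atoms \<eta> \<inter> cball 0 R. ennreal (g x (measure \<eta> {x})))"
        unfolding atom_sum_finite[OF \<eta> F]
      proof (intro sum.cong refl)
        fix x assume "x \<in> atoms \<eta> \<inter> cball 0 R"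
        from w[OF this] g show "ennreal (g x (measure \<eta> {x}) / measure \<eta> {x}) * ennreal (measure \<eta> {x})
            = ennreal (g x (measure \<eta> {x}))"
          by (subst ennreal_mult[symmetric]) auto
      qed
      then show ?thesis using g by (simp add: sum_ennreal sum_nonneg)
    qed
    have "enn2real (atom_sum R kp \<eta>) - enn2real (atom_sum R km \<eta>)
        = (\<Sum>x\<in>atoms \<eta> \<inter> cball 0 R. ln (\<rho> x (measure \<eta> {x})))"
      unfolding kp_def km_def by (subst (1 2) sum) (auto simp: sum_subtractf[symmetric] intro!: sum.cong)
    also have "exp \<dots> = atom_product R \<rho> \<eta>"
      unfolding atom_product_def exp_sum[OF F] using pos w by (intro prod.cong) auto
    finally show ?thesis .
  qed
  ultimately show ?thesis
    by (subst measurable_cong[where g = "\<lambda>\<eta>. if atom_count R \<eta> < \<infinity> then exp (enn2real (atom_sum R kp \<eta>) - enn2real (atom_sum R km \<eta>)) else 1"]) auto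
qed

section \<open>The transformed law\<close>

text \<open>The ball of radius \<open>R\<close> contains the points that are moved and the points at which \<open>\<theta>\<close> is not \<open>1\<close>.\<close>

locale gauge_law = gauge_transform l \<phi> \<theta>
  for l :: "real^'n::finite \<Rightarrow> real \<Rightarrow> real" and \<phi> \<theta> +
  fixes \<mu> :: "(real^'n) measure measure" and R :: real
  assumes R: "R > 0"
    and phi_outside: "\<And>x. x \<notin> cball 0 R \<Longrightarrow> \<phi> x = x"
    and theta_outside: "\<And>x. x \<notin> cball 0 R \<Longrightarrow> \<theta> x = 1"
    and strip_finite: "\<And>r. emeasure (intensity l) (cball 0 r \<times> {0<..}) < \<infinity>"
    and law_mu: "random_measure_law (intensity l) \<mu>"
begin

lemma emeasure_intensity:
  "S \<in> sets mark_space \<Longrightarrow> emeasure (intensity l) S = (\<integral>\<^sup>+p. ennreal (l (fst p) (snd p) / snd p) * indicator S p \<partial>mark_space)"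
proof -
  assume S: "S \<in> sets mark_space"
  have "(\<lambda>(x, s). ennreal (l x s / s)) \<in> borel_measurable mark_space"
  proof -
    have [measurable]: "(\<lambda>p. l (fst p) (snd p)) \<in> borel_measurable mark_space"
      using l_meas unfolding case_prod_beta .
    show ?thesis unfolding case_prod_beta by measurable
  qed
  then show ?thesis
    unfolding intensity_def using S by (subst emeasure_density) (auto simp: case_prod_beta)
qed

lemma emeasure_mark_strip:
  assumes "B \<in> sets borel"
  shows "B \<times> {0<..} \<in> sets mark_space" "emeasure mark_space (B \<times> {0<..}) = emeasure lborel B * emeasure lborel {0::real<..}"
proof -
  have P: "{0<..} \<in> sets lborel_pos" by (auto simp: sets_restrict_space)
  show "B \<times> {0<..} \<in> sets mark_space" using assms P by (intro pair_measureI) auto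
  have "emeasure lborel_pos {0<..} = emeasure lborel {0::real<..}"
    by (rule emeasure_restrict_space) auto
  then show "emeasure mark_space (B \<times> {0<..}) = emeasure lborel B * emeasure lborel {0::real<..}"
    using assms P sigma_finite_measure.emeasure_pair_measure_Times[OF sigma_finite_lborel_pos, of B lborel "{0<..}"] by simp
qed

sublocale marked_law "intensity l" \<mu> R
proof
  show "sets (intensity l) = sets mark_space" by (rule sets_intensity)
  show "emeasure (intensity l) (cball 0 r \<times> {0<..}) < \<infinity>" for r by (rule strip_finite)
  show "random_measure_law (intensity l) \<mu>" by (rule law_mu)
  show "emeasure (intensity l) ({x} \<times> {0<..}) = 0" for x
  proof -
    have "{x} \<times> {0<..} \<in> null_sets mark_space"
      using emeasure_mark_strip[of "{x}"] by auto
    then show ?thesis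
      by (subst emeasure_intensity) (auto intro: nn_integral_null_set)
  qed
  show "emeasure (intensity l) (cball 0 R \<times> {0<..}) \<noteq> 0"
  proof
    let ?A = "cball 0 R \<times> {0<..} :: ((real^'n) \<times> real) set"
    have A: "?A \<in> sets mark_space" by (rule emeasure_mark_strip) simp
    have [measurable]: "(\<lambda>p. l (fst p) (snd p)) \<in> borel_measurable mark_space"
      using l_meas unfolding case_prod_beta .
    assume "emeasure (intensity l) ?A = 0"
    then have "(\<integral>\<^sup>+p. ennreal (l (fst p) (snd p) / snd p) * indicator ?A p \<partial>mark_space) = 0"
      by (simp only: emeasure_intensity[OF A])
    then have "AE p in mark_space. ennreal (l (fst p) (snd p) / snd p) * indicator ?A p = 0"
      using A by (subst (asm) nn_integral_0_iff_AE) (auto intro!: borel_measurable_times_ennreal)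
    then have "AE p in mark_space. p \<notin> ?A"
    proof (rule AE_mp, intro AE_I2 impI)
      fix p assume *: "ennreal (l (fst p) (snd p) / snd p) * indicator ?A p = 0"
      show "p \<notin> ?A"
      proof
        assume "p \<in> ?A"
        then have "snd p > 0" by auto
        then have "l (fst p) (snd p) / snd p > 0" by (simp add: l_pos)
        then have "ennreal (l (fst p) (snd p) / snd p) \<noteq> 0"
          by (subst ennreal_eq_0_iff) (simp only: not_le)
        with * \<open>p \<in> ?A\<close> show False by simp
      qed
    qed
    then have "emeasure mark_space ?A = 0"
      using A by (simp add: AE_iff_measurable[OF A] Collect_mem_eq) (metis AE_iff_null_sets A null_setsD1)
    moreover have "emeasure lborel {0::real<..} \<noteq> 0"
    proof -
      have "{0<..<1} \<subseteq> {0::real<..}" by auto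
      then have "emeasure lborel {0<..<1::real} \<le> emeasure lborel {0::real<..}" by (rule emeasure_mono) simp
      then show ?thesis by auto
    qed
    moreover have "emeasure lborel (cball (0 :: real^'n) R) \<noteq> 0"
      using content_cball_pos[OF R, of "0 :: real^'n"] by (auto simp: measure_def)
    ultimately show False
      using emeasure_mark_strip(2)[of "cball (0 :: real^'n) R"] by simp
  qed
qed

lemma phi_in_ball [simp]: "\<phi> x \<in> cball 0 R \<longleftrightarrow> x \<in> cball 0 R"
  by (metis phi_outside inv_phi_phi)

lemma inv_phi_outside: "x \<notin> cball 0 R \<Longrightarrow> inv \<phi> x = x"
  using inv_phi_phi[of x] phi_outside[of x] by simp

lemma jac_outside:
  assumes "x \<notin> cball 0 R" shows "jac \<phi> x = 1"
proof -
  have "((\<lambda>x. x) has_derivative (\<lambda>x. x)) (at x)" by (rule has_derivative_ident)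
  then have "(inv \<phi> has_derivative (\<lambda>x. x)) (at x)"
    by (rule has_derivative_transform_within_open[where s = "- cball 0 R"])
      (use assms inv_phi_outside in auto)
  then have "frechet_derivative (inv \<phi>) (at x) = (\<lambda>x. x)"
    by (rule frechet_derivative_at[symmetric])
  then show ?thesis by (simp add: jac_def matrix_id_mat_1[unfolded id_def])
qed

text \<open>Outside the ball the transformation is the identity in a neighbourhood of each point, so the Jacobian is
  \<open>1\<close> as well.\<close>

lemma mark_density_outside: "x \<notin> cball 0 R \<Longrightarrow> s > 0 \<Longrightarrow> mark_density x s = 1"
  using l_pos[of s x] by (simp add: mark_density_def inv_phi_outside theta_outside jac_outside)

lemma gauge_act_eq: "gauge_act (\<phi>, \<theta>) \<eta> = density (distr \<eta> borel \<phi>) (\<lambda>x. ennreal (\<theta> x))"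
  by (simp add: gauge_act_def)

lemma inv_phi_image: "\<phi> -` B = inv \<phi> ` B"
  using Diff0_bij[OF phi] by (simp add: bij_vimage_eq_inv_image)

lemma gauge_act_discrete:
  assumes \<eta>: "\<eta> \<in> discrete_radon" shows "gauge_act (\<phi>, \<theta>) \<eta> \<in> discrete_radon"
proof -
  have r: "\<eta> \<in> radon_measures" by (rule discrete_radon_radon[OF \<eta>])
  note [measurable_cong] = radon_sets[OF r]
  have em: "emeasure (gauge_act (\<phi>, \<theta>) \<eta>) B = (\<integral>\<^sup>+x. ennreal (\<theta> (\<phi> x)) * indicator (\<phi> -` B) x \<partial>\<eta>)"
    if [measurable]: "B \<in> sets borel" for B
  proof -
    have "emeasure (gauge_act (\<phi>, \<theta>) \<eta>) B = (\<integral>\<^sup>+x. ennreal (\<theta> x) * indicator B x \<partial>distr \<eta> borel \<phi>)"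
      unfolding gauge_act_eq by (rule emeasure_density) auto
    also have "\<dots> = (\<integral>\<^sup>+x. ennreal (\<theta> (\<phi> x)) * indicator B (\<phi> x) \<partial>\<eta>)"
      by (rule nn_integral_distr) measurable
    finally show ?thesis by (simp add: indicator_def)
  qed
  obtain A where A: "countable A" "emeasure \<eta> (- A) = 0" using \<eta> by (auto simp: discrete_radon_iff)
  have cA: "countable (\<phi> ` A)" using A by simp
  have sA: "- A \<in> sets borel" "- \<phi> ` A \<in> sets borel"
    by (rule borel_comp[OF countable_sets_borel[OF A(1)]], rule borel_comp[OF countable_sets_borel[OF cA]])
  have "\<phi> -` (- \<phi> ` A) = - A"
    using Diff0_bij[OF phi] by (auto simp: bij_is_inj inj_image_mem_iff)
  then have "emeasure (gauge_act (\<phi>, \<theta>) \<eta>) (- \<phi> ` A) = (\<integral>\<^sup>+x. ennreal (\<theta> (\<phi> x)) * indicator (- A) x \<partial>\<eta>)"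
    by (simp only: em[OF sA(2)])
  also have "\<dots> = 0"
    using A(2) sA(1) radon_sets[OF r] by (intro nn_integral_null_set null_setsI) auto
  finally have null: "emeasure (gauge_act (\<phi>, \<theta>) \<eta>) (- \<phi> ` A) = 0" .
  have "emeasure (gauge_act (\<phi>, \<theta>) \<eta>) K < \<infinity>" if K: "compact K" for K
  proof -
    have "compact (\<theta> ` K)" by (intro compact_continuous_image K continuous_on_subset[OF theta_continuous]) auto
    then obtain c where c': "\<forall>y\<in>\<theta> ` K. \<bar>y\<bar> \<le> c"
      using compact_imp_bounded bounded_real by metis
    have c: "\<theta> x \<le> c" if "x \<in> K" for x using c' that abs_le_D1 by blast
    have cK: "compact (\<phi> -` K)"
      unfolding inv_phi_image
      by (intro compact_continuous_image K continuous_on_subset[OF Diff0_continuous_inv[OF phi]]) auto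
    then have sK: "\<phi> -` K \<in> sets \<eta>" using radon_sets[OF r] compact_imp_closed[OF cK] borel_closed by auto
    have "emeasure (gauge_act (\<phi>, \<theta>) \<eta>) K = (\<integral>\<^sup>+x. ennreal (\<theta> (\<phi> x)) * indicator (\<phi> -` K) x \<partial>\<eta>)"
      using compact_imp_closed[OF K] by (intro em) auto
    also have "\<dots> \<le> (\<integral>\<^sup>+x. ennreal c * indicator (\<phi> -` K) x \<partial>\<eta>)"
      using c by (intro nn_integral_mono) (auto simp: indicator_def intro: ennreal_leI)
    also have "\<dots> = ennreal c * emeasure \<eta> (\<phi> -` K)" by (rule nn_integral_cmult_indicator[OF sK])
    also have "\<dots> < \<infinity>" using radon_finite[OF r cK] by (simp add: ennreal_mult_less_top)
    finally show ?thesis .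
  qed
  moreover have "sets (gauge_act (\<phi>, \<theta>) \<eta>) = sets borel" by (simp add: gauge_act_eq)
  ultimately show ?thesis
    unfolding discrete_radon_iff radon_measures_def using cA null by blast
qed

lemma gauge_act_integral:
  fixes f :: "real^'n \<Rightarrow> real"
  assumes \<eta>: "\<eta> \<in> radon_measures" and [measurable]: "f \<in> borel_measurable borel"
  shows "(LINT x|gauge_act (\<phi>, \<theta>) \<eta>. f x) = (LINT x|\<eta>. \<theta> (\<phi> x) * f (\<phi> x))"
proof -
  note [measurable_cong] = radon_sets[OF \<eta>]
  have "(LINT x|gauge_act (\<phi>, \<theta>) \<eta>. f x) = (LINT x|distr \<eta> borel \<phi>. \<theta> x *\<^sub>R f x)"
    unfolding gauge_act_eq by (rule integral_density) auto
  also have "\<dots> = (LINT x|\<eta>. \<theta> (\<phi> x) * f (\<phi> x))"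
    by (subst integral_distr) auto
  finally show ?thesis .
qed

lemma Cc_pullback:
  assumes f: "f \<in> Cc" shows "(\<lambda>x. \<theta> (\<phi> x) * f (\<phi> x)) \<in> Cc"
proof -
  from f obtain r where r: "\<And>x. x \<notin> cball 0 r \<Longrightarrow> f x = 0" by (rule CcE) blast
  have cphi: "continuous_on UNIV \<phi>" by (rule Diff0_continuous[OF phi])
  show ?thesis
  proof (rule CcI)
    show "continuous_on UNIV (\<lambda>x. \<theta> (\<phi> x) * f (\<phi> x))"
      by (intro continuous_on_mult continuous_on_compose2[OF theta_continuous cphi]
          continuous_on_compose2[OF Cc_continuous[OF f] cphi]) auto
    show "compact (inv \<phi> ` cball 0 r)"
      by (intro compact_continuous_image compact_cball continuous_on_subset[OF Diff0_continuous_inv[OF phi]]) auto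
    show "\<theta> (\<phi> x) * f (\<phi> x) = 0" if "x \<notin> inv \<phi> ` cball 0 r" for x
      using that r[of "\<phi> x"] unfolding inv_phi_image[symmetric] by auto
  qed
qed

lemma gauge_act_measurable: "gauge_act (\<phi>, \<theta>) \<in> \<mu> \<rightarrow>\<^sub>M discrete_borel"
proof (rule measurable_discrete_borelI)
  show "gauge_act (\<phi>, \<theta>) \<eta> \<in> discrete_radon" if "\<eta> \<in> space \<mu>" for \<eta>
    using that by (simp add: space_mu gauge_act_discrete)
  fix f :: "real^'n \<Rightarrow> real" assume f: "f \<in> Cc"
  have "(\<lambda>\<eta>. LINT x|\<eta>. \<theta> (\<phi> x) * f (\<phi> x)) \<in> borel_measurable \<mu>"
    by (rule borel_measurable_discrete_evaluation[OF sets_mu Cc_pullback[OF f]])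
  then show "(\<lambda>\<eta>. LINT x|gauge_act (\<phi>, \<theta>) \<eta>. f x) \<in> borel_measurable \<mu>"
    by (rule measurable_cong[THEN iffD1, rotated])
      (simp add: gauge_act_integral[OF _ Cc_measurable[OF f]] space_mu discrete_radon_radon)
qed

abbreviation rho :: "(real^'n) \<times> real \<Rightarrow> real" where
  "rho p \<equiv> mark_density (fst p) (snd p)"

lemma rho_measurable [measurable]: "rho \<in> borel_measurable (intensity l)"
  using mark_density_measurable measurable_cong_sets[OF sets_intensity refl, of borel]
  unfolding case_prod_beta by blast

lemma rho_pos: "p \<in> space (intensity l) \<Longrightarrow> rho p > 0"
  by (auto simp: mark_density_pos)

lemma mark_map_measurable_m: "mark_map \<in> intensity l \<rightarrow>\<^sub>M mark_space"
  using mark_map_measurable measurable_cong_sets[OF sets_intensity refl] by blast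

lemma integral_mark_map:
  fixes H :: "(real^'n) \<times> real \<Rightarrow> complex"
  assumes H: "H \<in> borel_measurable (intensity l)"
  shows "(LINT p|intensity l. H (mark_map p)) = (LINT p|intensity l. rho p *\<^sub>R H p)"
    and "integrable (intensity l) (\<lambda>p. H (mark_map p)) \<longleftrightarrow> integrable (intensity l) (\<lambda>p. rho p *\<^sub>R H p)"
proof -
  have H': "H \<in> borel_measurable mark_space"
    using H measurable_cong_sets[OF sets_intensity refl, of borel] by blast
  have nn: "AE p in intensity l. 0 \<le> rho p"
    using rho_pos by (intro AE_I2) (simp add: less_imp_le)
  show "(LINT p|intensity l. H (mark_map p)) = (LINT p|intensity l. rho p *\<^sub>R H p)"
    using integral_distr[OF mark_map_measurable_m H'] integral_density[OF H rho_measurable nn]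
    by (simp add: distr_mark_map)
  show "integrable (intensity l) (\<lambda>p. H (mark_map p)) \<longleftrightarrow> integrable (intensity l) (\<lambda>p. rho p *\<^sub>R H p)"
    using integrable_distr_eq[OF mark_map_measurable_m H'] integrable_density[OF H rho_measurable nn]
    by (simp add: distr_mark_map)
qed

lemma indicator_strip_integrable: "integrable (intensity l) (indicator A :: _ \<Rightarrow> complex)"
proof (rule integrableI_bounded_set[where A = A and B = 1])
  show AS: "A \<in> sets (intensity l)" by (rule strip_sets) simp
  then show "(indicator A :: _ \<Rightarrow> complex) \<in> borel_measurable (intensity l)" by simp
  show "emeasure (intensity l) A < \<infinity>" by (rule m_fin)
qed (auto simp: indicator_def)

text \<open>The transformation maps the strip above the ball onto itself, hence the image of the intensity has the same
  mass on it. So the likelihood ratio has the normalising constant \<open>1\<close>.\<close>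

lemma rho_mass:
  "integrable (intensity l) (\<lambda>p. rho p *\<^sub>R indicator A p :: complex)"
  "(LINT p|intensity l. rho p *\<^sub>R indicator A p) = (LINT p|intensity l. indicator A p :: complex)"
proof -
  have A: "A \<in> sets (intensity l)" by (rule strip_sets) simp
  have m: "(indicator A :: _ \<Rightarrow> complex) \<in> borel_measurable (intensity l)" using A by simp
  have e: "indicator A (mark_map p) = (indicator A p :: complex)" if "p \<in> space (intensity l)" for p
    using that phi_in_ball[of "fst p"]
    by (auto simp: mark_map_def indicator_def split: prod.splits simp del: phi_in_ball)
  have "integrable (intensity l) (indicator A :: _ \<Rightarrow> complex)"
    by (rule indicator_strip_integrable)
  then have "integrable (intensity l) (\<lambda>p. indicator A (mark_map p) :: complex)"
    by (subst Bochner_Integration.integrable_cong[OF refl]) (rule e)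
  then show "integrable (intensity l) (\<lambda>p. rho p *\<^sub>R indicator A p :: complex)"
    using integral_mark_map(2)[OF m] by blast
  show "(LINT p|intensity l. rho p *\<^sub>R indicator A p) = (LINT p|intensity l. indicator A p :: complex)"
    unfolding integral_mark_map(1)[OF m, symmetric] by (rule Bochner_Integration.integral_cong[OF refl e])
qed

text \<open>Pulling \<open>f\<close> back along the transformation stays within \<^const>\<open>Cc\<close>, so the assumption on the law
  applies, and \<open>distr_mark_map\<close> moves the transformation from the test function to the intensity.\<close>

lemma fourier_transformed_law:
  assumes f: "f \<in> Cc"
  shows "(LINT \<eta>|transformed_law (\<phi>, \<theta>) \<mu>. iexp (LINT x|\<eta>. f x)) =
    exp (LINT p:A|intensity l. rho p *\<^sub>R psi f p) * exp (LINT p:outer_strip|intensity l. psi f p)"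
proof -
  let ?k = "\<lambda>x. \<theta> (\<phi> x) * f (\<phi> x)"
  have k: "?k \<in> Cc" by (rule Cc_pullback[OF f])
  have pm: "psi f \<in> borel_measurable (intensity l)" by (rule psi_measurable[OF Cc_measurable[OF f]])
  have kp: "psi ?k p = psi f (mark_map p)" for p
    by (simp add: psi_def mark_map_def mult_ac split: prod.splits)
  have i: "integrable (intensity l) (\<lambda>p. rho p *\<^sub>R psi f p)"
    using Cc_psi_integrable[OF k] unfolding kp[abs_def] integral_mark_map(2)[OF pm] .
  have "(LINT \<eta>|transformed_law (\<phi>, \<theta>) \<mu>. iexp (LINT x|\<eta>. f x)) = (LINT \<eta>|\<mu>. iexp (LINT x|gauge_act (\<phi>, \<theta>) \<eta>. f x))"
    unfolding transformed_law_def
    by (intro integral_distr gauge_act_measurable borel_measurable_iexp evaluation_measurable f)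
  also have "\<dots> = (LINT \<eta>|\<mu>. iexp (LINT x|\<eta>. ?k x))"
    by (rule Bochner_Integration.integral_cong[OF refl])
      (simp add: gauge_act_integral[OF _ Cc_measurable[OF f]] space_mu discrete_radon_radon)
  also have "\<dots> = exp (LINT p|intensity l. psi ?k p)" by (rule fourier_Cc[OF k])
  also have "(LINT p|intensity l. psi ?k p) = (LINT p|intensity l. rho p *\<^sub>R psi f p)"
    unfolding kp by (rule integral_mark_map(1)[OF pm])
  also have "\<dots> = (LINT p|intensity l. indicator A p *\<^sub>R (rho p *\<^sub>R psi f p) + indicator outer_strip p *\<^sub>R psi f p)"
    by (rule Bochner_Integration.integral_cong[OF refl]) (auto simp: indicator_def mark_density_outside)
  also have "\<dots> = (LINT p:A|intensity l. rho p *\<^sub>R psi f p) + (LINT p:outer_strip|intensity l. psi f p)"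
    unfolding set_lebesgue_integral_def
    by (intro Bochner_Integration.integral_add integrable_mult_indicator i Cc_psi_integrable f strip_sets) auto
  finally show ?thesis by (simp add: exp_add)
qed

text \<open>The value \<open>1\<close> in the case of infinitely many atoms is arbitrary; it keeps the function measurable and
  positive.\<close>

definition law_density :: "(real^'n) measure \<Rightarrow> real" where
  "law_density \<eta> = (if atom_count R \<eta> < \<infinity> then atom_product R mark_density \<eta> else 1)"

lemma law_density_measurable [measurable]: "law_density \<in> borel_measurable discrete_borel"
  unfolding law_density_def[abs_def]
  by (rule atom_product_measurable[OF mark_density_measurable mark_density_pos])

lemma law_density_pos: "\<eta> \<in> discrete_radon \<Longrightarrow> law_density \<eta> > 0"
  unfolding law_density_def atom_product_def
  by (auto intro!: prod_pos mark_density_pos simp: atoms_iff discrete_radon_radon)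

text \<open>For distinct points the weights do not merge, and the product over the atoms is the product over the
  sample.\<close>

lemma law_density_config_measure:
  assumes inj: "inj (\<lambda>i. fst (p i))" and pos: "\<And>i. snd (p i) > (0::real)" and ball: "\<And>i. fst (p i) \<in> cball 0 R"
  shows "law_density (config_measure (n, p)) = (\<Prod>i<n. rho (p i))"
proof -
  let ?\<eta> = "config_measure (n, p)"
  have \<eta>: "?\<eta> \<in> radon_measures" by (rule discrete_radon_radon[OF config_measure_discrete])
  have em: "emeasure ?\<eta> {x} = (\<Sum>i<n. ennreal (snd (p i)) * indicator {x} (fst (p i)))" for x
    by (rule emeasure_config_measure) simp
  have w: "measure ?\<eta> {fst (p j)} = snd (p j)" if "j < n" for j
  proof -
    have "emeasure ?\<eta> {fst (p j)} = (\<Sum>i<n. if i = j then ennreal (snd (p j)) else 0)"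
      unfolding em using inj by (intro sum.cong) (auto simp: indicator_def dest: injD)
    also have "\<dots> = ennreal (snd (p j))" using that by simp
    finally show ?thesis using pos[of j] by (simp add: measure_def)
  qed
  have at: "atoms ?\<eta> \<inter> cball 0 R = (\<lambda>i. fst (p i)) ` {..<n}"
  proof (intro equalityI subsetI)
    fix x assume "x \<in> (\<lambda>i. fst (p i)) ` {..<n}"
    then show "x \<in> atoms ?\<eta> \<inter> cball 0 R" using w pos ball by (auto simp: atoms_iff[OF \<eta>])
  next
    fix x assume "x \<in> atoms ?\<eta> \<inter> cball 0 R"
    then have "emeasure ?\<eta> {x} \<noteq> 0" by (auto simp: atoms_def)
    then show "x \<in> (\<lambda>i. fst (p i)) ` {..<n}"
      unfolding em by (auto simp: indicator_def split: if_splits)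
  qed
  then have "atom_count R ?\<eta> < \<infinity>" using finite_atoms_iff[OF \<eta>] by simp
  then have "law_density ?\<eta> = (\<Prod>x\<in>(\<lambda>i. fst (p i)) ` {..<n}. mark_density x (measure ?\<eta> {x}))"
    by (simp add: law_density_def atom_product_def at)
  also have "\<dots> = (\<Prod>i<n. mark_density (fst (p i)) (measure ?\<eta> {fst (p i)}))"
    using inj by (subst prod.reindex) (auto intro: inj_on_subset)
  also have "\<dots> = (\<Prod>i<n. rho (p i))" by (intro prod.cong) (auto simp: w)
  finally show ?thesis .
qed

lemma AE_sample_config:
  "AE (n, p) in poisson_sample (intensity l) A. inj (\<lambda>i. fst (p i)) \<and> (\<forall>i. p i \<in> A)"
proof -
  have "AE (n, p) in poisson_sample (intensity l) A. inj (\<lambda>i. fst (p i))"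
  proof (rule strip.AE_sample_distinct)
    show "fst \<in> borel_measurable (intensity l)" by (rule mark_functions)
    show "emeasure (intensity l) {p \<in> space (intensity l). fst p = y} = 0" for y
    proof -
      have "{p \<in> space (intensity l). fst p = y} = {y} \<times> {0<..}" by auto
      then show ?thesis by (simp only: m_diffuse)
    qed
  qed
  with strip.AE_sample_in show ?thesis
    by eventually_elim auto
qed

text \<open>Almost surely the integrand is a product over the sample, with the factor \<open>\<rho> exp (i s f)\<close> for each point,
  so its expectation is known. Since the total masses agree, \<open>\<rho> exp (i s f) - 1\<close> and
  \<open>\<rho> (exp (i s f) - 1)\<close> have the same integral over the strip.\<close>

lemma law_density_fourier:
  assumes f: "f \<in> Cc"
  shows "integrable sample_law (\<lambda>\<eta>. law_density \<eta> *\<^sub>R iexp (LINT x|\<eta>. f x))"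
    and "(LINT \<eta>|sample_law. law_density \<eta> *\<^sub>R iexp (LINT x|\<eta>. f x)) = exp (LINT p:A|intensity l. rho p *\<^sub>R psi f p)"
proof -
  define H where "H p = rho p *\<^sub>R iexp (snd p * f (fst p))" for p
  note [measurable] = Cc_measurable[OF f]
  have Hm: "H \<in> borel_measurable (intensity l)" unfolding H_def[abs_def] by measurable
  have AS: "A \<in> sets (intensity l)" by (rule strip_sets) simp
  have iA: "integrable (intensity l) (indicator A :: _ \<Rightarrow> complex)"
    by (rule indicator_strip_integrable)
  have Hi: "set_integrable (intensity l) A H"
    unfolding set_integrable_def
    by (rule Bochner_Integration.integrable_bound[OF rho_mass(1)])
      (use Hm AS in \<open>auto simp: H_def indicator_def\<close>)
  have Gm: "(\<lambda>\<eta>. law_density \<eta> *\<^sub>R iexp (LINT x|\<eta>. f x)) \<in> borel_measurable discrete_borel"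
    by (intro borel_measurable_scaleR law_density_measurable borel_measurable_iexp evaluation_measurable f)
  have AE: "AE np in poisson_sample (intensity l) A.
      law_density (config_measure np) *\<^sub>R iexp (LINT x|config_measure np. f x) = (case np of (n, p) \<Rightarrow> \<Prod>i<n. H (p i))"
    using AE_sample_config
  proof eventually_elim
    case (elim np)
    obtain n p where np: "np = (n, p)" by force
    have pos: "snd (p i) > 0" and ball: "fst (p i) \<in> cball 0 R" for i
      using elim unfolding np by (auto simp: mem_Times_iff)
    have "iexp (LINT x|config_measure (n, p). f x) = (\<Prod>i<n. iexp (snd (p i) * f (fst (p i))))"
      by (simp add: integral_config_measure pos[THEN less_imp_le] exp_sum[symmetric] sum_distrib_left)
    moreover have "law_density (config_measure (n, p)) = (\<Prod>i<n. rho (p i))"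
      using elim pos ball unfolding np by (intro law_density_config_measure) auto
    ultimately show ?case
      by (simp add: np H_def scaleR_conv_of_real prod.distrib)
  qed
  have m1: "(\<lambda>np. law_density (config_measure np) *\<^sub>R iexp (LINT x|config_measure np. f x)) \<in> borel_measurable (poisson_sample (intensity l) A)"
    by (rule measurable_compose[OF config_measure_measurable Gm])
  have m2: "(\<lambda>(n, p). \<Prod>i<n. H (p i)) \<in> borel_measurable (poisson_sample (intensity l) A)"
    using strip.integrable_sample_prod[OF Hm Hi] by (rule borel_measurable_integrable)
  have "integrable (poisson_sample (intensity l) A) (\<lambda>np. law_density (config_measure np) *\<^sub>R iexp (LINT x|config_measure np. f x))"
    using integrable_cong_AE[OF m1 m2 AE] strip.integrable_sample_prod[OF Hm Hi] by blast
  then show "integrable sample_law (\<lambda>\<eta>. law_density \<eta> *\<^sub>R iexp (LINT x|\<eta>. f x))"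
    unfolding sample_law_def by (subst integrable_distr_eq[OF config_measure_measurable Gm])
  have "(LINT \<eta>|sample_law. law_density \<eta> *\<^sub>R iexp (LINT x|\<eta>. f x)) = (LINT np|poisson_sample (intensity l) A. law_density (config_measure np) *\<^sub>R iexp (LINT x|config_measure np. f x))"
    unfolding sample_law_def by (rule integral_distr[OF config_measure_measurable Gm])
  also have "\<dots> = (LINT (n, p)|poisson_sample (intensity l) A. (\<Prod>i<n. H (p i)))"
    by (rule integral_cong_AE[OF m1 m2 AE])
  also have "\<dots> = exp (LINT p:A|intensity l. H p - 1)" by (rule strip.integral_sample_prod[OF Hm Hi])
  also have "(LINT p:A|intensity l. H p - 1) = (LINT p:A|intensity l. rho p *\<^sub>R psi f p)"
  proof -
    have i1: "integrable (intensity l) (\<lambda>p. indicator A p *\<^sub>R H p)" using Hi by (simp add: set_integrable_def)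
    have "(LINT p:A|intensity l. rho p *\<^sub>R psi f p) = (LINT p|intensity l. indicator A p *\<^sub>R H p - rho p *\<^sub>R indicator A p)"
      unfolding set_lebesgue_integral_def
      by (rule Bochner_Integration.integral_cong[OF refl]) (auto simp: H_def psi_def indicator_def algebra_simps)
    also have "\<dots> = (LINT p|intensity l. indicator A p *\<^sub>R H p) - (LINT p|intensity l. indicator A p)"
      unfolding rho_mass(2)[symmetric] by (rule Bochner_Integration.integral_diff[OF i1 rho_mass(1)])
    also have "\<dots> = (LINT p|intensity l. indicator A p *\<^sub>R H p - indicator A p)"
      by (rule Bochner_Integration.integral_diff[OF i1 iA, symmetric])
    also have "\<dots> = (LINT p:A|intensity l. H p - 1)"
      unfolding set_lebesgue_integral_def
      by (rule Bochner_Integration.integral_cong[OF refl]) (auto simp: indicator_def)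
    finally show ?thesis ..
  qed
  finally show "(LINT \<eta>|sample_law. law_density \<eta> *\<^sub>R iexp (LINT x|\<eta>. f x)) = exp (LINT p:A|intensity l. rho p *\<^sub>R psi f p)" .
qed


definition law_ratio :: "(real^'n) measure \<Rightarrow> real" where
  "law_ratio \<eta> = law_density (restrict_measure \<Lambda> \<eta>)"

lemma law_ratio_measurable [measurable]: "law_ratio \<in> borel_measurable \<mu>"
  unfolding law_ratio_def[abs_def]
  by (rule measurable_compose[OF restrict_measure_measurable_mu law_density_measurable])

lemma law_ratio_pos: "\<eta> \<in> space \<mu> \<Longrightarrow> law_ratio \<eta> > 0"
  unfolding law_ratio_def by (intro law_density_pos restrict_measure_discrete) (auto simp: space_mu)

lemma finite_ratio: "finite_measure (density \<mu> (\<lambda>\<eta>. ennreal (law_ratio \<eta>)))"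
proof (rule finite_measureI)
  have "integrable sample_law (\<lambda>\<eta>. complex_of_real (law_density \<eta>))"
    using law_density_fourier(1)[OF Cc_zero] by (simp add: scaleR_conv_of_real)
  then have i: "integrable sample_law law_density" by (simp only: complex_of_real_integrable_eq)
  have "emeasure (density \<mu> (\<lambda>\<eta>. ennreal (law_ratio \<eta>))) (space \<mu>) = (\<integral>\<^sup>+\<eta>. ennreal (law_ratio \<eta>) \<partial>\<mu>)"
    by (subst emeasure_density) (use sets.top[of \<mu>] in \<open>auto intro!: nn_integral_cong\<close>)
  also have "\<dots> = (\<integral>\<^sup>+\<eta>. ennreal (law_density \<eta>) \<partial>distr \<mu> discrete_borel (restrict_measure \<Lambda>))"
    unfolding law_ratio_def by (rule nn_integral_distr[symmetric, OF restrict_measure_measurable_mu]) simp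
  also have "\<dots> \<le> (\<integral>\<^sup>+\<eta>. ennreal (norm (law_density \<eta>)) \<partial>sample_law)"
    unfolding distr_restrict_measure by (intro nn_integral_mono ennreal_leI) simp
  also have "\<dots> < \<infinity>" using i by (simp add: integrable_iff_bounded)
  finally show "emeasure (density \<mu> (\<lambda>\<eta>. ennreal (law_ratio \<eta>))) (space (density \<mu> (\<lambda>\<eta>. ennreal (law_ratio \<eta>)))) \<noteq> \<infinity>"
    by simp
qed

text \<open>The Fourier transforms agree: inside the ball \<open>\<rho>\<close> enters through \<open>law_density_fourier\<close>, outside the
  ball both laws have the intensity \<open>m\<close>, and the two parts are independent.\<close>

theorem transformed_law_density: "transformed_law (\<phi>, \<theta>) \<mu> = density \<mu> (\<lambda>\<eta>. ennreal (law_ratio \<eta>))"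
proof (rule fourier_determines_law)
  show "finite_measure (transformed_law (\<phi>, \<theta>) \<mu>)"
    unfolding transformed_law_def by (rule finite_measure_distr[OF gauge_act_measurable])
  show "finite_measure (density \<mu> (\<lambda>\<eta>. ennreal (law_ratio \<eta>)))" by (rule finite_ratio)
  show "sets (transformed_law (\<phi>, \<theta>) \<mu>) = sets discrete_borel"
    "sets (density \<mu> (\<lambda>\<eta>. ennreal (law_ratio \<eta>))) = sets discrete_borel"
    by (simp_all add: transformed_law_def)
  fix f :: "real^'n \<Rightarrow> real" assume f: "f \<in> Cc"
  define G where "G \<eta> = law_density \<eta> *\<^sub>R iexp (LINT x|\<eta>. f x)" for \<eta>
  have Gm: "G \<in> borel_measurable discrete_borel" unfolding G_def[abs_def]
    by (intro borel_measurable_scaleR law_density_measurable borel_measurable_iexp evaluation_measurable f)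
  have Gi: "integrable sample_law G" unfolding G_def[abs_def] by (rule law_density_fourier(1)[OF f])
  have split: "law_ratio \<eta> *\<^sub>R iexp (LINT x|\<eta>. f x) =
      G (restrict_measure \<Lambda> \<eta>) * iexp (LINT x|\<eta>. glue \<Lambda> (\<lambda>x. 0) f x)" if "\<eta> \<in> space \<mu>" for \<eta>
  proof -
    have r: "\<eta> \<in> radon_measures" using that by (simp add: space_mu discrete_radon_radon)
    have "(LINT x|\<eta>. f x) = (LINT x|\<eta>. glue \<Lambda> f (\<lambda>x. 0) x + glue \<Lambda> (\<lambda>x. 0) f x)"
      by (rule Bochner_Integration.integral_cong) (auto simp: glue_def)
    also have "\<dots> = (LINT x|\<eta>. glue \<Lambda> f (\<lambda>x. 0) x) + (LINT x|\<eta>. glue \<Lambda> (\<lambda>x. 0) f x)"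
      using glue_integrable[OF r closed_cball f Cc_zero] glue_integrable[OF r closed_cball Cc_zero f]
      by (rule Bochner_Integration.integral_add)
    also have "(LINT x|\<eta>. glue \<Lambda> f (\<lambda>x. 0) x) = (LINT x|restrict_measure \<Lambda> \<eta>. f x)"
      by (rule restrict_measure_integral[OF r _ Cc_measurable[OF f], symmetric]) simp
    finally show ?thesis by (simp add: G_def law_ratio_def exp_add distrib_left)
  qed
  have "(LINT \<eta>|density \<mu> (\<lambda>\<eta>. ennreal (law_ratio \<eta>)). iexp (LINT x|\<eta>. f x))
      = (LINT \<eta>|\<mu>. law_ratio \<eta> *\<^sub>R iexp (LINT x|\<eta>. f x))"
  proof (rule integral_density)
    show "(\<lambda>\<eta>. iexp (LINT x|\<eta>. f x)) \<in> borel_measurable \<mu>"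
      by (intro borel_measurable_iexp borel_measurable_discrete_evaluation sets_mu f)
    show "AE \<eta> in \<mu>. 0 \<le> law_ratio \<eta>"
      using law_ratio_pos by (intro AE_I2) (simp add: less_imp_le)
  qed (rule law_ratio_measurable)
  also have "\<dots> = (LINT \<eta>|\<mu>. G (restrict_measure \<Lambda> \<eta>) * iexp (LINT x|\<eta>. glue \<Lambda> (\<lambda>x. 0) f x))"
    by (rule Bochner_Integration.integral_cong[OF refl split])
  also have "\<dots> = (LINT \<eta>|sample_law. G \<eta>) * exp (LINT p:outer_strip|intensity l. psi f p)"
    by (rule restriction_independent[OF Gm Gi f])
  also have "(LINT \<eta>|sample_law. G \<eta>) = exp (LINT p:A|intensity l. rho p *\<^sub>R psi f p)"
    unfolding G_def by (rule law_density_fourier(2)[OF f])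
  finally show "(LINT \<eta>|transformed_law (\<phi>, \<theta>) \<mu>. iexp (LINT x|\<eta>. f x)) =
      (LINT \<eta>|density \<mu> (\<lambda>\<eta>. ennreal (law_ratio \<eta>)). iexp (LINT x|\<eta>. f x))"
    by (simp only: fourier_transformed_law[OF f])
qed

text \<open>The number of atoms in the ball depends on the restriction to the ball only, which is distributed like a finite
  sample.\<close>

lemma AE_finite_atoms: "AE \<eta> in \<mu>. finite (atoms \<eta> \<inter> \<Lambda>)"
proof -
  have "AE \<eta> in sample_law. atom_count R \<eta> < \<infinity>"
    unfolding sample_law_def
  proof (subst AE_distr_iff[OF config_measure_measurable])
    show "{\<eta> \<in> space discrete_borel. atom_count R \<eta> < \<infinity>} \<in> sets (discrete_borel :: (real^'n) measure measure)"
      by measurable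
    have "finite (atoms (config_measure (n, p)))" for n and p :: "nat \<Rightarrow> (real^'n) \<times> real"
    proof (rule finite_subset)
      show "atoms (config_measure (n, p)) \<subseteq> (\<lambda>i. fst (p i)) ` {..<n}"
      proof
        fix x assume x: "x \<in> atoms (config_measure (n, p))"
        show "x \<in> (\<lambda>i. fst (p i)) ` {..<n}"
        proof (rule ccontr)
          assume "x \<notin> (\<lambda>i. fst (p i)) ` {..<n}"
          then have "emeasure (config_measure (n, p)) {x} = 0"
            by (subst emeasure_config_measure) (auto simp: indicator_def intro!: sum.neutral)
          with x show False by (simp add: atoms_def)
        qed
      qed
    qed simp
    then show "AE np in poisson_sample (intensity l) A. atom_count R (config_measure np) < \<infinity>"
    proof (intro AE_I2)
      fix np
      have "finite (atoms (config_measure np) \<inter> \<Lambda>)"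
        using \<open>\<And>n p. finite (atoms (config_measure (n, p)))\<close>[of "fst np" "snd np"] by simp
      then show "atom_count R (config_measure np) < \<infinity>"
        by (rule finite_atoms_iff[OF discrete_radon_radon[OF config_measure_discrete], THEN iffD2])
    qed
  qed
  then have "AE \<eta> in \<mu>. atom_count R (restrict_measure \<Lambda> \<eta>) < \<infinity>"
    unfolding distr_restrict_measure[symmetric] by (rule AE_distrD[OF restrict_measure_measurable_mu])
  then show ?thesis
  proof (rule AE_mp, intro AE_I2 impI)
    fix \<eta> assume \<eta>: "\<eta> \<in> space \<mu>" and fin: "atom_count R (restrict_measure \<Lambda> \<eta>) < \<infinity>"
    have d: "\<eta> \<in> discrete_radon" using \<eta> by (simp add: space_mu)
    have "restrict_measure \<Lambda> \<eta> \<in> radon_measures"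
      by (intro discrete_radon_radon restrict_measure_discrete d) simp
    from finite_atoms_iff[OF this, THEN iffD1, OF fin]
    show "finite (atoms \<eta> \<inter> \<Lambda>)"
      unfolding atoms_restrict_measure(1)[OF discrete_radon_radon[OF d]] .
  qed
qed

text \<open>For almost every \<open>x\<close> the integral of \<open>l x s / s\<close> over \<open>s\<close> is finite, because the intensity is finite above
  every ball. For such \<open>x\<close> the two parts of the inner integral agree by the scaling invariance of \<open>ds / s\<close>.\<close>

lemma exponent_integral_zero: "(LINT x|lborel. LINT s|lborel_pos. (l x s - l x (s / \<theta> x)) / s) = 0"
proof (rule integral_eq_zero_AE)
  have lm: "(\<lambda>p. l (fst p) (snd p)) \<in> borel_measurable mark_space"
    using l_meas unfolding case_prod_beta .
  have lx: "l x \<in> borel_measurable lborel_pos" for x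
    using measurable_compose[OF measurable_Pair1'[of x lborel lborel_pos] lm] by simp
  have id: "(\<lambda>s. s) \<in> borel_measurable lborel_pos"
    by (rule measurable_restrict_space1) simp
  have qm: "(\<lambda>p. ennreal (l (fst p) (snd p) / snd p) * indicator (cball 0 r \<times> {0<..}) p) \<in> borel_measurable mark_space" for r
    using emeasure_mark_strip(1)[of "cball 0 r"]
    by (intro borel_measurable_times_ennreal measurable_compose[OF _ measurable_ennreal] borel_measurable_divide lm
        borel_measurable_mark borel_measurable_indicator) simp
  have "AE x in lborel. x \<in> cball 0 (real n) \<longrightarrow> (\<integral>\<^sup>+s. ennreal (l x s / s) \<partial>lborel_pos) \<noteq> \<infinity>" for n
  proof -
    let ?S = "cball 0 (real n) \<times> {0<..} :: ((real^'n) \<times> real) set"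
    have S: "?S \<in> sets mark_space" by (rule emeasure_mark_strip) simp
    have "emeasure (intensity l) ?S = (\<integral>\<^sup>+x. \<integral>\<^sup>+s. ennreal (l x s / s) * indicator ?S (x, s) \<partial>lborel_pos \<partial>lborel)"
      unfolding emeasure_intensity[OF S] by (subst nn_integral_mark_space[OF qm]) simp
    with strip_finite[of "real n"]
    have "(\<integral>\<^sup>+x. \<integral>\<^sup>+s. ennreal (l x s / s) * indicator ?S (x, s) \<partial>lborel_pos \<partial>lborel) \<noteq> \<infinity>" by simp
    moreover have "(\<lambda>x. \<integral>\<^sup>+s. ennreal (l x s / s) * indicator ?S (x, s) \<partial>lborel_pos) \<in> borel_measurable lborel"
      using sigma_finite_measure.borel_measurable_nn_integral_fst[OF sigma_finite_lborel_pos qm[of "real n"]] by simp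
    ultimately have "AE x in lborel. (\<integral>\<^sup>+s. ennreal (l x s / s) * indicator ?S (x, s) \<partial>lborel_pos) \<noteq> \<infinity>"
      by (intro nn_integral_noteq_infinite) auto
    then show ?thesis
    proof (rule AE_mp, intro AE_I2 impI)
      fix x :: "real^'n"
      assume *: "(\<integral>\<^sup>+s. ennreal (l x s / s) * indicator ?S (x, s) \<partial>lborel_pos) \<noteq> \<infinity>" and "x \<in> cball 0 (real n)"
      then have "(\<integral>\<^sup>+s. ennreal (l x s / s) * indicator ?S (x, s) \<partial>lborel_pos) = (\<integral>\<^sup>+s. ennreal (l x s / s) \<partial>lborel_pos)"
        by (intro nn_integral_cong) (auto simp: indicator_def)
      with * show "(\<integral>\<^sup>+s. ennreal (l x s / s) \<partial>lborel_pos) \<noteq> \<infinity>" by simp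
    qed
  qed
  then have "AE x in lborel. \<forall>n. x \<in> cball 0 (real n) \<longrightarrow> (\<integral>\<^sup>+s. ennreal (l x s / s) \<partial>lborel_pos) \<noteq> \<infinity>"
    by (simp only: AE_all_countable) blast
  then show "AE x in lborel. (LINT s|lborel_pos. (l x s - l x (s / \<theta> x)) / s) = 0"
  proof (rule AE_mp, intro AE_I2 impI)
    fix x :: "real^'n"
    assume "\<forall>n. x \<in> cball 0 (real n) \<longrightarrow> (\<integral>\<^sup>+s. ennreal (l x s / s) \<partial>lborel_pos) \<noteq> \<infinity>"
    moreover obtain n where "norm x \<le> real n" using real_arch_simple by blast
    ultimately have fin: "(\<integral>\<^sup>+s. ennreal (l x s / s) \<partial>lborel_pos) \<noteq> \<infinity>" by auto
    have m1: "(\<lambda>s. l x s / s) \<in> borel_measurable lborel_pos" by (intro borel_measurable_divide lx id)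
    have "(\<lambda>s. s / \<theta> x) \<in> lborel_pos \<rightarrow>\<^sub>M lborel_pos"
      by (rule measurable_restrict_space2) (auto intro!: measurable_restrict_space1)
    from measurable_compose[OF this lx]
    have m2: "(\<lambda>s. l x (s / \<theta> x) / s) \<in> borel_measurable lborel_pos" by (intro borel_measurable_divide id)
    have div: "ennreal (l x s) * ennreal (1 / t) = ennreal (l x s / t)" if "s > 0" "t > 0" for s t
      using that l_pos[of s x] by (subst ennreal_mult[symmetric]) auto
    have "(\<integral>\<^sup>+s. ennreal (l x (s / \<theta> x) / s) \<partial>lborel_pos) = (\<integral>\<^sup>+s. ennreal (l x (inverse (\<theta> x) * s)) * ennreal (1 / s) \<partial>lborel_pos)"
    proof (rule nn_integral_cong)
      fix s :: real assume "s \<in> space lborel_pos"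
      then have "s > 0" by simp
      then have "ennreal (l x (s / \<theta> x)) * ennreal (1 / s) = ennreal (l x (s / \<theta> x) / s)"
        by (intro div) auto
      moreover have "inverse (\<theta> x) * s = s / \<theta> x" by (simp add: divide_inverse mult.commute)
      ultimately show "ennreal (l x (s / \<theta> x) / s) = ennreal (l x (inverse (\<theta> x) * s)) * ennreal (1 / s)"
        by (simp only:)
    qed
    also have "\<dots> = (\<integral>\<^sup>+s. ennreal (l x s) * ennreal (1 / s) \<partial>lborel_pos)"
      by (rule nn_integral_lborel_pos_scale) (use lx in auto)
    also have "\<dots> = (\<integral>\<^sup>+s. ennreal (l x s / s) \<partial>lborel_pos)"
      by (rule nn_integral_cong) (simp add: div)
    finally have eq: "(\<integral>\<^sup>+s. ennreal (l x (s / \<theta> x) / s) \<partial>lborel_pos) = (\<integral>\<^sup>+s. ennreal (l x s / s) \<partial>lborel_pos)" .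
    have nn1: "AE s in lborel_pos. 0 \<le> l x s / s" and nn2: "AE s in lborel_pos. 0 \<le> l x (s / \<theta> x) / s"
      by (auto intro!: AE_I2 simp: l_pos less_imp_le)
    have i1: "integrable lborel_pos (\<lambda>s. l x s / s)"
      by (rule integrableI_nonneg[OF m1 nn1]) (use fin in \<open>simp add: less_top\<close>)
    have i2: "integrable lborel_pos (\<lambda>s. l x (s / \<theta> x) / s)"
      by (rule integrableI_nonneg[OF m2 nn2]) (use fin eq in \<open>simp add: less_top\<close>)
    have "(LINT s|lborel_pos. (l x s - l x (s / \<theta> x)) / s) = (LINT s|lborel_pos. l x s / s) - (LINT s|lborel_pos. l x (s / \<theta> x) / s)"
      unfolding diff_divide_distrib by (rule Bochner_Integration.integral_diff[OF i1 i2])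
    also have "\<dots> = 0"
      by (simp only: integral_eq_nn_integral[OF m1 nn1] integral_eq_nn_integral[OF m2 nn2] eq diff_self)
    finally show "(LINT s|lborel_pos. (l x s - l x (s / \<theta> x)) / s) = 0" .
  qed
qed

text \<open>The factors for atoms outside the ball are \<open>1\<close>, so the unordered product is eventually constant along the
  finite sets of atoms, and the integral in the exponent is a finite sum over atoms. In the product of the two
  factors the intermediate value \<open>l x (s / \<theta> x)\<close> cancels.\<close>

lemma density_formula_eq:
  assumes \<eta>: "\<eta> \<in> discrete_radon" and fin: "finite (atoms \<eta> \<inter> \<Lambda>)"
  shows "density_formula l (\<phi>, \<theta>) \<eta> = law_ratio \<eta>"
proof -
  have r: "\<eta> \<in> radon_measures" by (rule discrete_radon_radon[OF \<eta>])
  have rr: "restrict_measure \<Lambda> \<eta> \<in> radon_measures"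
    by (intro discrete_radon_radon restrict_measure_discrete \<eta>) simp
  have s: "measure \<eta> {x} > 0" if "x \<in> atoms \<eta>" for x using that atoms_iff[OF r] by blast
  define g where "g x = l (inv \<phi> x) (measure \<eta> {x} / \<theta> x) / l x (measure \<eta> {x} / \<theta> x) * jac \<phi> x" for x
  define q where "q x = l x (measure \<eta> {x} / \<theta> x) / l x (measure \<eta> {x})" for x
  have g1: "g x = 1" if "x \<in> atoms \<eta>" "x \<notin> \<Lambda>" for x
    using that s[of x] l_pos[of "measure \<eta> {x}" x]
    by (simp add: g_def inv_phi_outside theta_outside jac_outside)
  have q1: "q x = 1" if "x \<in> atoms \<eta>" "x \<notin> \<Lambda>" for x
    using that s[of x] l_pos[of "measure \<eta> {x}" x]
    by (simp add: q_def theta_outside)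
  have q0: "q x > 0" if "x \<in> atoms \<eta>" for x
    using s[OF that] by (simp add: q_def l_pos)
  have "(prod g \<longlongrightarrow> prod g (atoms \<eta> \<inter> \<Lambda>)) (finite_subsets_at_top (atoms \<eta>))"
  proof (rule tendsto_eventually)
    show "\<forall>\<^sub>F F in finite_subsets_at_top (atoms \<eta>). prod g F = prod g (atoms \<eta> \<inter> \<Lambda>)"
      unfolding eventually_finite_subsets_at_top
    proof (intro exI[of _ "atoms \<eta> \<inter> \<Lambda>"] conjI allI impI)
      fix Y assume Y: "finite Y \<and> atoms \<eta> \<inter> \<Lambda> \<subseteq> Y \<and> Y \<subseteq> atoms \<eta>"
      then have "\<forall>x\<in>Y - atoms \<eta> \<inter> \<Lambda>. g x = 1" using g1 by blast
      with Y show "prod g Y = prod g (atoms \<eta> \<inter> \<Lambda>)" by (intro prod.mono_neutral_right) blast+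
    qed (use fin in auto)
  qed
  then have prod: "unordered_prod g (atoms \<eta>) = prod g (atoms \<eta> \<inter> \<Lambda>)"
    unfolding unordered_prod_def by (intro tendsto_Lim) (auto simp: finite_subsets_at_top_neq_bot)
  have "(LINT x|\<eta>. ln (q x) / measure \<eta> {x}) = (\<Sum>x\<in>atoms \<eta> \<inter> \<Lambda>. ln (q x) / measure \<eta> {x} * measure \<eta> {x})"
  proof (rule integral_finite_support[OF r fin])
    fix x assume "x \<notin> atoms \<eta> \<inter> \<Lambda>"
    then show "ln (q x) / measure \<eta> {x} = 0"
      using q1[of x] atoms_iff[OF r, of x] measure_nonneg[of \<eta> "{x}"] by (cases "x \<in> atoms \<eta>") auto
  qed
  also have "\<dots> = (\<Sum>x\<in>atoms \<eta> \<inter> \<Lambda>. ln (q x))"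
  proof (rule sum.cong[OF refl])
    fix x assume "x \<in> atoms \<eta> \<inter> \<Lambda>"
    then have "measure \<eta> {x} > 0" using s by blast
    then show "ln (q x) / measure \<eta> {x} * measure \<eta> {x} = ln (q x)" by simp
  qed
  finally have "exp (LINT x|\<eta>. ln (q x) / measure \<eta> {x}) = (\<Prod>x\<in>atoms \<eta> \<inter> \<Lambda>. exp (ln (q x)))"
    by (simp add: exp_sum[OF fin])
  also have "\<dots> = prod q (atoms \<eta> \<inter> \<Lambda>)"
    using q0 by (intro prod.cong) auto
  finally have ex: "exp (LINT x|\<eta>. ln (q x) / measure \<eta> {x}) = prod q (atoms \<eta> \<inter> \<Lambda>)" .
  have "density_formula l (\<phi>, \<theta>) \<eta> = unordered_prod g (atoms \<eta>) * exp (LINT x|\<eta>. ln (q x) / measure \<eta> {x})"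
    unfolding density_formula_def g_def[abs_def] q_def[abs_def] by (simp add: exponent_integral_zero)
  also have "\<dots> = (\<Prod>x\<in>atoms \<eta> \<inter> \<Lambda>. g x * q x)"
    unfolding prod ex by (rule prod.distrib[symmetric])
  also have "\<dots> = atom_product R mark_density \<eta>"
    unfolding atom_product_def
  proof (rule prod.cong[OF refl])
    fix x assume "x \<in> atoms \<eta> \<inter> \<Lambda>"
    then have "measure \<eta> {x} > 0" using s by blast
    then have "l x (measure \<eta> {x} / \<theta> x) > 0" by (simp add: l_pos)
    then show "g x * q x = mark_density x (measure \<eta> {x})"
      by (simp add: g_def q_def mark_density_def)
  qed
  also have "\<dots> = atom_product R mark_density (restrict_measure \<Lambda> \<eta>)"
    unfolding atom_product_def atoms_restrict_measure(1)[OF r]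
    by (rule prod.cong) (auto simp: atoms_restrict_measure(2)[OF r])
  also have "\<dots> = law_ratio \<eta>"
    using fin finite_atoms_iff[OF rr, of R] unfolding atoms_restrict_measure(1)[OF r]
    by (simp add: law_ratio_def law_density_def)
  finally show ?thesis .
qed

theorem quasi_invariance:
  "equivalent_measures (transformed_law (\<phi>, \<theta>) \<mu>) \<mu> \<and>
    (AE \<eta> in \<mu>. RN_deriv \<mu> (transformed_law (\<phi>, \<theta>) \<mu>) \<eta> = ennreal (density_formula l (\<phi>, \<theta>) \<eta>))"
proof
  show "equivalent_measures (transformed_law (\<phi>, \<theta>) \<mu>) \<mu>"
    unfolding equivalent_measures_def
  proof
    show "absolutely_continuous \<mu> (transformed_law (\<phi>, \<theta>) \<mu>)"
      unfolding transformed_law_density by (rule absolutely_continuousI_density) simp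
    show "absolutely_continuous (transformed_law (\<phi>, \<theta>) \<mu>) \<mu>"
      unfolding transformed_law_density absolutely_continuous_def
    proof
      fix N assume "N \<in> null_sets (density \<mu> (\<lambda>\<eta>. ennreal (law_ratio \<eta>)))"
      then have N: "N \<in> sets \<mu>" "AE \<eta> in \<mu>. \<eta> \<in> N \<longrightarrow> ennreal (law_ratio \<eta>) = 0"
        by (auto simp: null_sets_density_iff)
      from N(2) have "AE \<eta> in \<mu>. \<eta> \<notin> N"
      proof (rule AE_mp, intro AE_I2 impI)
        fix \<eta> assume "\<eta> \<in> space \<mu>" "\<eta> \<in> N \<longrightarrow> ennreal (law_ratio \<eta>) = 0"
        with law_ratio_pos[of \<eta>] show "\<eta> \<notin> N" by (auto simp: ennreal_eq_0_iff)
      qed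
      then show "N \<in> null_sets \<mu>" using N(1) by (simp add: AE_iff_null_sets)
    qed
  qed
  have "AE \<eta> in \<mu>. ennreal (law_ratio \<eta>) = RN_deriv \<mu> (transformed_law (\<phi>, \<theta>) \<mu>) \<eta>"
    by (rule RN_deriv_unique) (simp_all add: transformed_law_density)
  with AE_finite_atoms AE_space show "AE \<eta> in \<mu>. RN_deriv \<mu> (transformed_law (\<phi>, \<theta>) \<mu>) \<eta> = ennreal (density_formula l (\<phi>, \<theta>) \<eta>)"
    by eventually_elim (simp add: space_mu density_formula_eq)
qed

end

theorem theorem38:
  fixes l :: "real^'n::finite \<Rightarrow> real \<Rightarrow> real"
    and \<mu> :: "(real^'n) measure measure"
    and \<phi> :: "real^'n \<Rightarrow> real^'n" and \<theta> :: "real^'n \<Rightarrow> real"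
  assumes l_meas: "(\<lambda>(x, s). l x s) \<in> borel_measurable (lborel \<Otimes>\<^sub>M lborel_pos)"
    and l_pos: "\<And>x s. s > 0 \<Longrightarrow> l x s > 0"
    and l_int: "\<And>A. A \<in> B0 \<Longrightarrow>
      (\<integral>\<^sup>+p\<in>A \<times> {0<..}. (case p of (x, s) \<Rightarrow> ennreal (l x s * min (inverse s) 1))
         \<partial>(lborel \<Otimes>\<^sub>M lborel_pos)) < \<infinity>"
    and m_fin: "\<And>\<Lambda>. \<Lambda> \<in> B0 \<Longrightarrow> emeasure (intensity l) (\<Lambda> \<times> {0<..}) < \<infinity>"
    and \<mu>: "random_measure_law (intensity l) \<mu>"
    and g: "(\<phi>, \<theta>) \<in> gauge_group"
  shows "equivalent_measures (transformed_law (\<phi>, \<theta>) \<mu>) \<mu> \<and>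
    (AE \<eta> in \<mu>. RN_deriv \<mu> (transformed_law (\<phi>, \<theta>) \<mu>) \<eta> =
       ennreal (density_formula l (\<phi>, \<theta>) \<eta>))"
proof -
  have phi: "\<phi> \<in> Diff0" and theta: "\<theta> \<in> C0_pos" using g by (auto simp: gauge_group_def)
  obtain K where K: "compact K" "\<And>x. x \<notin> K \<Longrightarrow> \<phi> x = x"
    using Diff0_support[OF phi] by blast
  obtain L where L: "compact L" "\<And>x. x \<notin> L \<Longrightarrow> \<theta> x = 1"
    using theta by (auto simp: C0_pos_def)
  have "bounded (K \<union> L)" using K(1) L(1) by (simp add: compact_imp_bounded)
  then obtain R where R: "R > 0" "K \<union> L \<subseteq> ball 0 R"
    by (rule bounded_subset_ballD[THEN exE]) blast
  have KL: "K \<subseteq> cball 0 R" "L \<subseteq> cball 0 R" using R(2) ball_subset_cball[of 0 R] by auto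
  interpret gauge_law l \<phi> \<theta> \<mu> R
  proof
    show "\<phi> x = x" if "x \<notin> cball 0 R" for x using K(2)[of x] KL(1) that by blast
    show "\<theta> x = 1" if "x \<notin> cball 0 R" for x using L(2)[of x] KL(2) that by blast
    show "emeasure (intensity l) (cball 0 r \<times> {0<..}) < \<infinity>" for r
      by (rule m_fin) (simp add: B0_def)
  qed (use l_meas l_pos phi theta R(1) \<mu> in auto)
  show ?thesis by (rule quasi_invariance)
qed

end
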